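(* The spin chain representation of the 2BTL algebra on $(\mathbb C^2)^{\otimes N}$ with twist parameter $\theta$ is equivalent (isomorphic as a module) to the $2^N$-dimensional representation $W^{(N)}(b)$, where $b$ is determined by $\theta$ through $$b=\frac{[(\omega_1+\omega_2+1+\theta)/2][(\omega_1+\omega_2+1-\theta)/2]}{[\omega_1+1][\omega_2+1]}\ (N\text{ even}),\qquad b=-\frac{[(\omega_1-\omega_2+\theta)/2][(\omega_1-\omega_2-\theta)/2]}{[\omega_1+1][\omega_2+1]}\ (N\text{ odd}).$$
   Context: Let $N\ge2$. Fix complex numbers $\eta,\omega_1,\omega_2,\theta$; write $q^x=e^{\eta x}$ and $[x]=\frac{q^x-q^{-x}}{q-q^{-1}}$. Parameters are generic: $q$ is not a root of unity, $[\omega_1-m]\neq0$ for all $m\in\mathbb Z$, $[\omega_2],[\omega_2+1]\ne0$, and $q^\theta$ is not of the form $q^{\pm(-n+\epsilon_1\omega_1+\epsilon_2\omega_2)}$ with $\epsilon_1,\epsilon_2=\pm1$ and $0\le n\le N-1$, $n\equiv N-1\pmod 2$. Put $\delta=[2]$, $s_1=\frac{[\omega_1]}{[\omega_1+1]}$, $s_2=\frac{[\omega_2]}{[\omega_2+1]}$. The 2BTL algebra is the unital complex algebra with generators $e_0,\dots,e_N$ and relations $e_i^2=\delta e_i$, $e_ie_{i\pm1}e_i=e_i$ for $1\le i\le N-1$ (with $i\pm1\in\{0,\dots,N\}$), $e_0^2=s_1e_0$, $e_N^2=s_2e_N$, $e_ie_j=e_je_i$ for $|i-j|>1$. For $N$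 even set $I_1=e_1e_3\cdots e_{N-1}$, $I_2=e_0e_2\cdots e_N$; for $N$ odd set $I_1=e_1e_3\cdots e_N$, $I_2=e_0e_2\cdots e_{N-1}$. The double quotient $\mathcal A_b$ is the quotient of 2BTL by $I_1I_2I_1=bI_1$, $I_2I_1I_2=bI_2$. Define $E_0=1$ and $E_i=s_1^{(-1)^i}E_{i-1}e_{i-1}E_{i-1}$ for $1\le i\le N$ (idempotents). The $2^N$-dimensional module $W^{(N)}(b)$ is realised as the left ideal $\mathcal A_bE_N$. Spin chain representation on $(\mathbb C^2)^{\otimes N}$: with $\sigma^+=\begin{pmatrix}0&1\\0&0\end{pmatrix}$, $\sigma^-=\begin{pmatrix}0&0\\1&0\end{pmatrix}$, $\sigma^z=\begin{pmatrix}1&0\\0&-1\end{pmatrix}$ and $\sigma_i$ denoting the action on the $i$-th tensor factor, $$e_0=\tfrac{1}{q^{\omega_1+1}-q^{-\omega_1-1}}\{\sigma_1^+-\sigma_1^--\tfrac12(q^{\omega_1}+q^{-\omega_1})\sigma_1^z+\tfrac12(q^{\omega_1}-q^{-\omega_1})\},$$ $$e_i=-\Big\{\sigma_i^+\sigma_{i+1}^-+\sigma_i^-\sigma_{i+1}^++\tfrac{q+q^{-1}}4(\sigma_i^z\sigma_{i+1}^z-1)+\tfrac{q-q^{-1}}4(\sigma_i^z-\sigma_{i+1}^z)\Big\},\quad 1\le i\le N-1,$$ $$e_N=\tfrac{1}{q^{\omega_2+1}-q^{-\omega_2-1}}\{-q^\theta\sigma_N^++q^{-\theta}\sigma_N^-+\tfrac12(q^{\omega_2}+q^{-\omega_2})\sigma_N^z+\tfrac12(q^{\omega_2}-q^{-\omega_2})\}.$$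 *)

theory Defs
  imports
    Complex_Main
    "HOL-Library.Poly_Mapping"
    "HOL-Algebra.QuotRing"
    "HOL-Algebra.Module"
    "Jordan_Normal_Form.Matrix"
begin

hide_const (open) Multiset.mult  (* clashes with the ring record field *)

section \<open>Modules over a not necessarily commutative ring\<close>

text \<open>
  The library locale \<open>module\<close> requires a commutative ring of scalars. The following is the same
  list of axioms over an arbitrary ring; the module record is reused, with its \<open>mult\<close> and \<open>one\<close>
  fields irrelevant.
\<close>

locale left_module = R?: ring R + M?: abelian_group M
  for R :: "('a, 'c) ring_scheme" (structure) and M :: "('a, 'b, 'd) module_scheme" (structure) +
  assumes smult_closed:
      "\<lbrakk>a \<in> carrier R; x \<in> carrier M\<rbrakk> \<Longrightarrow> a \<odot>\<^bsub>M\<^esub> x \<in> carrier M"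
    and smult_l_distr:
      "\<lbrakk>a \<in> carrier R; b \<in> carrier R; x \<in> carrier M\<rbrakk> \<Longrightarrow>
        (a \<oplus>\<^bsub>R\<^esub> b) \<odot>\<^bsub>M\<^esub> x = a \<odot>\<^bsub>M\<^esub> x \<oplus>\<^bsub>M\<^esub> b \<odot>\<^bsub>M\<^esub> x"
    and smult_r_distr:
      "\<lbrakk>a \<in> carrier R; x \<in> carrier M; y \<in> carrier M\<rbrakk> \<Longrightarrow>
        a \<odot>\<^bsub>M\<^esub> (x \<oplus>\<^bsub>M\<^esub> y) = a \<odot>\<^bsub>M\<^esub> x \<oplus>\<^bsub>M\<^esub> a \<odot>\<^bsub>M\<^esub> y"
    and smult_assoc:
      "\<lbrakk>a \<in> carrier R; b \<in> carrier R; x \<in> carrier M\<rbrakk> \<Longrightarrow>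
        (a \<otimes>\<^bsub>R\<^esub> b) \<odot>\<^bsub>M\<^esub> x = a \<odot>\<^bsub>M\<^esub> (b \<odot>\<^bsub>M\<^esub> x)"
    and smult_one:
      "x \<in> carrier M \<Longrightarrow> \<one>\<^bsub>R\<^esub> \<odot>\<^bsub>M\<^esub> x = x"

definition left_module_iso ::
    "('a, 'c) ring_scheme \<Rightarrow> ('a, 'b, 'd) module_scheme \<Rightarrow> ('a, 'e, 'f) module_scheme \<Rightarrow> ('b \<Rightarrow> 'e) set"
where
  "left_module_iso R M M' = {\<phi>. bij_betw \<phi> (carrier M) (carrier M') \<and>
     (\<forall>x\<in>carrier M. \<forall>y\<in>carrier M. \<phi> (x \<oplus>\<^bsub>M\<^esub> y) = \<phi> x \<oplus>\<^bsub>M'\<^esub> \<phi> y) \<and>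
     (\<forall>a\<in>carrier R. \<forall>x\<in>carrier M. \<phi> (a \<odot>\<^bsub>M\<^esub> x) = a \<odot>\<^bsub>M'\<^esub> \<phi> x)}"

definition isomorphic_left_modules ::
    "('a, 'c) ring_scheme \<Rightarrow> ('a, 'b, 'd) module_scheme \<Rightarrow> ('a, 'e, 'f) module_scheme \<Rightarrow> bool"
where
  "isomorphic_left_modules R M M' \<longleftrightarrow>
     left_module R M \<and> left_module R M' \<and> left_module_iso R M M' \<noteq> {}"


section \<open>The free algebra\<close>

text \<open>
  Finitely supported functions on the free monoid of words form, with the convolution product of
  \<^theory>\<open>HOL-Library.Poly_Mapping\<close>, the free unital complex algebra on countably many letters.
\<close>

datatype word = Word (letters: "nat list")

instantiation word :: monoid_add
begin

definition zero_word :: word where "zero_word = Word []"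

definition plus_word :: "word \<Rightarrow> word \<Rightarrow> word"
  where "plus_word u v = Word (letters u @ letters v)"

instance
  by standard (simp_all add: zero_word_def plus_word_def)

end

type_synonym free = "word \<Rightarrow>\<^sub>0 complex"

definition gen :: "nat \<Rightarrow> free"
  where "gen i = Poly_Mapping.single (Word [i]) 1"

definition scal :: "complex \<Rightarrow> free"
  where "scal c = Poly_Mapping.single 0 c"

definition free_alg :: "nat \<Rightarrow> free ring"
  where "free_alg N =
    \<lparr>carrier = {p. \<forall>w \<in> Poly_Mapping.keys p. set (letters w) \<subseteq> {0..N}},
     mult = (*), one = 1, zero = 0, add = (+)\<rparr>"


section \<open>Parameters\<close>

definition qpow :: "complex \<Rightarrow> complex \<Rightarrow> complex"
  where "qpow \<eta> x = exp (\<eta> * x)"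

definition qnum :: "complex \<Rightarrow> complex \<Rightarrow> complex"
  where "qnum \<eta> x = (qpow \<eta> x - qpow \<eta> (- x)) / (qpow \<eta> 1 - qpow \<eta> (- 1))"

definition bweight :: "complex \<Rightarrow> complex \<Rightarrow> complex"
  where "bweight \<eta> \<omega> = qnum \<eta> \<omega> / qnum \<eta> (\<omega> + 1)"


section \<open>The two-boundary Temperley--Lieb algebra and its double quotient\<close>

definition tbtl_relations :: "nat \<Rightarrow> complex \<Rightarrow> complex \<Rightarrow> complex \<Rightarrow> free set"
  where "tbtl_relations N \<eta> \<omega>\<^sub>1 \<omega>\<^sub>2 =
    {gen i * gen i - scal (qnum \<eta> 2) * gen i | i. 1 \<le> i \<and> i \<le> N - 1} \<union>
    {gen i * gen j * gen i - gen i | i j. 1 \<le> i \<and> i \<le> N - 1 \<and> (j = i + 1 \<or> j = i - 1)} \<union>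
    {gen 0 * gen 0 - scal (bweight \<eta> \<omega>\<^sub>1) * gen 0} \<union>
    {gen N * gen N - scal (bweight \<eta> \<omega>\<^sub>2) * gen N} \<union>
    {gen i * gen j - gen j * gen i | i j. i \<le> N \<and> j \<le> N \<and> (i + 1 < j \<or> j + 1 < i)}"

text \<open>
  The constants \<open>scal c\<close> lie in the free algebra, so a (two-sided) ring ideal is automatically a
  complex subspace, and the quotients are complex algebras in which \<open>c\<close> acts as the class of
  \<open>scal c\<close>. For the same reason, modules over \<open>tbtl\<close> are complex vector spaces and additive maps
  between them that commute with the action of \<open>tbtl\<close> are complex linear.
\<close>

definition tbtl_ideal :: "nat \<Rightarrow> complex \<Rightarrow> complex \<Rightarrow> complex \<Rightarrow> free set"
  where "tbtl_ideal N \<eta> \<omega>\<^sub>1 \<omega>\<^sub>2 = Idl\<^bsub>free_alg N\<^esub> (tbtl_relations N \<eta> \<omega>\<^sub>1 \<omega>\<^sub>2)"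

definition tbtl :: "nat \<Rightarrow> complex \<Rightarrow> complex \<Rightarrow> complex \<Rightarrow> free set ring"
  where "tbtl N \<eta> \<omega>\<^sub>1 \<omega>\<^sub>2 = free_alg N Quot tbtl_ideal N \<eta> \<omega>\<^sub>1 \<omega>\<^sub>2"

definition tbtl_class :: "nat \<Rightarrow> complex \<Rightarrow> complex \<Rightarrow> complex \<Rightarrow> free \<Rightarrow> free set"
  where "tbtl_class N \<eta> \<omega>\<^sub>1 \<omega>\<^sub>2 p = tbtl_ideal N \<eta> \<omega>\<^sub>1 \<omega>\<^sub>2 +>\<^bsub>free_alg N\<^esub> p"

definition I1 :: "nat \<Rightarrow> free"
  where "I1 N = prod_list (map gen (filter odd [0..<Suc N]))"

definition I2 :: "nat \<Rightarrow> free"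
  where "I2 N = prod_list (map gen (filter even [0..<Suc N]))"

definition double_ideal :: "nat \<Rightarrow> complex \<Rightarrow> complex \<Rightarrow> complex \<Rightarrow> complex \<Rightarrow> free set set"
  where "double_ideal N \<eta> \<omega>\<^sub>1 \<omega>\<^sub>2 b = Idl\<^bsub>tbtl N \<eta> \<omega>\<^sub>1 \<omega>\<^sub>2\<^esub>
    {tbtl_class N \<eta> \<omega>\<^sub>1 \<omega>\<^sub>2 (I1 N * I2 N * I1 N - scal b * I1 N),
     tbtl_class N \<eta> \<omega>\<^sub>1 \<omega>\<^sub>2 (I2 N * I1 N * I2 N - scal b * I2 N)}"

definition double_quot :: "nat \<Rightarrow> complex \<Rightarrow> complex \<Rightarrow> complex \<Rightarrow> complex \<Rightarrow> free set set ring"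
  where "double_quot N \<eta> \<omega>\<^sub>1 \<omega>\<^sub>2 b = tbtl N \<eta> \<omega>\<^sub>1 \<omega>\<^sub>2 Quot double_ideal N \<eta> \<omega>\<^sub>1 \<omega>\<^sub>2 b"

definition double_class ::
    "nat \<Rightarrow> complex \<Rightarrow> complex \<Rightarrow> complex \<Rightarrow> complex \<Rightarrow> free set \<Rightarrow> free set set"
  where "double_class N \<eta> \<omega>\<^sub>1 \<omega>\<^sub>2 b a = double_ideal N \<eta> \<omega>\<^sub>1 \<omega>\<^sub>2 b +>\<^bsub>tbtl N \<eta> \<omega>\<^sub>1 \<omega>\<^sub>2\<^esub> a"


section \<open>The module \<open>W\<close>\<close>

fun Eidem :: "complex \<Rightarrow> complex \<Rightarrow> nat \<Rightarrow> free"
  where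
    "Eidem \<eta> \<omega>\<^sub>1 0 = 1"
  | "Eidem \<eta> \<omega>\<^sub>1 (Suc i) =
       scal (bweight \<eta> \<omega>\<^sub>1 powi ((- 1) ^ Suc i)) * Eidem \<eta> \<omega>\<^sub>1 i * gen i * Eidem \<eta> \<omega>\<^sub>1 i"

definition W_module ::
    "nat \<Rightarrow> complex \<Rightarrow> complex \<Rightarrow> complex \<Rightarrow> complex \<Rightarrow> (free set, free set set) module"
  where "W_module N \<eta> \<omega>\<^sub>1 \<omega>\<^sub>2 b =
    (let A = double_quot N \<eta> \<omega>\<^sub>1 \<omega>\<^sub>2 b;
         E = double_class N \<eta> \<omega>\<^sub>1 \<omega>\<^sub>2 b (tbtl_class N \<eta> \<omega>\<^sub>1 \<omega>\<^sub>2 (Eidem \<eta> \<omega>\<^sub>1 N))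
     in \<lparr>carrier = {x \<otimes>\<^bsub>A\<^esub> E | x. x \<in> carrier A},
         mult = undefined, one = undefined,
         zero = \<zero>\<^bsub>A\<^esub>, add = add A,
         smult = (\<lambda>a x. double_class N \<eta> \<omega>\<^sub>1 \<omega>\<^sub>2 b a \<otimes>\<^bsub>A\<^esub> x)\<rparr>)"


section \<open>The spin chain representation\<close>

text \<open>
  The \<open>N\<close>-fold tensor power of \<open>\<complex>\<^sup>2\<close> is \<open>\<complex>\<close> to the power \<open>2 ^ N\<close>, operators being identified with
  matrices through the Kronecker product (first tensor factor most significant).
\<close>

definition kron :: "complex mat \<Rightarrow> complex mat \<Rightarrow> complex mat"
  where "kron A B = mat (dim_row A * dim_row B) (dim_col A * dim_col B)
    (\<lambda>(i, j). A $$ (i div dim_row B, j div dim_col B) * B $$ (i mod dim_row B, j mod dim_col B))"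

definition sigma_plus :: "complex mat" where "sigma_plus = mat_of_rows_list 2 [[0, 1], [0, 0]]"
definition sigma_minus :: "complex mat" where "sigma_minus = mat_of_rows_list 2 [[0, 0], [1, 0]]"
definition sigma_z :: "complex mat" where "sigma_z = mat_of_rows_list 2 [[1, 0], [0, - 1]]"

text \<open>Tensor factors are numbered from \<open>1\<close> to \<open>N\<close>.\<close>

definition site :: "nat \<Rightarrow> complex mat \<Rightarrow> nat \<Rightarrow> complex mat"
  where "site N A i = kron (kron (1\<^sub>m (2 ^ (i - 1))) A) (1\<^sub>m (2 ^ (N - i)))"

definition spin_left :: "nat \<Rightarrow> complex \<Rightarrow> complex \<Rightarrow> complex mat"
  where "spin_left N \<eta> \<omega>\<^sub>1 =
    (1 / (qpow \<eta> (\<omega>\<^sub>1 + 1) - qpow \<eta> (- \<omega>\<^sub>1 - 1))) \<cdot>\<^sub>m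
      (site N sigma_plus 1 - site N sigma_minus 1
       - (1/2 * (qpow \<eta> \<omega>\<^sub>1 + qpow \<eta> (- \<omega>\<^sub>1))) \<cdot>\<^sub>m site N sigma_z 1
       + (1/2 * (qpow \<eta> \<omega>\<^sub>1 - qpow \<eta> (- \<omega>\<^sub>1))) \<cdot>\<^sub>m 1\<^sub>m (2 ^ N))"

definition spin_bulk :: "nat \<Rightarrow> complex \<Rightarrow> nat \<Rightarrow> complex mat"
  where "spin_bulk N \<eta> i =
    - (site N sigma_plus i * site N sigma_minus (i + 1)
       + site N sigma_minus i * site N sigma_plus (i + 1)
       + ((qpow \<eta> 1 + qpow \<eta> (- 1)) / 4) \<cdot>\<^sub>m
           (site N sigma_z i * site N sigma_z (i + 1) - 1\<^sub>m (2 ^ N))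
       + ((qpow \<eta> 1 - qpow \<eta> (- 1)) / 4) \<cdot>\<^sub>m
           (site N sigma_z i - site N sigma_z (i + 1)))"

definition spin_right :: "nat \<Rightarrow> complex \<Rightarrow> complex \<Rightarrow> complex \<Rightarrow> complex mat"
  where "spin_right N \<eta> \<omega>\<^sub>2 \<theta> =
    (1 / (qpow \<eta> (\<omega>\<^sub>2 + 1) - qpow \<eta> (- \<omega>\<^sub>2 - 1))) \<cdot>\<^sub>m
      ((- qpow \<eta> \<theta>) \<cdot>\<^sub>m site N sigma_plus N + qpow \<eta> (- \<theta>) \<cdot>\<^sub>m site N sigma_minus N
       + (1/2 * (qpow \<eta> \<omega>\<^sub>2 + qpow \<eta> (- \<omega>\<^sub>2))) \<cdot>\<^sub>m site N sigma_z N
       + (1/2 * (qpow \<eta> \<omega>\<^sub>2 - qpow \<eta> (- \<omega>\<^sub>2))) \<cdot>\<^sub>m 1\<^sub>m (2 ^ N))"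

definition spin_gen ::
    "nat \<Rightarrow> complex \<Rightarrow> complex \<Rightarrow> complex \<Rightarrow> complex \<Rightarrow> nat \<Rightarrow> complex mat"
  where "spin_gen N \<eta> \<omega>\<^sub>1 \<omega>\<^sub>2 \<theta> i =
    (if i = 0 then spin_left N \<eta> \<omega>\<^sub>1
     else if i = N then spin_right N \<eta> \<omega>\<^sub>2 \<theta>
     else spin_bulk N \<eta> i)"

definition spin_word ::
    "nat \<Rightarrow> complex \<Rightarrow> complex \<Rightarrow> complex \<Rightarrow> complex \<Rightarrow> word \<Rightarrow> complex mat"
  where "spin_word N \<eta> \<omega>\<^sub>1 \<omega>\<^sub>2 \<theta> w =
    foldr (\<lambda>i M. spin_gen N \<eta> \<omega>\<^sub>1 \<omega>\<^sub>2 \<theta> i * M) (letters w) (1\<^sub>m (2 ^ N))"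

definition spin_free ::
    "nat \<Rightarrow> complex \<Rightarrow> complex \<Rightarrow> complex \<Rightarrow> complex \<Rightarrow> free \<Rightarrow> complex mat"
  where "spin_free N \<eta> \<omega>\<^sub>1 \<omega>\<^sub>2 \<theta> p =
    (\<Oplus>\<^bsub>ring_mat TYPE(complex) (2 ^ N) ()\<^esub> w \<in> Poly_Mapping.keys p.
       Poly_Mapping.lookup p w \<cdot>\<^sub>m spin_word N \<eta> \<omega>\<^sub>1 \<omega>\<^sub>2 \<theta> w)"

text \<open>
  The map induced on cosets. It is meaningful only because \<open>spin_free\<close> is constant on each coset,
  that is, because the matrices \<open>spin_gen\<close> satisfy the defining relations.
\<close>

definition spin_rep ::
    "nat \<Rightarrow> complex \<Rightarrow> complex \<Rightarrow> complex \<Rightarrow> complex \<Rightarrow> free set \<Rightarrow> complex mat"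
  where "spin_rep N \<eta> \<omega>\<^sub>1 \<omega>\<^sub>2 \<theta> X = the_elem (spin_free N \<eta> \<omega>\<^sub>1 \<omega>\<^sub>2 \<theta> ` X)"

definition spin_module ::
    "nat \<Rightarrow> complex \<Rightarrow> complex \<Rightarrow> complex \<Rightarrow> complex \<Rightarrow> (free set, complex vec) module"
  where "spin_module N \<eta> \<omega>\<^sub>1 \<omega>\<^sub>2 \<theta> =
    \<lparr>carrier = carrier_vec (2 ^ N), mult = undefined, one = undefined,
     zero = 0\<^sub>v (2 ^ N), add = (+),
     smult = (\<lambda>a v. spin_rep N \<eta> \<omega>\<^sub>1 \<omega>\<^sub>2 \<theta> a *\<^sub>v v)\<rparr>"

end

theory Submission
  imports Defs "Jordan_Normal_Form.Determinant"
begin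

text \<open>
  The generators act on functions of spin configurations. Every \<open>e\<^sub>i\<close> is local and has rank one
  on the sites it touches; pulling a boundary operator through the zigzags of \<open>I\<^sub>1I\<^sub>2I\<^sub>1\<close> and
  \<open>I\<^sub>2I\<^sub>1I\<^sub>2\<close> leaves one scalar, which is \<open>b\<close>, so the spin chain is a module over the double
  quotient. In it \<open>E\<^sub>N\<close> fixes the product vector with factors \<open>(1, q^\<omega>\<^sub>1)\<close> and
  \<open>(1, q^(-\<omega>\<^sub>1-1))\<close> in turn. This vector is cyclic: a factor \<open>(1, y)\<close> travels to the right by the
  bulk generators, losing a factor \<open>q\<close> at each step, and at the last site \<open>e\<^sub>N\<close> turns it into a
  linearly independent one; the conditions on \<open>q^\<theta>\<close> guarantee that this never fails.

  In the double quotient, \<open>2 ^ N\<close> words applied to \<open>E\<^sub>N\<close>, one for each sign sequence, span the left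
  ideal. This needs \<open>b \<noteq> 0\<close>, through a relation making \<open>e\<^sub>N\<^sub>-\<^sub>1 e\<^sub>N E\<^sub>N\<close> a nonzero multiple of
  \<open>e\<^sub>N\<^sub>-\<^sub>1 E\<^sub>N\<close>. The images of the \<open>2 ^ N\<close> words span the spin chain, hence are independent there,
  so sending \<open>p E\<^sub>N\<close> to \<open>p\<close> applied to the cyclic vector is an isomorphism.
\<close>

section \<open>The free algebra\<close>

text \<open>No normal form is established inside the double quotient. It supplies only the upper
  bound \<open>2 ^ N\<close>, the spin chain supplies the lower one, and their agreement makes a map
  that is easily seen to be well defined injective. Hence most scalars on the algebraic side need
  not be computed; it is enough that certain ones are nonzero.

  The conditions on \<open>q^\<theta>\<close> enter twice. The factor of site \<open>m\<close>
  arrives at site \<open>N\<close> as \<open>(1, y)\<close> with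
  \<open>y = xs m / q ^ (N - m)\<close>. There \<open>e_N\<close> has image
  \<open>(1, 1 / (t * z))\<close> and kills \<open>(1, y)\<close> if \<open>z = t * y\<close>. The
  two bad coincidences make \<open>t\<close> equal to \<open>q ^ n\<close> times a product of
  \<open>x\<close> or \<open>1 / x\<close> with \<open>z\<close> or \<open>1 / z\<close>, where
  \<open>n\<close> is \<open>N - m\<close> for odd \<open>m\<close> and \<open>N - m + 1\<close> for
  even \<open>m\<close>; both have the parity of \<open>N - 1\<close>. The same conditions with
  \<open>n = 1\<close> for even \<open>N\<close> and \<open>n = 0\<close> for odd \<open>N\<close>
  exclude the zeros of \<open>b\<close>.

  Operators act on functions of configurations, so that a relation is checked on the few sites it
  touches instead of on Kronecker products.\<close>

lemma scal_0 [simp]: "scal 0 = 0"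
  by (simp add: scal_def)

lemma scal_1 [simp]: "scal 1 = 1"
  by (simp add: scal_def)

lemma scal_add: "scal (c + d) = scal c + scal d"
  by (simp add: scal_def single_add)

lemma scal_mult: "scal (c * d) = scal c * scal d"
  by (simp add: scal_def mult_single)

lemma scal_times_single: "scal c * Poly_Mapping.single w d = Poly_Mapping.single w (c * d)"
  by (simp add: scal_def mult_single)

lemma single_times_scal: "Poly_Mapping.single w d * scal c = Poly_Mapping.single w (d * c)"
  by (simp add: scal_def mult_single)

lemma poly_mapping_sum_single:
  "(\<Sum>w\<in>Poly_Mapping.keys p. Poly_Mapping.single w (Poly_Mapping.lookup p w)) = p"
proof (rule poly_mapping_eqI)
  fix k
  show "Poly_Mapping.lookup (\<Sum>w\<in>Poly_Mapping.keys p. Poly_Mapping.single w (Poly_Mapping.lookup p w)) k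
      = Poly_Mapping.lookup p k"
    by (cases "k \<in> Poly_Mapping.keys p")
      (auto simp: lookup_sum lookup_single when_def in_keys_iff)
qed

lemma scal_commute: "scal c * p = p * scal c"
proof -
  have "scal c * (\<Sum>w\<in>Poly_Mapping.keys p. Poly_Mapping.single w (Poly_Mapping.lookup p w))
      = (\<Sum>w\<in>Poly_Mapping.keys p. Poly_Mapping.single w (Poly_Mapping.lookup p w)) * scal c"
    by (simp add: sum_distrib_left sum_distrib_right scal_times_single single_times_scal mult.commute)
  then show ?thesis
    by (simp only: poly_mapping_sum_single)
qed

lemma scal_left_commute: "p * (scal c * r) = scal c * (p * r)"
  by (metis mult.assoc scal_commute)

lemma single_Word_Cons: "Poly_Mapping.single (Word (i # u)) c = gen i * Poly_Mapping.single (Word u) c"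
  by (simp add: gen_def mult_single plus_word_def)

lemma single_Word_Nil: "Poly_Mapping.single (Word []) c = scal c"
  by (simp add: scal_def zero_word_def)

abbreviation carr :: "nat \<Rightarrow> free set"
  where "carr N \<equiv> carrier (free_alg N)"

lemma free_alg_simps [simp]:
  "x \<otimes>\<^bsub>free_alg N\<^esub> y = x * y" "x \<oplus>\<^bsub>free_alg N\<^esub> y = x + y"
  "\<one>\<^bsub>free_alg N\<^esub> = 1" "\<zero>\<^bsub>free_alg N\<^esub> = 0"
  by (simp_all add: free_alg_def)

lemma carr_iff: "p \<in> carr N \<longleftrightarrow> (\<forall>w \<in> Poly_Mapping.keys p. set (letters w) \<subseteq> {0..N})"
  by (simp add: free_alg_def)

lemma carr_single: "set (letters w) \<subseteq> {0..N} \<Longrightarrow> Poly_Mapping.single w c \<in> carr N"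
  by (simp add: carr_iff)

lemma carr_scal [simp, intro]: "scal c \<in> carr N"
  by (simp add: scal_def carr_single zero_word_def)

lemma carr_0 [simp, intro]: "0 \<in> carr N" and carr_1 [simp, intro]: "1 \<in> carr N"
  using carr_scal[of 0 N] carr_scal[of 1 N] by simp_all

lemma carr_gen [simp, intro]: "i \<le> N \<Longrightarrow> gen i \<in> carr N"
  by (simp add: gen_def carr_single)

lemma carr_add [simp, intro]: "p \<in> carr N \<Longrightarrow> r \<in> carr N \<Longrightarrow> p + r \<in> carr N"
  using keys_add[of p r] by (fastforce simp: carr_iff)

lemma carr_diff [simp, intro]: "p \<in> carr N \<Longrightarrow> r \<in> carr N \<Longrightarrow> p - r \<in> carr N"
  using keys_diff[of p r] by (fastforce simp: carr_iff)

lemma carr_minus [simp, intro]: "p \<in> carr N \<Longrightarrow> - p \<in> carr N"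
  using carr_diff[of 0 N p] by simp

lemma carr_mult [simp, intro]: "p \<in> carr N \<Longrightarrow> r \<in> carr N \<Longrightarrow> p * r \<in> carr N"
  using keys_mult[of p r] by (fastforce simp: carr_iff plus_word_def)

lemma carr_prod_list: "(\<And>x. x \<in> set xs \<Longrightarrow> x \<in> carr N) \<Longrightarrow> prod_list xs \<in> carr N"
  by (induction xs) auto

lemma ring_free_alg: "ring (free_alg N)"
proof (rule ringI)
  show "abelian_group (free_alg N)"
  proof (rule abelian_groupI)
    fix x assume "x \<in> carr N"
    then show "\<exists>y\<in>carr N. y \<oplus>\<^bsub>free_alg N\<^esub> x = \<zero>\<^bsub>free_alg N\<^esub>"
      by (intro bexI[of _ "- x"]) auto
  qed (auto simp: algebra_simps)
  show "Group.monoid (free_alg N)"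
    by (rule monoidI) (auto simp: algebra_simps)
qed (auto simp: algebra_simps)

lemma carr_induct [consumes 1, case_names zero add single]:
  assumes "p \<in> carr N"
    and zero: "P 0"
    and add: "\<And>p r. p \<in> carr N \<Longrightarrow> r \<in> carr N \<Longrightarrow> P p \<Longrightarrow> P r \<Longrightarrow> P (p + r)"
    and single: "\<And>u c. set u \<subseteq> {0..N} \<Longrightarrow> P (Poly_Mapping.single (Word u) c)"
  shows "P p"
proof -
  let ?f = "\<lambda>w. Poly_Mapping.single w (Poly_Mapping.lookup p w)"
  have step: "P (sum ?f A) \<and> sum ?f A \<in> carr N" if "finite A" "A \<subseteq> Poly_Mapping.keys p" for A
    using that
  proof (induction A rule: finite_induct)
    case empty
    then show ?case using zero by simp
  next
    case (insert w A)
    have "set (letters w) \<subseteq> {0..N}"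
      using assms(1) insert.prems by (auto simp: carr_iff)
    then have "P (?f w)" and "?f w \<in> carr N"
      using single[of "letters w"] by (auto intro: carr_single)
    with insert add show ?case
      by simp
  qed
  from step[of "Poly_Mapping.keys p"] show ?thesis
    by (simp add: poly_mapping_sum_single)
qed

section \<open>Evaluating the free algebra on operators\<close>

text \<open>A vector of the tensor power is viewed as a function of spin configurations; \<open>True\<close> is
  spin down, the second basis vector of the tensor factor.\<close>

type_synonym cfun = "(nat \<Rightarrow> bool) \<Rightarrow> complex"

definition eval_word :: "(nat \<Rightarrow> cfun \<Rightarrow> cfun) \<Rightarrow> nat list \<Rightarrow> cfun \<Rightarrow> cfun"
  where "eval_word T u F = foldr T u F"

definition eval_free :: "(nat \<Rightarrow> cfun \<Rightarrow> cfun) \<Rightarrow> free \<Rightarrow> cfun \<Rightarrow> cfun"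
  where "eval_free T p F c =
    (\<Sum>w\<in>Poly_Mapping.keys p. Poly_Mapping.lookup p w * eval_word T (letters w) F c)"

locale operators =
  fixes T :: "nat \<Rightarrow> cfun \<Rightarrow> cfun"
  assumes T_add: "T i (\<lambda>c. F c + G c) = (\<lambda>c. T i F c + T i G c)"
    and T_scale: "T i (\<lambda>c. a * F c) = (\<lambda>c. a * T i F c)"
begin

abbreviation ev :: "free \<Rightarrow> cfun \<Rightarrow> cfun" where "ev \<equiv> eval_free T"

lemma eval_word_add: "eval_word T u (\<lambda>c. F c + G c) = (\<lambda>c. eval_word T u F c + eval_word T u G c)"
  by (induction u) (simp_all add: eval_word_def T_add)

lemma eval_word_scale: "eval_word T u (\<lambda>c. a * F c) = (\<lambda>c. a * eval_word T u F c)"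
  by (induction u) (simp_all add: eval_word_def T_scale)

lemma ev_superset:
  assumes "finite A" "Poly_Mapping.keys p \<subseteq> A"
  shows "ev p F c = (\<Sum>w\<in>A. Poly_Mapping.lookup p w * eval_word T (letters w) F c)"
  unfolding eval_free_def
  by (rule sum.mono_neutral_left) (use assms in \<open>auto simp: in_keys_iff\<close>)

lemma ev_plus: "ev (p + r) F c = ev p F c + ev r F c"
proof -
  let ?A = "Poly_Mapping.keys p \<union> Poly_Mapping.keys r"
  have "finite ?A" by simp
  moreover have "Poly_Mapping.keys (p + r) \<subseteq> ?A" by (rule keys_add)
  ultimately show ?thesis
    by (simp add: ev_superset[of ?A] lookup_add distrib_right sum.distrib)
qed

lemma ev_zero [simp]: "ev 0 F c = 0"
  by (simp add: eval_free_def)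

lemma ev_minus: "ev (p - r) F c = ev p F c - ev r F c"
  using ev_plus[of "p - r" r F c] by simp

lemma ev_sum: "ev (sum f A) F c = (\<Sum>i\<in>A. ev (f i) F c)"
  by (induction A rule: infinite_finite_induct) (simp_all add: ev_plus)

lemma ev_single: "ev (Poly_Mapping.single w a) F = (\<lambda>c. a * eval_word T (letters w) F c)"
  by (rule ext) (simp add: eval_free_def)

lemma ev_scal [simp]: "ev (scal a) F = (\<lambda>c. a * F c)"
  unfolding scal_def ev_single by (simp add: zero_word_def eval_word_def)

lemma ev_one [simp]: "ev 1 F = F"
  using ev_scal[of 1] by (simp del: ev_scal)

lemma ev_gen [simp]: "ev (gen i) F = T i F"
  by (simp add: gen_def ev_single eval_word_def)

lemma ev_add: "ev p (\<lambda>c. F c + G c) = (\<lambda>c. ev p F c + ev p G c)"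
  by (rule ext) (simp add: eval_free_def eval_word_add distrib_left sum.distrib)

lemma ev_scale: "ev p (\<lambda>c. a * F c) = (\<lambda>c. a * ev p F c)"
  by (rule ext) (simp add: eval_free_def eval_word_scale sum_distrib_left mult.left_commute)

lemma ev_null: "ev p (\<lambda>c. 0) = (\<lambda>c. 0)"
  using ev_scale[of p 0 "\<lambda>c. 0"] by simp

lemma ev_sum_arg: "ev p (\<lambda>c. \<Sum>i\<in>A. F i c) = (\<lambda>c. \<Sum>i\<in>A. ev p (F i) c)"
  by (induction A rule: infinite_finite_induct) (simp_all add: ev_null ev_add)

text \<open>Both factors are expanded into monomials, where the product concatenates words and
  \<open>foldr\<close> composes operators; linearity of \<open>T\<close> handles the sums.\<close>

lemma ev_mult: "ev (p * r) F = ev p (ev r F)"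
proof -
  have single_single: "ev (Poly_Mapping.single u a * Poly_Mapping.single w b) F
      = ev (Poly_Mapping.single u a) (ev (Poly_Mapping.single w b) F)" for u w a b
    by (simp add: mult_single ev_single plus_word_def eval_word_scale)
      (simp add: eval_word_def mult.assoc)
  let ?s = "\<lambda>p w. Poly_Mapping.single w (Poly_Mapping.lookup p w)"
  have "ev (sum (?s p) (Poly_Mapping.keys p) * sum (?s r) (Poly_Mapping.keys r)) F
      = ev (sum (?s p) (Poly_Mapping.keys p)) (ev (sum (?s r) (Poly_Mapping.keys r)) F)"
  proof -
    have fun_sum: "ev (sum f A) G = (\<lambda>c. \<Sum>i\<in>A. ev (f i) G c)" for f :: "word \<Rightarrow> free" and A G
      by (rule ext) (rule ev_sum)
    show ?thesis
      by (simp add: sum_distrib_left sum_distrib_right fun_sum single_single ev_sum_arg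
          sum.swap[of _ "Poly_Mapping.keys r"])
  qed
  then show ?thesis
    by (simp only: poly_mapping_sum_single)
qed

end

section \<open>Spin configurations and matrices\<close>

text \<open>Binary value of the spins with site \<open>1\<close> most significant, the order of the
  basis produced by \<open>kron\<close>. The value \<open>c 0\<close> and the sites beyond
  \<open>n\<close> are ignored.\<close>

fun idx :: "nat \<Rightarrow> (nat \<Rightarrow> bool) \<Rightarrow> nat" where
  "idx 0 c = 0"
| "idx (Suc n) c = 2 * idx n c + of_bool (c (Suc n))"

lemma idx_less [simp]: "idx n c < 2 ^ n"
  by (induction n) auto

lemma idx_cong: "(\<And>i. 1 \<le> i \<Longrightarrow> i \<le> n \<Longrightarrow> c i = d i) \<Longrightarrow> idx n c = idx n d"
  by (induction n) auto

lemma idx_inj: "idx n c = idx n d \<Longrightarrow> 1 \<le> i \<Longrightarrow> i \<le> n \<Longrightarrow> c i = d i"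
proof (induction n)
  case (Suc n)
  from Suc.prems(1) have "(2 * idx n c + of_bool (c (Suc n))) mod 2 = (2 * idx n d + of_bool (d (Suc n))) mod 2"
    by simp
  then have last: "c (Suc n) = d (Suc n)"
    by (auto split: if_splits simp: of_bool_def)
  with Suc.prems(1) have "idx n c = idx n d" by simp
  with Suc last show ?case by (cases "i = Suc n") auto
qed simp

lemma idx_surj: "k < 2 ^ n \<Longrightarrow> \<exists>c. idx n c = k"
proof (induction n arbitrary: k)
  case (Suc n)
  then obtain c where c: "idx n c = k div 2"
    by (metis less_mult_imp_div_less mult.commute power_Suc)
  have "idx n (c(Suc n := odd k)) = idx n c"
    by (rule idx_cong) auto
  then have "idx (Suc n) (c(Suc n := odd k)) = k"
    using c by (auto elim: oddE)
  then show ?case by blast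
qed simp

text \<open>Cuts the binary expansion after \<open>m\<close> digits; quotient and remainder are what
  the nested \<open>kron\<close> in \<open>site\<close> reads off.\<close>

lemma idx_add: "idx (m + n) c = idx m c * 2 ^ n + idx n (\<lambda>i. c (m + i))"
  by (induction n) (simp_all add: algebra_simps)

lemma idx_div: "i \<le> n \<Longrightarrow> idx n c div 2 ^ (n - i) = idx i c"
  using idx_add[of i "n - i" c] by simp

lemma idx_mod: "i \<le> n \<Longrightarrow> idx n c mod 2 ^ (n - i) = idx (n - i) (\<lambda>k. c (i + k))"
  using idx_add[of i "n - i" c] by simp

lemma site_carrier [simp]:
  assumes "A \<in> carrier_mat 2 2" "1 \<le> i" "i \<le> N"
  shows "site N A i \<in> carrier_mat (2 ^ N) (2 ^ N)"
proof -
  have "2 ^ (i - 1) * 2 * 2 ^ (N - i) = (2::nat) ^ N"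
    using assms by (metis Suc_pred' le_add_diff_inverse power_Suc2 power_add less_eq_Suc_le One_nat_def)
  then show ?thesis
    using assms(1) by (simp add: site_def kron_def)
qed

lemma site_index:
  assumes A: "A \<in> carrier_mat 2 2" and i: "1 \<le> i" "i \<le> N"
  shows "site N A i $$ (idx N c, idx N d) =
    (if idx (i - 1) c = idx (i - 1) d \<and> idx (N - i) (\<lambda>k. c (i + k)) = idx (N - i) (\<lambda>k. d (i + k))
     then A $$ (of_bool (c i), of_bool (d i)) else 0)"
proof -
  have dim: "2 ^ (i - 1) * 2 * 2 ^ (N - i) = (2::nat) ^ N"
    using i by (metis Suc_pred' le_add_diff_inverse power_Suc2 power_add less_eq_Suc_le One_nat_def)
  obtain j where j: "i = Suc j" using i by (cases i) auto
  have l1: "idx N b < 2 ^ (i - 1) * 2 * 2 ^ (N - i)" for b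
    unfolding dim by simp
  have l2: "idx i b < 2 ^ (i - 1) * 2" for b
    using idx_less[of i b] j by (simp del: idx_less add: mult.commute)
  have mod2: "idx i b mod 2 = of_bool (b i)" and div2: "idx i b div 2 = idx (i - 1) b" for b
    using j by (simp_all del: of_bool_def)
  have m: "idx N b mod 2 ^ (N - i) < 2 ^ (N - i)" for b by simp
  have "site N A i $$ (idx N c, idx N d) =
     kron (1\<^sub>m (2 ^ (i - 1))) A $$ (idx i c, idx i d) *
     1\<^sub>m (2 ^ (N - i)) $$ (idx N c mod 2 ^ (N - i), idx N d mod 2 ^ (N - i))"
    unfolding site_def
    apply (subst kron_def)
    using A l1[of c] l1[of d] i by (simp add: kron_def idx_div)
  also have "kron (1\<^sub>m (2 ^ (i - 1))) A $$ (idx i c, idx i d)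
     = 1\<^sub>m (2 ^ (i - 1)) $$ (idx (i - 1) c, idx (i - 1) d) * A $$ (of_bool (c i), of_bool (d i))"
    using A l2[of c] l2[of d] by (simp add: kron_def mod2 div2)
  finally show ?thesis
    using i by (simp add: idx_mod)
qed

section \<open>Dictionary between coordinate vectors and functions of configurations\<close>

definition to_cfun :: "nat \<Rightarrow> complex vec \<Rightarrow> cfun"
  where "to_cfun N v = (\<lambda>c. v $ idx N c)"

lemma to_cfun_inj:
  assumes "v \<in> carrier_vec (2 ^ N)" "w \<in> carrier_vec (2 ^ N)" "to_cfun N v = to_cfun N w"
  shows "v = w"
proof (rule eq_vecI)
  show "dim_vec v = dim_vec w" using assms by simp
  fix k assume "k < dim_vec w"
  then obtain c where "idx N c = k" using idx_surj[of k N] assms by auto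
  then show "v $ k = w $ k" using fun_cong[OF assms(3), of c] by (simp add: to_cfun_def)
qed

lemma to_cfun_simps:
  assumes "v \<in> carrier_vec (2 ^ N)" "w \<in> carrier_vec (2 ^ N)"
  shows "to_cfun N (v + w) c = to_cfun N v c + to_cfun N w c"
    and "to_cfun N (v - w) c = to_cfun N v c - to_cfun N w c"
    and "to_cfun N (- v) c = - to_cfun N v c"
    and "to_cfun N (a \<cdot>\<^sub>v v) c = a * to_cfun N v c"
  using assms by (simp_all add: to_cfun_def)

lemma to_cfun_site:
  assumes A: "A \<in> carrier_mat 2 2" and i: "1 \<le> i" "i \<le> N" and v: "v \<in> carrier_vec (2 ^ N)"
  shows "to_cfun N (site N A i *\<^sub>v v) c =
    A $$ (of_bool (c i), 0) * to_cfun N v (c(i := False)) +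
    A $$ (of_bool (c i), 1) * to_cfun N v (c(i := True))"
proof -
  let ?S = "site N A i" and ?c = "\<lambda>b. c(i := b)"
  have S: "?S \<in> carrier_mat (2 ^ N) (2 ^ N)" using A i by simp
  have ne: "idx N (?c False) \<noteq> idx N (?c True)"
    using idx_inj[of N "?c False" "?c True" i] i by auto
  have entry: "?S $$ (idx N c, idx N (?c b)) = A $$ (of_bool (c i), of_bool b)" for b
  proof -
    have "idx (i - 1) c = idx (i - 1) (?c b)" and "idx (N - i) (\<lambda>k. c (i + k)) = idx (N - i) (\<lambda>k. ?c b (i + k))"
      by (rule idx_cong; auto)+
    then show ?thesis
      unfolding site_index[OF A i] by simp
  qed
  \<comment> \<open>Only two configurations on the sites up to \<open>N\<close> agree with
    \<open>c\<close> off site \<open>i\<close>, so the sum over all columns collapses to two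
    terms.\<close>
  have zero: "?S $$ (idx N c, k) = 0" if k: "k < 2 ^ N" "k \<notin> {idx N (?c False), idx N (?c True)}" for k
  proof -
    obtain d where d: "idx N d = k" using idx_surj k by blast
    have "\<not> (idx (i - 1) c = idx (i - 1) d \<and> idx (N - i) (\<lambda>k. c (i + k)) = idx (N - i) (\<lambda>k. d (i + k)))"
    proof
      assume *: "idx (i - 1) c = idx (i - 1) d \<and> idx (N - i) (\<lambda>k. c (i + k)) = idx (N - i) (\<lambda>k. d (i + k))"
      have "d l = ?c (d i) l" if l: "1 \<le> l" "l \<le> N" for l
      proof -
        consider "l = i" | "l < i" | "i < l" by linarith
        then show ?thesis
        proof cases
          case 2
          then show ?thesis using idx_inj[of "i - 1" c d l] * l by auto
        next
          case 3
          then show ?thesis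
            using idx_inj[of "N - i" "\<lambda>k. c (i + k)" "\<lambda>k. d (i + k)" "l - i"] * l by auto
        qed simp
      qed
      then have "idx N d = idx N (?c (d i))" by (rule idx_cong)
      then show False using k d by (cases "d i") auto
    qed
    then show ?thesis
      unfolding d[symmetric] site_index[OF A i] by (rule if_not_P)
  qed
  have "to_cfun N (?S *\<^sub>v v) c = (\<Sum>k<2 ^ N. ?S $$ (idx N c, k) * v $ k)"
    using S v by (simp add: to_cfun_def scalar_prod_def row_def lessThan_atLeast0)
  also have "\<dots> = (\<Sum>k\<in>{idx N (?c False), idx N (?c True)}. ?S $$ (idx N c, k) * v $ k)"
    by (rule sum.mono_neutral_right) (use zero in auto)
  finally show ?thesis
    using ne entry by (simp add: to_cfun_def)
qed

section \<open>The generators as local operators\<close>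

definition site_op :: "(bool \<Rightarrow> bool \<Rightarrow> complex) \<Rightarrow> nat \<Rightarrow> cfun \<Rightarrow> cfun"
  where "site_op A i F c = A (c i) False * F (c(i := False)) + A (c i) True * F (c(i := True))"

text \<open>On antiparallel spins this is the rank one matrix with rows \<open>(1 / q, - 1)\<close>
  and \<open>(- 1, q)\<close>.\<close>

definition bulk_op :: "complex \<Rightarrow> nat \<Rightarrow> cfun \<Rightarrow> cfun"
  where "bulk_op q i F c = (if c i = c (Suc i) then 0
    else (if c i then q else 1 / q) * F c - F (c(i := c (Suc i), Suc i := c i)))"

definition left_mat :: "complex \<Rightarrow> complex \<Rightarrow> bool \<Rightarrow> bool \<Rightarrow> complex"
  where "left_mat q x a b =
    (if a then if b then x else - 1 else if b then 1 else - 1 / x) / (q * x - 1 / (q * x))"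

definition right_mat :: "complex \<Rightarrow> complex \<Rightarrow> complex \<Rightarrow> bool \<Rightarrow> bool \<Rightarrow> complex"
  where "right_mat q z t a b =
    (if a then if b then - 1 / z else 1 / t else if b then - t else z) / (q * z - 1 / (q * z))"

definition spin_op :: "nat \<Rightarrow> complex \<Rightarrow> complex \<Rightarrow> complex \<Rightarrow> complex \<Rightarrow> nat \<Rightarrow> cfun \<Rightarrow> cfun"
  where "spin_op N q x z t i =
    (if i = 0 then site_op (left_mat q x) 1
     else if i = N then site_op (right_mat q z t) N
     else bulk_op q i)"

lemma qpow_add: "qpow \<eta> (a + b) = qpow \<eta> a * qpow \<eta> b"
  by (simp add: qpow_def distrib_left exp_add)

lemma qpow_minus: "qpow \<eta> (- a) = 1 / qpow \<eta> a"
  by (simp add: qpow_def exp_minus inverse_eq_divide)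

lemma qpow_nonzero [simp]: "qpow \<eta> a \<noteq> 0"
  by (simp add: qpow_def)

lemma qpow_diff: "qpow \<eta> (a - b) = qpow \<eta> a / qpow \<eta> b"
  using qpow_add[of \<eta> a "- b"] by (simp add: qpow_minus)

lemma sigma_carrier [simp]:
  "sigma_plus \<in> carrier_mat 2 2" "sigma_minus \<in> carrier_mat 2 2" "sigma_z \<in> carrier_mat 2 2"
  unfolding sigma_plus_def sigma_minus_def sigma_z_def mat_of_rows_list_def
  by (rule carrier_matI; simp)+

lemma sigma_index:
  "sigma_plus $$ (of_bool b, 0) = 0" "sigma_plus $$ (of_bool b, 1) = of_bool (\<not> b)"
  "sigma_minus $$ (of_bool b, 0) = of_bool b" "sigma_minus $$ (of_bool b, 1) = 0"
  "sigma_z $$ (of_bool b, 0) = of_bool (\<not> b)" "sigma_z $$ (of_bool b, 1) = - of_bool b"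
  by (simp_all add: sigma_plus_def sigma_minus_def sigma_z_def mat_of_rows_list_def)

lemma to_cfun_sigma:
  assumes "1 \<le> i" "i \<le> N" "v \<in> carrier_vec (2 ^ N)"
  shows "to_cfun N (site N sigma_plus i *\<^sub>v v) c = (if c i then 0 else to_cfun N v (c(i := True)))"
    and "to_cfun N (site N sigma_minus i *\<^sub>v v) c = (if c i then to_cfun N v (c(i := False)) else 0)"
    and "to_cfun N (site N sigma_z i *\<^sub>v v) c = (if c i then - to_cfun N v c else to_cfun N v c)"
  using assms fun_upd_triv[of c i]
  by (simp_all only: to_cfun_site sigma_carrier sigma_index)
    (cases "c i"; auto)+

lemma spin_gen_carrier:
  assumes "1 \<le> N" "i \<le> N"
  shows "spin_gen N \<eta> \<omega>\<^sub>1 \<omega>\<^sub>2 \<theta> i \<in> carrier_mat (2 ^ N) (2 ^ N)"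
  using assms
  by (auto simp: spin_gen_def spin_left_def spin_right_def spin_bulk_def
      intro!: add_carrier_mat minus_carrier_mat smult_carrier_mat uminus_carrier_mat mult_carrier_mat)

lemma mat_vec_simps:
  fixes A :: "complex mat"
  assumes "A \<in> carrier_mat n n" "v \<in> carrier_vec n"
  shows "B \<in> carrier_mat n n \<Longrightarrow> (A + B) *\<^sub>v v = A *\<^sub>v v + B *\<^sub>v v"
    and "B \<in> carrier_mat n n \<Longrightarrow> (A - B) *\<^sub>v v = A *\<^sub>v v - B *\<^sub>v v"
    and "(a \<cdot>\<^sub>m A) *\<^sub>v v = a \<cdot>\<^sub>v (A *\<^sub>v v)" "(- A) *\<^sub>v v = - (A *\<^sub>v v)"
    and "B \<in> carrier_mat n n \<Longrightarrow> (A * B) *\<^sub>v v = A *\<^sub>v (B *\<^sub>v v)" "1\<^sub>m n *\<^sub>v v = v"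
  using assms by (auto simp: add_mult_distrib_mat_vec minus_mult_distrib_mat_vec)

lemma to_cfun_spin_gen:
  assumes N: "1 \<le> N" "i \<le> N" and v: "v \<in> carrier_vec (2 ^ N)"
  shows "to_cfun N (spin_gen N \<eta> \<omega>\<^sub>1 \<omega>\<^sub>2 \<theta> i *\<^sub>v v) = 
      spin_op N (qpow \<eta> 1) (qpow \<eta> \<omega>\<^sub>1) (qpow \<eta> \<omega>\<^sub>2) (qpow \<eta> \<theta>) i (to_cfun N v)"
proof (rule ext)
  fix c
  note mv = mat_vec_simps[where n = "2 ^ N"]
  note carriers = add_carrier_mat minus_carrier_mat smult_carrier_mat mult_carrier_mat[of _ "2 ^ N" "2 ^ N"]
    uminus_carrier_mat one_carrier_mat mult_mat_vec_carrier[of _ "2 ^ N" "2 ^ N"]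
    add_carrier_vec minus_carrier_vec smult_carrier_vec uminus_carrier_vec
  consider "i = 0" | "i = N" "i \<noteq> 0" | "1 \<le> i" "i < N" using N by linarith
  then show "to_cfun N (spin_gen N \<eta> \<omega>\<^sub>1 \<omega>\<^sub>2 \<theta> i *\<^sub>v v) c = 
      spin_op N (qpow \<eta> 1) (qpow \<eta> \<omega>\<^sub>1) (qpow \<eta> \<omega>\<^sub>2) (qpow \<eta> \<theta>) i (to_cfun N v) c"
  proof cases
    case 1
    \<comment> \<open>Site \<open>1\<close> becomes a variable so that simplification does not
      rewrite the literal to \<open>Suc 0\<close>.\<close>
    obtain j :: nat where j: "1 = j" "1 \<le> j" "j \<le> N" using N by auto
    have c: "c j \<Longrightarrow> c(j := True) = c" "\<not> c j \<Longrightarrow> c(j := False) = c"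
      by (simp_all add: fun_upd_idem)
    have den: "qpow \<eta> (\<omega>\<^sub>1 + 1) - qpow \<eta> (- \<omega>\<^sub>1 - 1) = qpow \<eta> 1 * qpow \<eta> \<omega>\<^sub>1 - 1 / (qpow \<eta> 1 * qpow \<eta> \<omega>\<^sub>1)"
      by (simp add: qpow_add qpow_diff qpow_minus mult.commute)
    \<comment> \<open>For \<open>d = 0\<close> both sides vanish, division by zero being zero; the
      other case is arithmetic.\<close>
    obtain d where d: "qpow \<eta> 1 * qpow \<eta> \<omega>\<^sub>1 - 1 / (qpow \<eta> 1 * qpow \<eta> \<omega>\<^sub>1) = d" by simp
    show ?thesis
      unfolding spin_gen_def spin_left_def spin_op_def site_op_def left_mat_def 1 j(1) den d
      using j(2,3) v c
      by (simp add: mv carriers to_cfun_simps to_cfun_sigma del: One_nat_def)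
        (cases "d = 0"; auto simp: qpow_minus divide_simps algebra_simps)
  next
    case 2
    have c: "c N \<Longrightarrow> c(N := True) = c" "\<not> c N \<Longrightarrow> c(N := False) = c"
      by (simp_all add: fun_upd_idem)
    have den: "qpow \<eta> (\<omega>\<^sub>2 + 1) - qpow \<eta> (- \<omega>\<^sub>2 - 1) = qpow \<eta> 1 * qpow \<eta> \<omega>\<^sub>2 - 1 / (qpow \<eta> 1 * qpow \<eta> \<omega>\<^sub>2)"
      by (simp add: qpow_add qpow_diff qpow_minus mult.commute)
    obtain d where d: "qpow \<eta> 1 * qpow \<eta> \<omega>\<^sub>2 - 1 / (qpow \<eta> 1 * qpow \<eta> \<omega>\<^sub>2) = d" by simp
    show ?thesis
      unfolding spin_gen_def spin_right_def spin_op_def site_op_def right_mat_def 2 den d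
      using N v c 2
      by (simp add: mv carriers to_cfun_simps to_cfun_sigma del: One_nat_def)
        (cases "d = 0"; auto simp: qpow_minus divide_simps algebra_simps)
  next
    case 3
    then show ?thesis
      unfolding spin_gen_def spin_bulk_def
      using N v
      by (simp add: mv carriers to_cfun_simps to_cfun_sigma del: One_nat_def)
        (auto simp: spin_op_def bulk_op_def qpow_minus divide_simps algebra_simps)
  qed
qed

section \<open>The relations in the spin chain\<close>

text \<open>Three consecutive sites are exposed and the others frozen in \<open>c\<close>. By
  \<open>cfg3_ext\<close> an operator identity supported on these sites becomes a check of eight
  cases.\<close>

definition cfg3 :: "(nat \<Rightarrow> bool) \<Rightarrow> nat \<Rightarrow> bool \<Rightarrow> bool \<Rightarrow> bool \<Rightarrow> nat \<Rightarrow> bool"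
  where "cfg3 c i a b d = c(i := a, Suc i := b, Suc (Suc i) := d)"

lemma cfg3_self: "c = cfg3 c i (c i) (c (Suc i)) (c (Suc (Suc i)))"
  by (auto simp: cfg3_def)

lemma cfg3_simps [simp]:
  "cfg3 c i a b d i = a" "cfg3 c i a b d (Suc i) = b" "cfg3 c i a b d (Suc (Suc i)) = d"
  "(cfg3 c i a b d)(i := e) = cfg3 c i e b d" "(cfg3 c i a b d)(Suc i := e) = cfg3 c i a e d"
  "(cfg3 c i a b d)(Suc (Suc i) := e) = cfg3 c i a b e"
  by (auto simp: cfg3_def fun_eq_iff)

lemma bulk_op_cfg3:
  "bulk_op q i F (cfg3 c i a b d) =
    (if a = b then 0 else (if a then q else 1 / q) * F (cfg3 c i a b d) - F (cfg3 c i b a d))"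
  "bulk_op q (Suc i) F (cfg3 c i a b d) =
    (if b = d then 0 else (if b then q else 1 / q) * F (cfg3 c i a b d) - F (cfg3 c i a d b))"
  by (simp_all only: bulk_op_def cfg3_simps)

lemma site_op_cfg3:
  "site_op A i F (cfg3 c i a b d) = A a False * F (cfg3 c i False b d) + A a True * F (cfg3 c i True b d)"
  "site_op A (Suc i) F (cfg3 c i a b d) = A b False * F (cfg3 c i a False d) + A b True * F (cfg3 c i a True d)"
  "site_op A (Suc (Suc i)) F (cfg3 c i a b d) = A d False * F (cfg3 c i a b False) + A d True * F (cfg3 c i a b True)"
  by (simp_all only: site_op_def cfg3_simps)

lemma cfg3_ext:
  fixes F G :: cfun
  assumes "\<And>c a b d. F (cfg3 c i a b d) = G (cfg3 c i a b d)"
  shows "F = G"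
proof (rule ext)
  fix c show "F c = G c" using assms[of c] cfg3_self[of c i] by metis
qed

lemma bulk_op_square:
  assumes "q \<noteq> 0"
  shows "bulk_op q i (bulk_op q i F) = (\<lambda>c. (q + 1 / q) * bulk_op q i F c)"
  by (rule cfg3_ext[of _ i]) (use assms in \<open>simp add: bulk_op_cfg3 field_simps\<close>)

lemma bulk_op_braid:
  assumes "q \<noteq> 0"
  shows "bulk_op q i (bulk_op q (Suc i) (bulk_op q i F)) = bulk_op q i F"
    and "bulk_op q (Suc i) (bulk_op q i (bulk_op q (Suc i) F)) = bulk_op q (Suc i) F"
  by (rule cfg3_ext[of _ i], use assms in \<open>simp add: bulk_op_cfg3 field_simps\<close>)+

text \<open>In diagrams \<open>e_i e_(i+1) e_i\<close> is a zigzag that straightens; an operator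
  inserted on the strand at site \<open>i\<close> slides along it and reappears at site
  \<open>i + 2\<close>.\<close>

lemma zigzag:
  assumes "q \<noteq> 0"
  shows "bulk_op q i (site_op A i (bulk_op q (Suc i) (bulk_op q i F)))
    = bulk_op q i (site_op A (Suc (Suc i)) F)"
  by (rule cfg3_ext[of _ i]) (use assms in \<open>simp add: bulk_op_cfg3 site_op_cfg3 field_simps\<close>)

text \<open>The bulk operator has rank one on its two sites, so compressing by it leaves a scalar: a
  \<open>q\<close>-weighted trace of one inserted operator, or the loop closed by two.\<close>

lemma bulk_op_site:
  assumes "q \<noteq> 0"
  shows "bulk_op q i (site_op A i (bulk_op q i F))
      = (\<lambda>c. (A False False / q + q * A True True) * bulk_op q i F c)"
    and "bulk_op q i (site_op A (Suc i) (bulk_op q i F))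
      = (\<lambda>c. (q * A False False + A True True / q) * bulk_op q i F c)"
    and "bulk_op q i (site_op A i (site_op B (Suc i) (bulk_op q i F)))
      = (\<lambda>c. (A False False * B True True / q - A False True * B True False
           - A True False * B False True + q * A True True * B False False) * bulk_op q i F c)"
  by (rule cfg3_ext[of _ i], use assms in \<open>simp add: bulk_op_cfg3 site_op_cfg3 field_simps\<close>)+

lemma site_op_rank_one:
  assumes "\<And>a b. A a b = u a * v b"
  shows "site_op A i (site_op B i (site_op A i F))
    = (\<lambda>c. (\<Sum>a\<in>{False, True}. \<Sum>b\<in>{False, True}. v a * B a b * u b) * site_op A i F c)"
  by (rule cfg3_ext[of _ i]) (simp add: site_op_cfg3 assms field_simps)

lemma site_op_commute:
  assumes "i \<noteq> j"
  shows "site_op A i (site_op B j F) = site_op B j (site_op A i F)"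
  by (rule ext) (use assms in \<open>simp add: site_op_def fun_upd_twist[OF assms] algebra_simps\<close>)

lemma site_bulk_commute:
  assumes "j \<noteq> i" "j \<noteq> Suc i"
  shows "site_op A j (bulk_op q i F) = bulk_op q i (site_op A j F)"
proof (rule ext)
  fix c :: "nat \<Rightarrow> bool"
  have "c(j := b, i := d, Suc i := e) = c(i := d, Suc i := e, j := b)" for b d e
    using assms by (auto simp: fun_eq_iff)
  then show "site_op A j (bulk_op q i F) c = bulk_op q i (site_op A j F) c"
    using assms by (simp add: site_op_def bulk_op_def algebra_simps)
qed

lemma bulk_commute:
  assumes "Suc i < j"
  shows "bulk_op q i (bulk_op q j F) = bulk_op q j (bulk_op q i F)"
proof (rule ext)
  fix c :: "nat \<Rightarrow> bool"
  have "c(j := a, Suc j := b, i := d, Suc i := e) = c(i := d, Suc i := e, j := a, Suc j := b)" for a b d e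
    using assms by (auto simp: fun_eq_iff)
  then show "bulk_op q i (bulk_op q j F) c = bulk_op q j (bulk_op q i F) c"
    using assms by (simp add: bulk_op_def algebra_simps)
qed

lemma site_op_add: "site_op A i (\<lambda>c. F c + G c) = (\<lambda>c. site_op A i F c + site_op A i G c)"
  and site_op_scale: "site_op A i (\<lambda>c. a * F c) = (\<lambda>c. a * site_op A i F c)"
  by (simp_all add: fun_eq_iff site_op_def algebra_simps)

lemma bulk_op_add: "bulk_op q i (\<lambda>c. F c + G c) = (\<lambda>c. bulk_op q i F c + bulk_op q i G c)"
  and bulk_op_scale: "bulk_op q i (\<lambda>c. a * F c) = (\<lambda>c. a * bulk_op q i F c)"
  by (auto simp: fun_eq_iff bulk_op_def algebra_simps)

lemma operators_spin_op: "operators (spin_op N q x z t)"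
  by standard (simp_all add: spin_op_def site_op_add site_op_scale bulk_op_add bulk_op_scale)

locale spin_chain =
  fixes N :: nat and q x z t :: complex
  assumes N: "N \<ge> 2"
    and q: "q \<noteq> 0" and x: "x \<noteq> 0" and z: "z \<noteq> 0" and t: "t \<noteq> 0"
    and qx: "(q * x) ^ 2 \<noteq> 1" and qz: "(q * z) ^ 2 \<noteq> 1"
begin

abbreviation T :: "nat \<Rightarrow> cfun \<Rightarrow> cfun" where "T \<equiv> spin_op N q x z t"

sublocale operators T by (rule operators_spin_op)

definition k1 :: complex where "k1 = q * x - 1 / (q * x)"
definition k2 :: complex where "k2 = q * z - 1 / (q * z)"
definition s1 :: complex where "s1 = (x - 1 / x) / k1"
definition s2 :: complex where "s2 = (z - 1 / z) / k2"

text \<open>This is \<open>b\<close> with its products of \<open>q\<close>-numbers multiplied out,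
  which removes the half arguments: only \<open>q\<close>, \<open>x\<close>, \<open>z\<close> and
  \<open>t\<close> remain.\<close>

definition bval :: complex
  where "bval = (if even N then q * x * z + 1 / (q * x * z) - t - 1 / t
     else t + 1 / t - x / z - z / x) / (k1 * k2)"

lemma k_nonzero: "k1 \<noteq> 0" "k2 \<noteq> 0"
  using qx qz q x z by (auto simp: k1_def k2_def field_simps power2_eq_square)

lemma T_0: "T 0 = site_op (left_mat q x) 1"
  and T_N: "T N = site_op (right_mat q z t) N"
  and T_bulk: "0 < i \<Longrightarrow> i < N \<Longrightarrow> T i = bulk_op q i"
  using N by (simp_all add: spin_op_def)

text \<open>The column \<open>(1, x)\<close> is what \<open>e_0\<close> creates at site
  \<open>1\<close>, hence the first factor of the product vector \<open>pre\<close>.\<close>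

lemma left_rank_one: "left_mat q x a b = ((if a then x else 1) / k1) * (if b then 1 else - 1 / x)"
  using x by (simp add: left_mat_def k1_def)

text \<open>Column \<open>(1, 1 / (t * z))\<close> and row \<open>(z, - t)\<close>: this shows what
  \<open>e_N\<close> creates at the last site and which vector it kills.\<close>

lemma right_rank_one:
  "right_mat q z t a b = ((if a then 1 / (t * z) else 1) / k2) * (if b then - t else z)"
  using z t by (simp add: right_mat_def k2_def)

lemma site_op_square:
  assumes "\<And>a b. A a b = u a * v b"
  shows "site_op A i (site_op A i F) = (\<lambda>c. (v False * u False + v True * u True) * site_op A i F c)"
  by (rule cfg3_ext[of _ i]) (simp add: site_op_cfg3 assms field_simps)

lemma T_0_square: "T 0 (T 0 F) = (\<lambda>c. s1 * T 0 F c)"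
proof -
  have "- 1 / x * (1 / k1) + 1 * (x / k1) = s1"
    using x k_nonzero by (simp add: s1_def field_simps)
  then show ?thesis
    using site_op_square[of "left_mat q x" "\<lambda>a. (if a then x else 1) / k1" "\<lambda>b. if b then 1 else - 1 / x", OF left_rank_one]
    unfolding T_0 by simp
qed

lemma T_N_square: "T N (T N F) = (\<lambda>c. s2 * T N F c)"
proof -
  have "z * (1 / k2) + - t * (1 / (t * z) / k2) = s2"
    using z t k_nonzero by (simp add: s2_def field_simps)
  then show ?thesis
    using site_op_square[of "right_mat q z t" "\<lambda>a. (if a then 1 / (t * z) else 1) / k2" "\<lambda>b. if b then - t else z", OF right_rank_one]
    unfolding T_N by simp
qed

lemma T_square: "0 < i \<Longrightarrow> i < N \<Longrightarrow> T i (T i F) = (\<lambda>c. (q + 1 / q) * T i F c)"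
  by (simp add: T_bulk bulk_op_square q)

text \<open>If \<open>j\<close> is \<open>0\<close> or \<open>N\<close>, the relation says that the
  \<open>q\<close>-weighted trace of the boundary matrix is \<open>1\<close>, which is the role of
  the denominators \<open>k1\<close> and \<open>k2\<close>. Otherwise only bulk operators are
  involved.\<close>

lemma T_braid:
  assumes i: "0 < i" "i < N" and j: "j = i + 1 \<or> j = i - 1"
  shows "T i (T j (T i F)) = T i F"
proof -
  consider "j = Suc i" "j < N" | "j = Suc i" "j = N" | "i = Suc j" "0 < j" | "i = Suc j" "j = 0"
    using assms by linarith
  then show ?thesis
  proof cases
    case 1
    then show ?thesis using i by (simp add: T_bulk bulk_op_braid q)
  next
    case 2
    have "q * right_mat q z t False False + right_mat q z t True True / q = k2 / k2"
      using q z t by (simp add: right_rank_one) (simp add: k2_def divide_simps)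
    moreover have "T j = site_op (right_mat q z t) (Suc i)" "T i = bulk_op q i"
      using 2 i T_N T_bulk by simp_all
    ultimately show ?thesis
      using bulk_op_site(2)[OF q, of i "right_mat q z t" F] k_nonzero by simp
  next
    case 3
    then show ?thesis using i by (simp add: T_bulk bulk_op_braid q)
  next
    case 4
    have "left_mat q x False False / q + q * left_mat q x True True = k1 / k1"
      using q x by (simp add: left_rank_one) (simp add: k1_def divide_simps)
    then show ?thesis
      using i 4 T_0 bulk_op_site(1)[OF q, of i "left_mat q x" F] k_nonzero by (simp add: T_bulk)
  qed
qed

lemma T_commute_less:
  assumes "Suc i < j" "j \<le> N"
  shows "T i (T j F) = T j (T i F)"
proof (cases "i = 0 \<or> j = N")
  case True
  then show ?thesis
    using assms N
    by (cases "i = 0"; cases "j = N")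
      (simp_all add: T_0 T_N T_bulk site_op_commute[of "Suc 0" N] site_bulk_commute)
next
  case False
  then show ?thesis
    using assms by (simp add: T_bulk bulk_commute[OF assms(1)])
qed

lemma T_commute:
  assumes "Suc i < j \<or> Suc j < i" "i \<le> N" "j \<le> N"
  shows "T i (T j F) = T j (T i F)"
  using T_commute_less assms by metis

subsection \<open>The double quotient\<close>

text \<open>The letters \<open>i, i + 2, ...\<close> up to \<open>N\<close>. Thus \<open>P 1\<close>
  and \<open>P 0\<close> are the operators of \<open>I1 N\<close> and \<open>I2 N\<close>.\<close>

definition alternate :: "nat \<Rightarrow> nat list"
  where "alternate i = filter (\<lambda>j. even (i + j)) [i..<Suc N]"

abbreviation P :: "nat \<Rightarrow> cfun \<Rightarrow> cfun" where "P i \<equiv> foldr T (alternate i)"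

lemma alternate_rec: "i \<le> N \<Longrightarrow> alternate i = i # alternate (Suc (Suc i))"
proof (cases "i = N")
  case False
  assume "i \<le> N"
  with False have "[i..<Suc N] = i # Suc i # [Suc (Suc i)..<Suc N]"
    by (metis le_neq_implies_less less_Suc_eq_le not_less_eq upt_conv_Cons)
  then show ?thesis
    unfolding alternate_def by (simp del: upt_Suc)
qed (simp add: alternate_def)

lemma alternate_Nil: "N < i \<Longrightarrow> alternate i = []"
  by (simp add: alternate_def)

lemma alternate_set: "set (alternate i) \<subseteq> {i..N}"
  by (auto simp: alternate_def)

lemma foldr_commute:
  assumes "\<And>j F. j \<in> set u \<Longrightarrow> S (T j F) = T j (S F)"
  shows "S (foldr T u F) = foldr T u (S F)"
  using assms by (induction u) auto

lemma P_commute: "i \<le> N \<Longrightarrow> Suc i < j \<Longrightarrow> T i (P j F) = P j (T i F)"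
proof (rule foldr_commute)
  fix k G assume "i \<le> N" "Suc i < j" "k \<in> set (alternate j)"
  then show "T i (T k G) = T k (T i G)"
    using alternate_set[of j] by (intro T_commute_less) auto
qed

text \<open>The parity of \<open>N - i\<close> decides how \<open>A\<close> ends. If it is even,
  \<open>A\<close> reaches site \<open>N\<close> and is sandwiched between the row and the column of
  \<open>e_N\<close>; if it is odd, \<open>A\<close> and \<open>e_N\<close> close a loop through
  \<open>e_(N-1)\<close>.\<close>

definition contraction :: "(bool \<Rightarrow> bool \<Rightarrow> complex) \<Rightarrow> nat \<Rightarrow> complex"
  where "contraction A i =
    (if even (N - i)
     then A False False * z + A False True / t - A True False * t - A True True / z
     else q * z * A True True + t * A True False - A False True / t - A False False / (q * z)) / k2"

text \<open>A strand carrying \<open>A\<close> is pulled through the zigzags until it meets the right boundary.\<close>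

lemma chain_contraction:
  "1 \<le> i \<Longrightarrow> i \<le> N \<Longrightarrow> P i (site_op A i (P (Suc i) (P i F))) = (\<lambda>c. contraction A i * P i F c)"
proof (induction "N - i" arbitrary: i F rule: less_induct)
  case less
  consider "i = N" | "Suc i = N" | "Suc (Suc i) \<le> N" using less.prems by linarith
  then show ?case
  proof cases
    case 1
    have "(\<Sum>a\<in>{False, True}. \<Sum>b\<in>{False, True}. (if a then - t else z) * A a b *
        ((if b then 1 / (t * z) else 1) / k2)) = contraction A i"
      using 1 t z by (simp add: contraction_def add_divide_distrib diff_divide_distrib mult.commute)
    then show ?thesis
      using 1 site_op_rank_one[of "right_mat q z t" "\<lambda>a. (if a then 1 / (t * z) else 1) / k2" "\<lambda>b. if b then - t else z", OF right_rank_one, of i A F]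
      by (simp add: alternate_rec alternate_Nil T_N)
  next
    case 2
    have "A False False * right_mat q z t True True / q - A False True * right_mat q z t True False
        - A True False * right_mat q z t False True + q * A True True * right_mat q z t False False
      = contraction A i"
    proof -
      have "odd (N - i)" using 2 by auto
      then show ?thesis using t z q
        by (simp add: contraction_def right_rank_one diff_divide_distrib add_divide_distrib mult_ac)
    qed
    then show ?thesis
      using 2 less.prems bulk_op_site(3)[OF q, of i A "right_mat q z t" F] T_N
      by (simp add: alternate_rec alternate_Nil T_bulk)
  next
    case 3
    let ?i = "Suc (Suc i)"
    have Ti: "T i = bulk_op q i" and Ti1: "T (Suc i) = bulk_op q (Suc i)"
      using 3 less.prems by (simp_all add: T_bulk)
    have "P i (site_op A i (P (Suc i) (P i F)))
        = T i (P ?i (site_op A i (T (Suc i) (P (Suc ?i) (T i (P ?i F))))))"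
      using 3 by (simp add: alternate_rec)
    \<comment> \<open>\<open>P ?i\<close> commutes with \<open>T i\<close>, and \<open>T i\<close>
      with \<open>P (Suc ?i)\<close>; this brings the operators of \<open>zigzag\<close>
      together.\<close>
    also have "\<dots> = P ?i (T i (site_op A i (T (Suc i) (T i (P (Suc ?i) (P ?i F))))))"
      using 3 by (simp add: P_commute)
    also have "\<dots> = P ?i (T i (site_op A ?i (P (Suc ?i) (P ?i F))))"
      unfolding Ti Ti1 by (simp add: zigzag q)
    also have "\<dots> = T i (P ?i (site_op A ?i (P (Suc ?i) (P ?i F))))"
      using 3 by (simp add: P_commute)
    also have "\<dots> = T i (\<lambda>c. contraction A ?i * P ?i F c)"
      using less.hyps[of ?i F] 3 by simp
    also have "\<dots> = (\<lambda>c. contraction A ?i * P i F c)"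
      using 3 by (simp add: T_scale alternate_rec)
    also have "contraction A ?i = contraction A i"
      using 3 by (simp add: contraction_def)
    finally show ?thesis .
  qed
qed

text \<open>The operator pulled through the zigzags is \<open>e_0\<close> itself, starting on site
  \<open>1\<close>.\<close>

lemma double_relation_odd: "P 1 (P 0 (P 1 F)) = (\<lambda>c. bval * P 1 F c)"
proof -
  have "P 1 (P 0 (P 1 F)) = P 1 (site_op (left_mat q x) 1 (P (Suc 1) (P 1 F)))"
    using N by (simp add: alternate_rec[of 0] T_0 numeral_2_eq_2)
  also have "\<dots> = (\<lambda>c. contraction (left_mat q x) 1 * P 1 F c)"
    using chain_contraction[of 1 "left_mat q x" F] N by simp
  also have "contraction (left_mat q x) 1 = bval"
    using N x z q t k_nonzero by (simp add: contraction_def bval_def left_rank_one field_simps)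
  finally show ?thesis .
qed

text \<open>The operator on the second site left over from compressing a bulk generator by the left boundary.\<close>

definition left_mat2 :: "bool \<Rightarrow> bool \<Rightarrow> complex"
  where "left_mat2 a b =
    (if a then if b then - 1 / (q * x) else 1 else if b then - 1 else q * x) / k1"

text \<open>Because \<open>e_0\<close> has rank one, compressing \<open>e_1\<close> between two
  copies of it decouples site \<open>1\<close> and leaves a matrix on site \<open>2\<close>.\<close>

lemma left_bulk_left:
  "site_op (left_mat q x) i (bulk_op q i (site_op (left_mat q x) i F))
    = site_op (left_mat q x) i (site_op left_mat2 (Suc i) F)"
  by (rule cfg3_ext[of _ i])
    (use q x k_nonzero in \<open>simp add: bulk_op_cfg3 site_op_cfg3 left_rank_one left_mat2_def field_simps\<close>)

text \<open>The two copies of \<open>e_0\<close> first turn \<open>e_1\<close> into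
  \<open>left_mat2\<close> on site \<open>2\<close>; the pulling then starts from there.\<close>

lemma double_relation_even: "P 0 (P 1 (P 0 F)) = (\<lambda>c. bval * P 0 F c)"
proof -
  have comm: "T 0 (P j G) = P j (T 0 G)" if "2 \<le> j" for j G
    using P_commute[of 0 j] that by simp
  have "P 0 (P 1 (P 0 F)) = T 0 (P 2 (T 1 (P 3 (T 0 (P 2 F)))))"
    using N by (simp add: alternate_rec numeral_2_eq_2 numeral_3_eq_3)
  also have "\<dots> = P 2 (T 0 (T 1 (T 0 (P 3 (P 2 F)))))"
    by (simp add: comm)
  also have "\<dots> = P 2 (T 0 (site_op left_mat2 2 (P 3 (P 2 F))))"
    unfolding T_0 using N by (simp add: T_bulk left_bulk_left[of 1, simplified] numeral_2_eq_2)
  also have "\<dots> = T 0 (P 2 (site_op left_mat2 2 (P (Suc 2) (P 2 F))))"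
    by (simp add: comm)
  also have "\<dots> = T 0 (\<lambda>c. contraction left_mat2 2 * P 2 F c)"
    using chain_contraction[of 2 left_mat2 F] N by simp
  also have "\<dots> = (\<lambda>c. contraction left_mat2 2 * P 0 F c)"
    using N by (simp add: T_scale alternate_rec[of 0] numeral_2_eq_2)
  also have "contraction left_mat2 2 = bval"
    using N x z q t k_nonzero by (simp add: contraction_def bval_def left_mat2_def field_simps)
  finally show ?thesis .
qed

end

section \<open>The cyclic vector\<close>

text \<open>\<open>Eidem\<close> with the boundary weight as a parameter, so that it serves both the
  spin chain and an abstract quotient.\<close>

fun Eid :: "complex \<Rightarrow> nat \<Rightarrow> free" where
  "Eid s 0 = 1"
| "Eid s (Suc i) = scal (s powi ((- 1) ^ Suc i)) * Eid s i * gen i * Eid s i"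

lemma Eidem_eq_Eid: "Eidem \<eta> \<omega> i = Eid (bweight \<eta> \<omega>) i"
  by (induction i) simp_all

definition qubit :: "complex \<Rightarrow> bool \<Rightarrow> complex"
  where "qubit y b = (if b then y else 1)"

text \<open>Takes the place of a splitting of the tensor product: \<open>f\<close> lives on the
  factors at the sites in \<open>S\<close>.\<close>

definition depends_on :: "nat set \<Rightarrow> cfun \<Rightarrow> bool"
  where "depends_on S f \<longleftrightarrow> (\<forall>c d. (\<forall>k\<in>S. c k = d k) \<longrightarrow> f c = f d)"

lemma depends_onD: "depends_on S f \<Longrightarrow> (\<And>k. k \<in> S \<Longrightarrow> c k = d k) \<Longrightarrow> f c = f d"
  unfolding depends_on_def by blast

lemma depends_onI: "(\<And>c d. (\<And>k. k \<in> S \<Longrightarrow> c k = d k) \<Longrightarrow> f c = f d) \<Longrightarrow> depends_on S f"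
  unfolding depends_on_def by blast

context spin_chain
begin

section \<open>The product vector fixed by the idempotents\<close>

definition xs :: "nat \<Rightarrow> complex"
  where "xs k = (if odd k then x else 1 / (q * x))"

definition pre :: "nat \<Rightarrow> cfun"
  where "pre m c = (\<Prod>k\<in>{1..m}. qubit (xs k) (c k))"

text \<open>Consecutive factors are related by an involution, in exponents \<open>\<omega>\<close>
  to \<open>- \<omega> - 1\<close>, so the recursion for the idempotents has one form at odd and
  even sites.\<close>

lemma xs_Suc: "xs (Suc k) = 1 / (q * xs k)"
  using q x by (auto simp: xs_def)

lemma xs_nonzero [simp]: "xs k \<noteq> 0"
  using q x by (simp add: xs_def)

lemma pre_0 [simp]: "pre 0 c = 1"
  by (simp add: pre_def)

lemma pre_Suc: "pre (Suc m) c = pre m c * qubit (xs (Suc m)) (c (Suc m))"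
  by (simp add: pre_def)

lemma pre_upd: "m < k \<Longrightarrow> pre m (c(k := b)) = pre m c"
  by (auto simp: pre_def intro: prod.cong)

text \<open>It suffices to know \<open>E_i\<close> on vectors that already start with
  \<open>pre (i - 1)\<close>. There it projects site \<open>i\<close> onto \<open>(1, xs i)\<close>,
  by a functional with value \<open>1\<close> on that vector. In the recursion the inner
  \<open>E_i\<close> fixes \<open>pre i\<close>, then \<open>e_i\<close> disturbs sites
  \<open>i\<close> and \<open>i + 1\<close>, and the outer \<open>E_i\<close> restores site
  \<open>i\<close>.\<close>

lemma Eid_pre:
  assumes "x ^ 2 \<noteq> 1" "1 \<le> i" "i \<le> N" "depends_on {i..} G"
  shows "ev (Eid s1 i) (\<lambda>c. pre (i - 1) c * G c)
    = (\<lambda>c. pre i c * ((G (c(i := True)) - G (c(i := False)) / xs i) / (xs i - 1 / xs i)))"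
  using assms(2-)
proof (induction i arbitrary: G rule: nat_induct_at_least)
  case base
  have xx: "x - 1 / x \<noteq> 0" using assms(1) x by (auto simp: field_simps power2_eq_square)
  have inv: "s1 powi - 1 = k1 / (x - 1 / x)"
    by (simp add: s1_def power_int_minus)
  have T0: "T 0 G c = qubit x (c 1) * (G (c(1 := True)) - G (c(1 := False)) / x) / k1" for c
    using x by (simp add: T_0 site_op_def left_rank_one qubit_def diff_divide_distrib right_diff_distrib)
  have "ev (Eid s1 1) G = (\<lambda>c. s1 powi - 1 * T 0 G c)"
    by (simp add: ev_mult)
  also have "\<dots> = (\<lambda>c. qubit x (c 1) * ((G (c(1 := True)) - G (c(1 := False)) / x) / (x - 1 / x)))"
    unfolding inv T0 using k_nonzero by simp
  finally have *: "ev (Eid s1 1) G = (\<lambda>c. qubit x (c 1) * ((G (c(1 := True)) - G (c(1 := False)) / x) / (x - 1 / x)))" .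
  have "pre 1 c = qubit x (c 1)" "xs 1 = x" for c
    by (simp_all add: pre_def xs_def)
  then show ?case
    by (simp only: * diff_self_eq_0 pre_0 mult_1)
next
  case (Suc i)
  have i: "1 \<le> i" "i < N" using Suc by simp_all
  have Ti: "T i = bulk_op q i" using i by (simp add: T_bulk)
  have G: "G (c(i := b)) = G c" "G (c(i := b, Suc i := d)) = G (c(Suc i := d))"
    "G (c(Suc i := d, i := b)) = G (c(Suc i := d))" for c b d
    by (rule depends_onD[OF Suc.prems(2)]; auto)+
  have pre_i: "pre i c = pre (i - 1) c * qubit (xs i) (c i)" for c
    using pre_Suc[of "i - 1" c] i by simp
  have xi: "xs i - 1 / xs i \<noteq> 0"
    using assms(1) qx q x
    by (auto simp: xs_def field_simps power2_eq_square)
  \<comment> \<open>Reading \<open>pre i * G\<close> as \<open>pre (i - 1)\<close> times a function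
    of the later sites makes the induction hypothesis applicable.\<close>
  have "depends_on {i..} (\<lambda>c. qubit (xs i) (c i) * G c)"
  proof (rule depends_onI)
    fix c d :: "nat \<Rightarrow> bool" assume cd: "\<And>k. k \<in> {i..} \<Longrightarrow> c k = d k"
    have "G c = G d"
      by (rule depends_onD[OF Suc.prems(2)]) (use cd in auto)
    then show "qubit (xs i) (c i) * G c = qubit (xs i) (d i) * G d" using cd by simp
  qed
  from Suc.IH[OF _ this] have IH: "ev (Eid s1 i) (\<lambda>c. pre (i - 1) c * (qubit (xs i) (c i) * G c))
    = (\<lambda>c. pre i c * ((qubit (xs i) True * G c - qubit (xs i) False * G c / xs i) / (xs i - 1 / xs i)))"
    using i by (simp only: fun_upd_same G)
  have "(\<lambda>c. pre i c * G c) = (\<lambda>c. pre (i - 1) c * (qubit (xs i) (c i) * G c))"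
    by (simp only: pre_i mult.assoc)
  moreover have "(qubit (xs i) True * a - qubit (xs i) False * a / xs i) / (xs i - 1 / xs i) = a" for a
  proof -
    have "qubit (xs i) True * a - qubit (xs i) False * a / xs i = (xs i - 1 / xs i) * a"
      by (simp add: qubit_def left_diff_distrib)
    then show ?thesis using xi by simp
  qed
  ultimately have E1: "ev (Eid s1 i) (\<lambda>c. pre i c * G c) = (\<lambda>c. pre i c * G c)"
    using IH by simp
  \<comment> \<open>What \<open>e_i\<close> leaves on the sites from \<open>i\<close> on, with
    \<open>pre (i - 1)\<close> split off.\<close>
  define K where "K c = (if c i = c (Suc i) then 0 else
    (if c i then q else 1 / q) * (qubit (xs i) (c i) * G c) - qubit (xs i) (c (Suc i)) * G (c(Suc i := c i)))" for c
  have TK: "T i (\<lambda>c. pre i c * G c) = (\<lambda>c. pre (i - 1) c * K c)"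
    using i by (auto simp: Ti bulk_op_def K_def pre_i pre_upd G fun_eq_iff algebra_simps)
  have "depends_on {i..} K"
  proof (rule depends_onI)
    fix c d :: "nat \<Rightarrow> bool" assume cd: "\<And>k. k \<in> {i..} \<Longrightarrow> c k = d k"
    have "G c = G d" "G (c(Suc i := b)) = G (d(Suc i := b))" for b
      by (rule depends_onD[OF Suc.prems(2)]; use cd in auto)+
    then show "K c = K d" using cd by (simp add: K_def)
  qed
  from Suc.IH[OF less_imp_le[OF i(2)] this] have E2: "ev (Eid s1 i) (\<lambda>c. pre (i - 1) c * K c)
    = (\<lambda>c. pre i c * ((K (c(i := True)) - K (c(i := False)) / xs i) / (xs i - 1 / xs i)))" .
  \<comment> \<open>At odd sites \<open>xs i - 1 / xs i\<close> is \<open>s1 * k1\<close>, at even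
    sites \<open>- k1\<close>; the alternating exponent in the idempotents compensates exactly
    this.\<close>
  have factor: "s1 powi ((- 1) ^ Suc i) / (xs i - 1 / xs i) = - (1 / (xs (Suc i) - 1 / xs (Suc i)))"
  proof (cases "odd i")
    case True
    have "1 / (q * x) - 1 / (1 / (q * x)) = - k1" by (simp add: k1_def)
    then show ?thesis using True xi by (simp add: xs_def s1_def)
  next
    case False
    have "1 / (q * x) - 1 / (1 / (q * x)) = - k1" by (simp add: k1_def)
    then show ?thesis using False xi k_nonzero by (simp add: xs_def s1_def power_int_minus divide_simps)
  qed
  have "ev (Eid s1 (Suc i)) (\<lambda>c. pre i c * G c) = (\<lambda>c. s1 powi ((- 1) ^ Suc i) *
      (pre i c * ((K (c(i := True)) - K (c(i := False)) / xs i) / (xs i - 1 / xs i))))"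
    by (simp only: Eid.simps ev_mult ev_scal ev_gen E1 TK E2)
  also have "\<dots> = (\<lambda>c. (s1 powi ((- 1) ^ Suc i) / (xs i - 1 / xs i)) *
      (pre i c * (K (c(i := True)) - K (c(i := False)) / xs i)))"
    by simp
  also have "\<dots> = (\<lambda>c. pre (Suc i) c * ((G (c(Suc i := True)) - G (c(Suc i := False)) / xs (Suc i))
      / (xs (Suc i) - 1 / xs (Suc i))))"
  proof (rule ext)
    fix c :: "nat \<Rightarrow> bool"
    have "K (c(i := True)) - K (c(i := False)) / xs i
        = - (qubit (xs (Suc i)) (c (Suc i)) * (G (c(Suc i := True)) - G (c(Suc i := False)) / xs (Suc i)))"
      using q fun_upd_idem[of c "Suc i" True] fun_upd_idem[of c "Suc i" False]
      by (cases "c (Suc i)") (simp_all add: K_def qubit_def G xs_Suc field_simps)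
    then show "s1 powi ((- 1) ^ Suc i) / (xs i - 1 / xs i) * (pre i c * (K (c(i := True)) - K (c(i := False)) / xs i))
       = pre (Suc i) c * ((G (c(Suc i := True)) - G (c(Suc i := False)) / xs (Suc i))
      / (xs (Suc i) - 1 / xs (Suc i)))"
      unfolding factor by (simp add: pre_Suc)
  qed
  finally show ?case by (simp only: diff_Suc_1)
qed

lemma Eid_cyclic:
  assumes "x ^ 2 \<noteq> 1"
  shows "ev (Eid s1 N) (pre N) = pre N"
proof -
  have pre_N: "pre N = (\<lambda>c. pre (N - 1) c * qubit (xs N) (c N))"
    using pre_Suc[of "N - 1"] N by (simp add: fun_eq_iff)
  have xN: "xs N - 1 / xs N \<noteq> 0"
    using assms(1) qx q x
    by (auto simp: xs_def field_simps power2_eq_square)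
  have "depends_on {N..} (\<lambda>c. qubit (xs N) (c N))"
    by (auto simp: depends_on_def)
  from Eid_pre[OF assms _ _ this] N
  have "ev (Eid s1 N) (pre N) = (\<lambda>c. pre N c * ((xs N - 1 / xs N) / (xs N - 1 / xs N)))"
    by (subst pre_N) (simp add: qubit_def)
  then show ?thesis using xN by simp
qed

section \<open>The submodule generated by the product vector\<close>

definition reach :: "cfun set"
  where "reach = {ev p (pre N) | p. p \<in> carr N}"

lemma reach_T: "F \<in> reach \<Longrightarrow> i \<le> N \<Longrightarrow> T i F \<in> reach"
  unfolding reach_def
proof clarify
  fix p assume "p \<in> carr N" "i \<le> N"
  then show "\<exists>r. T i (ev p (pre N)) = ev r (pre N) \<and> r \<in> carr N"
    by (intro exI[of _ "gen i * p"]) (simp add: ev_mult)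
qed

lemma reach_add:
  assumes "F \<in> reach" "G \<in> reach"
  shows "(\<lambda>c. F c + G c) \<in> reach"
proof -
  from assms obtain p r where "p \<in> carr N" "r \<in> carr N" "F = ev p (pre N)" "G = ev r (pre N)"
    by (auto simp: reach_def)
  then show ?thesis
    unfolding reach_def by (intro CollectI exI[of _ "p + r"]) (simp add: ev_plus fun_eq_iff)
qed

lemma reach_scale:
  assumes "F \<in> reach"
  shows "(\<lambda>c. a * F c) \<in> reach"
proof -
  from assms obtain p where "p \<in> carr N" "F = ev p (pre N)"
    by (auto simp: reach_def)
  then show ?thesis
    unfolding reach_def by (intro CollectI exI[of _ "scal a * p"]) (simp add: ev_mult)
qed

lemma reach_move:
  assumes m: "Suc m \<le> j" "Suc j \<le> N"
    and IH: "\<And>f. depends_on ({Suc m..N} - {j}) f \<Longrightarrow>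
      (\<lambda>c. pre m c * (qubit y (c j) * f c)) \<in> reach"
    and f: "depends_on ({Suc m..N} - {Suc j}) f"
  shows "(\<lambda>c. pre m c * (qubit (y / q) (c (Suc j)) * f c)) \<in> reach"
proof -
  \<comment> \<open>Parallel spins at \<open>j\<close> and \<open>j + 1\<close> are out of reach of
    \<open>e_j\<close> and force \<open>f1\<close>. What then remains of the target is antiparallel
    with coefficients in the ratio \<open>1 : - q\<close>, the image of \<open>e_j\<close>, and
    \<open>f2\<close> supplies a preimage.\<close>
  define f1 where "f1 c = (if c (Suc j) then f (c(j := True)) / q else f (c(j := False)))" for c
  define f2 where "f2 c = (if c (Suc j) then y * f (c(j := False)) - f (c(j := True)) else 0)" for c
  have Tj: "T j = bulk_op q j" using m by (simp add: T_bulk)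
  have upd: "f (c(j := b)) = f (d(j := b))" if "\<And>k. k \<in> {Suc m..N} - {j} - {Suc j} \<Longrightarrow> c k = d k" for c d b
    by (rule depends_onD[OF f]) (use that in auto)
  have "depends_on ({Suc m..N} - {j}) f1" "depends_on ({Suc m..N} - {j}) f2"
  proof -
    have "Suc j \<in> {Suc m..N} - {j}" using m by auto
    then have same: "f1 c = f1 d" "f2 c = f2 d" if "\<And>k. k \<in> {Suc m..N} - {j} \<Longrightarrow> c k = d k" for c d
      using that upd[of c d True] upd[of c d False] by (simp_all add: f1_def f2_def)
    show "depends_on ({Suc m..N} - {j}) f1"
      by (rule depends_onI) (rule same(1), blast)
    show "depends_on ({Suc m..N} - {j}) f2"
      by (rule depends_onI) (rule same(2), blast)
  qed
  then have "(\<lambda>c. pre m c * (qubit y (c j) * f1 c) +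
      T j (\<lambda>c. pre m c * (qubit y (c j) * f2 c)) c) \<in> reach"
    using m by (intro reach_add reach_T IH) auto
  also have "(\<lambda>c. pre m c * (qubit y (c j) * f1 c) +
      T j (\<lambda>c. pre m c * (qubit y (c j) * f2 c)) c)
    = (\<lambda>c. pre m c * (qubit (y / q) (c (Suc j)) * f c))"
  proof (rule ext)
    fix c :: "nat \<Rightarrow> bool"
    have upd2: "f (c(Suc j := d, j := b)) = f (c(j := b))" for b d
      by (rule upd) auto
    have f2: "f2 (c(j := a, Suc j := d)) = (if d then y * f (c(j := False)) - f (c(j := True)) else 0)" for a d
      by (simp add: f2_def upd2 fun_upd_twist[of j "Suc j"])
    have pre: "pre m (c(j := a, Suc j := d)) = pre m c" for a d
      using m by (simp add: pre_upd)
    have cj: "f c = f (c(j := c j))" by simp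
    let ?b = "if c j = c (Suc j) then 0 else
        (if c j then q else 1 / q) * (qubit y (c j) * f2 c) -
        qubit y (c (Suc j)) * (if c j then y * f (c(j := False)) - f (c(j := True)) else 0)"
    have b: "T j (\<lambda>c. pre m c * (qubit y (c j) * f2 c)) c = pre m c * ?b"
      by (simp add: Tj bulk_op_def f2 pre right_diff_distrib mult_ac)
    have "qubit y (c j) * f1 c + ?b = qubit (y / q) (c (Suc j)) * f c"
      by (subst cj) (use q in \<open>cases "c j"; cases "c (Suc j)"; simp add: f1_def f2_def qubit_def field_simps\<close>)
    then show "pre m c * (qubit y (c j) * f1 c) + T j (\<lambda>c. pre m c * (qubit y (c j) * f2 c)) c
       = pre m c * (qubit (y / q) (c (Suc j)) * f c)"
      unfolding b by (simp only: distrib_left[symmetric])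
  qed
  finally show ?thesis .
qed

lemma reach_boundary:
  assumes m: "m < N"
    and IH: "\<And>f. depends_on ({Suc m..N} - {N}) f \<Longrightarrow>
      (\<lambda>c. pre m c * (qubit y (c N) * f c)) \<in> reach"
    and y: "y \<noteq> 1 / (t * z)" "z \<noteq> t * y"
    and f: "depends_on {Suc m..N} f"
  shows "(\<lambda>c. pre m c * f c) \<in> reach"
proof -
  \<comment> \<open>\<open>(1, w)\<close> spans the image of \<open>e_N\<close> on site
    \<open>N\<close>; \<open>f1\<close> and \<open>f2\<close> are the coordinates of
    \<open>f\<close> in the basis \<open>(1, y)\<close>, \<open>(1, w)\<close>.\<close>
  define w where "w = 1 / (t * z)"
  define f2 where "f2 c = (f (c(N := True)) - y * f (c(N := False))) / (w - y)" for c
  define f1 where "f1 c = f (c(N := False)) - f2 c" for c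
  have wy: "w - y \<noteq> 0" using y(1) by (simp add: w_def)
  have upd: "f (c(N := b)) = f (d(N := b))" if "\<And>k. k \<in> {Suc m..N} - {N} \<Longrightarrow> c k = d k" for c d b
    by (rule depends_onD[OF f]) (use that in auto)
  have same: "f1 c = f1 d" "f2 c = f2 d" if "\<And>k. k \<in> {Suc m..N} - {N} \<Longrightarrow> c k = d k" for c d
    using upd[of c d True, OF that] upd[of c d False, OF that] by (simp_all add: f1_def f2_def)
  have d1: "depends_on ({Suc m..N} - {N}) f1"
    by (rule depends_onI) (rule same(1), blast)
  have d2: "depends_on ({Suc m..N} - {N}) f2"
    by (rule depends_onI) (rule same(2), blast)
  have "(\<lambda>c. pre m c * (qubit y (c N) * f1 c) +
      k2 / (z - t * y) * T N (\<lambda>c. pre m c * (qubit y (c N) * f2 c)) c) \<in> reach"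
    by (intro reach_add reach_scale reach_T IH d1 d2) simp
  also have "(\<lambda>c. pre m c * (qubit y (c N) * f1 c) +
      k2 / (z - t * y) * T N (\<lambda>c. pre m c * (qubit y (c N) * f2 c)) c)
    = (\<lambda>c. pre m c * f c)"
  proof (rule ext)
    fix c :: "nat \<Rightarrow> bool"
    have f2: "f2 (c(N := b)) = f2 c" for b by (simp add: f2_def)
    have pre: "pre m (c(N := a)) = pre m c" for a
      using m by (simp add: pre_upd)
    have "T N (\<lambda>c. pre m c * (qubit y (c N) * f2 c)) c
        = (z - t * y) / k2 * (pre m c * (qubit w (c N) * f2 c))"
      by (simp add: T_N site_op_def pre f2 right_rank_one qubit_def w_def diff_divide_distrib left_diff_distrib right_diff_distrib mult_ac)
    then have "k2 / (z - t * y) * T N (\<lambda>c. pre m c * (qubit y (c N) * f2 c)) c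
        = pre m c * (qubit w (c N) * f2 c)"
      using k_nonzero y(2) by simp
    moreover have "qubit y (c N) * f1 c + qubit w (c N) * f2 c = f c"
    proof -
      have "f2 c * (w - y) = f (c(N := True)) - y * f (c(N := False))"
        using wy by (simp add: f2_def)
      then show ?thesis
        using fun_upd_idem[of c N True] fun_upd_idem[of c N False]
        by (cases "c N") (simp_all add: qubit_def f1_def algebra_simps)
    qed
    ultimately show "pre m c * (qubit y (c N) * f1 c) +
        k2 / (z - t * y) * T N (\<lambda>c. pre m c * (qubit y (c N) * f2 c)) c = pre m c * f c"
      by (simp flip: distrib_left)
  qed
  finally show ?thesis .
qed

text \<open>Starting from the boundary, the tensor factors of \<open>pre N\<close> are freed one after the other:
  the factor at site \<open>m\<close> is moved to site \<open>N\<close>, being divided by \<open>q\<close> at each step.\<close>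

lemma reach_all:
  assumes generic: "\<And>m. 1 \<le> m \<Longrightarrow> m \<le> N \<Longrightarrow>
      xs m / q ^ (N - m) \<noteq> 1 / (t * z) \<and> z \<noteq> t * (xs m / q ^ (N - m))"
    and "depends_on {1..N} f"
  shows "f \<in> reach"
proof -
  \<comment> \<open>\<open>m\<close> is the number of factors still fixed; the induction descends
    from \<open>N\<close> to \<open>0\<close>.\<close>
  have free: "(\<lambda>c. pre m c * f c) \<in> reach" if "m \<le> N" "depends_on {Suc m..N} f" for m f
    using that
  proof (induction m arbitrary: f rule: inc_induct)
    case base
    have "f = (\<lambda>c. f (\<lambda>_. False))"
      by (rule ext) (rule depends_onD[OF base], simp)
    then have "(\<lambda>c. pre N c * f c) = ev (scal (f (\<lambda>_. False))) (pre N)"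
      by (simp add: mult.commute fun_eq_iff)
    then show ?case
      unfolding reach_def by blast
  next
    case (step m)
    \<comment> \<open>The factor of site \<open>m + 1\<close> has travelled to \<open>j\<close>; all
      other sites after \<open>m\<close> are arbitrary.\<close>
    have moved: "(\<lambda>c. pre m c * (qubit (xs (Suc m) / q ^ (j - Suc m)) (c j) * f c)) \<in> reach"
      if "Suc m \<le> j" "j \<le> N" "depends_on ({Suc m..N} - {j}) f" for j f
      using that
    proof (induction j arbitrary: f rule: nat_induct_at_least)
      case base
      have "{Suc m..N} - {Suc m} = {Suc (Suc m)..N}" by auto
      with step.IH[of f] base show ?case
        by (simp add: pre_Suc mult.assoc)
    next
      case (Suc j)
      have "(\<lambda>c. pre m c * (qubit (xs (Suc m) / q ^ (j - Suc m) / q) (c (Suc j)) * f c)) \<in> reach"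
        by (rule reach_move) (use Suc in auto)
      moreover have "xs (Suc m) / q ^ (j - Suc m) / q = xs (Suc m) / q ^ (Suc j - Suc m)"
      proof -
        have "Suc j - Suc m = Suc (j - Suc m)" using Suc.hyps by simp
        then show ?thesis by (simp add: mult.commute)
      qed
      ultimately show ?case by simp
    qed
    have "(\<lambda>c. pre m c * f c) \<in> reach"
      by (rule reach_boundary[where y = "xs (Suc m) / q ^ (N - Suc m)"])
        (use generic[of "Suc m"] step moved[of N] in auto)
    then show ?case by simp
  qed
  from free[of 0 f] assms(2) show ?thesis by simp
qed

end

section \<open>A spanning set of the quotient module\<close>

text \<open>Product of the generators with index below \<open>k\<close> and of the parity of
  \<open>k - 1\<close>. For either parity of \<open>N\<close>, \<open>alt N\<close> and
  \<open>alt (Suc N)\<close> are the two products of the double quotient, the second one containing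
  \<open>e_N\<close>; this avoids a case distinction.\<close>

fun alt :: "nat \<Rightarrow> free" where
  "alt 0 = 1"
| "alt (Suc 0) = gen 0"
| "alt (Suc (Suc k)) = alt k * gen (Suc k)"

text \<open>\<open>cl\<close> is an abstract class map, so computations stay among representatives
  in the free algebra. The double relation is the one that begins and ends with the product
  containing \<open>e_(N-1)\<close>.\<close>

locale tl_quotient =
  fixes N :: nat and cl :: "free \<Rightarrow> 'a" and s1 s2 d b :: complex
  assumes N: "2 \<le> N" and s1: "s1 \<noteq> 0" and b: "b \<noteq> 0"
    and cl_add: "\<lbrakk>p \<in> carr N; p' \<in> carr N; r \<in> carr N; r' \<in> carr N; cl p = cl p'; cl r = cl r'\<rbrakk>
      \<Longrightarrow> cl (p + r) = cl (p' + r')"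
    and cl_mult: "\<lbrakk>p \<in> carr N; p' \<in> carr N; r \<in> carr N; r' \<in> carr N; cl p = cl p'; cl r = cl r'\<rbrakk>
      \<Longrightarrow> cl (p * r) = cl (p' * r')"
    and rel_square: "1 \<le> i \<Longrightarrow> i < N \<Longrightarrow> cl (gen i * gen i) = cl (scal d * gen i)"
    and rel_left: "cl (gen 0 * gen 0) = cl (scal s1 * gen 0)"
    and rel_right: "cl (gen N * gen N) = cl (scal s2 * gen N)"
    and rel_braid: "\<lbrakk>1 \<le> i; i < N; j = i + 1 \<or> j = i - 1\<rbrakk> \<Longrightarrow> cl (gen i * gen j * gen i) = cl (gen i)"
    and rel_commute: "\<lbrakk>i \<le> N; j \<le> N; i + 1 < j\<rbrakk> \<Longrightarrow> cl (gen i * gen j) = cl (gen j * gen i)"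
    and rel_double: "cl (alt N * alt (Suc N) * alt N) = cl (scal b * alt N)"
begin

definition sim :: "free \<Rightarrow> free \<Rightarrow> bool" (infix \<open>\<doteq>\<close> 50)
  where "p \<doteq> r \<longleftrightarrow> p \<in> carr N \<and> r \<in> carr N \<and> cl p = cl r"

text \<open>Scalars such as powers of the boundary weight and \<open>b\<close> matter only through
  being invertible. As an equivalence relation this lets long chains of rewriting ignore
  them.\<close>

definition propto :: "free \<Rightarrow> free \<Rightarrow> bool" (infix \<open>\<propto>\<close> 50)
  where "p \<propto> r \<longleftrightarrow> (\<exists>c. c \<noteq> 0 \<and> p \<doteq> scal c * r) \<and> r \<in> carr N"

lemma sim_carr: "p \<doteq> r \<Longrightarrow> p \<in> carr N" "p \<doteq> r \<Longrightarrow> r \<in> carr N"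
  by (simp_all add: sim_def)

lemma sim_refl: "p \<in> carr N \<Longrightarrow> p \<doteq> p"
  and sim_sym: "p \<doteq> r \<Longrightarrow> r \<doteq> p"
  and sim_trans [trans]: "p \<doteq> r \<Longrightarrow> r \<doteq> u \<Longrightarrow> p \<doteq> u"
  and sim_add: "p \<doteq> p' \<Longrightarrow> r \<doteq> r' \<Longrightarrow> p + r \<doteq> p' + r'"
  and sim_mult: "p \<doteq> p' \<Longrightarrow> r \<doteq> r' \<Longrightarrow> p * r \<doteq> p' * r'"
  by (auto simp: sim_def intro: cl_add cl_mult)

lemma sim_left: "p \<in> carr N \<Longrightarrow> r \<doteq> r' \<Longrightarrow> p * r \<doteq> p * r'"
  by (simp add: sim_mult sim_refl)

lemma sim_right: "p \<in> carr N \<Longrightarrow> r \<doteq> r' \<Longrightarrow> r * p \<doteq> r' * p"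
  by (simp add: sim_mult sim_refl)

lemma sim_imp_propto: "p \<doteq> r \<Longrightarrow> p \<propto> r"
  unfolding propto_def by (intro conjI exI[of _ 1]) (auto simp: sim_def)

lemma scal_propto: "c \<noteq> 0 \<Longrightarrow> p \<in> carr N \<Longrightarrow> scal c * p \<propto> p"
  unfolding propto_def by (auto intro: sim_refl)

lemma propto_refl: "p \<in> carr N \<Longrightarrow> p \<propto> p"
  by (simp add: sim_imp_propto sim_refl)

lemma propto_sym:
  assumes "p \<propto> r" shows "r \<propto> p"
proof -
  from assms obtain c where c: "c \<noteq> 0" "p \<doteq> scal c * r" "r \<in> carr N" by (auto simp: propto_def)
  from sim_left[OF carr_scal c(2), of "1 / c"] c have "scal (1 / c) * p \<doteq> r"
    by (simp flip: mult.assoc scal_mult)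
  then show ?thesis
    using c unfolding propto_def by (intro conjI exI[of _ "1 / c"]) (auto simp: sim_sym sim_carr)
qed

lemma propto_trans [trans]:
  assumes "p \<propto> r" "r \<propto> u" shows "p \<propto> u"
proof -
  from assms obtain c c' where c: "c \<noteq> 0" "p \<doteq> scal c * r" "c' \<noteq> 0" "r \<doteq> scal c' * u" "u \<in> carr N"
    by (auto simp: propto_def)
  from c(2) sim_left[OF carr_scal c(4), of c] have "p \<doteq> scal c * (scal c' * u)" by (rule sim_trans)
  then have "p \<doteq> scal (c * c') * u" by (simp add: scal_mult mult.assoc)
  then show ?thesis
    using c unfolding propto_def by (intro conjI exI[of _ "c * c'"]) auto
qed

lemma sim_propto_trans [trans]: "p \<doteq> r \<Longrightarrow> r \<propto> u \<Longrightarrow> p \<propto> u"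
  and propto_sim_trans [trans]: "p \<propto> r \<Longrightarrow> r \<doteq> u \<Longrightarrow> p \<propto> u"
  using propto_trans sim_imp_propto by blast+

lemma propto_left:
  assumes "p \<in> carr N" "r \<propto> u" shows "p * r \<propto> p * u"
proof -
  from assms obtain c where c: "c \<noteq> 0" "r \<doteq> scal c * u" "u \<in> carr N" by (auto simp: propto_def)
  from sim_left[OF assms(1) c(2)] c assms(1) show ?thesis
    unfolding propto_def by (auto simp: scal_left_commute)
qed

section \<open>The tower of idempotents and the alternating products\<close>

abbreviation e :: "nat \<Rightarrow> free" where "e \<equiv> gen"
abbreviation E :: "nat \<Rightarrow> free" where "E \<equiv> Eid s1"

declare Eid.simps(2) [simp del]

lemma E_carr [simp]: "k \<le> N \<Longrightarrow> E k \<in> carr N"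
  by (induction k) (auto simp: Eid.simps(2))

lemma alt_carr [simp]: "k \<le> Suc N \<Longrightarrow> alt k \<in> carr N"
  by (induction k rule: alt.induct) auto

lemma commute: "\<lbrakk>i \<le> N; j \<le> N; i + 1 < j \<or> j + 1 < i; y \<in> carr N\<rbrakk> \<Longrightarrow> e i * (e j * y) \<doteq> e j * (e i * y)"
proof -
  assume a: "i \<le> N" "j \<le> N" "i + 1 < j \<or> j + 1 < i" "y \<in> carr N"
  then have "e i * e j \<doteq> e j * e i"
    using rel_commute[of i j] rel_commute[of j i] by (auto simp: sim_def)
  from sim_right[OF a(4) this] show ?thesis by (simp add: mult.assoc)
qed

lemma braid: "\<lbrakk>1 \<le> i; i < N; j = Suc i \<or> Suc j = i; y \<in> carr N\<rbrakk> \<Longrightarrow> e i * (e j * (e i * y)) \<doteq> e i * y"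
proof -
  assume a: "1 \<le> i" "i < N" "j = Suc i \<or> Suc j = i" "y \<in> carr N"
  then have "e i * e j * e i \<doteq> e i"
    using rel_braid[of i j] by (auto simp: sim_def)
  from sim_right[OF a(4) this] show ?thesis by (simp add: mult.assoc)
qed

lemma square:
  assumes "i \<le> N" "y \<in> carr N" shows "\<exists>c. e i * (e i * y) \<doteq> scal c * (e i * y)"
proof -
  have "\<exists>c. e i * e i \<doteq> scal c * e i"
  proof -
    consider "i = 0" | "i = N" | "1 \<le> i" "i < N" using assms(1) by linarith
    then show ?thesis
      using rel_square[of i] rel_left rel_right assms(1) unfolding sim_def
      by cases (blast intro: carr_mult carr_gen carr_scal)+
  qed
  then obtain c where "e i * e i \<doteq> scal c * e i" ..
  from sim_right[OF assms(2) this] show ?thesis by (auto simp: mult.assoc)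
qed

lemma square_0: "y \<in> carr N \<Longrightarrow> e 0 * (e 0 * y) \<propto> e 0 * y"
proof -
  assume y: "y \<in> carr N"
  have "e 0 * e 0 \<doteq> scal s1 * e 0" using rel_left by (simp add: sim_def)
  from sim_right[OF y this] show ?thesis
    using sim_propto_trans[OF _ scal_propto[OF s1]] y by (simp add: mult.assoc)
qed

lemma E_Suc: "k < N \<Longrightarrow> y \<in> carr N \<Longrightarrow> E (Suc k) * y \<propto> E k * (e k * (E k * y))"
  using scal_propto[of "s1 powi ((- 1) ^ Suc k)" "E k * (e k * (E k * y))"] s1 by (simp add: Eid.simps(2) mult.assoc)

lemma E_1: "y \<in> carr N \<Longrightarrow> E (Suc 0) * y \<propto> e 0 * y"
  using E_Suc[of 0 y] N by simp

text \<open>\<open>E k\<close> is built from letters below \<open>k\<close>, none of which is a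
  neighbour of \<open>i\<close>.\<close>

lemma E_commute: "\<lbrakk>k < i; i \<le> N; y \<in> carr N\<rbrakk> \<Longrightarrow> e i * (E k * y) \<propto> E k * (e i * y)"
proof (induction k arbitrary: y)
  case (Suc k)
  note Suc.prems(3) [simp]
  have [simp]: "k < N" "k \<le> N" "k < i" "i \<le> N" "Suc k < i" using Suc.prems by simp_all
  have "e i * (E (Suc k) * y) \<propto> e i * (E k * (e k * (E k * y)))"
    by (intro propto_left E_Suc) auto
  also have "\<dots> \<propto> E k * (e i * (e k * (E k * y)))"
    by (rule Suc.IH) auto
  also have "\<dots> \<propto> E k * (e k * (e i * (E k * y)))"
    by (intro propto_left sim_imp_propto commute) auto
  also have "\<dots> \<propto> E k * (e k * (E k * (e i * y)))"
    by (intro propto_left Suc.IH) auto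
  also have "\<dots> \<propto> E (Suc k) * (e i * y)"
    by (intro propto_sym[OF E_Suc]) auto
  finally show ?case .
qed (simp add: propto_refl)

lemma alt_commute: "\<lbrakk>k < i; i \<le> N; y \<in> carr N\<rbrakk> \<Longrightarrow> e i * (alt k * y) \<propto> alt k * (e i * y)"
proof (induction k arbitrary: y rule: alt.induct)
  case 2
  then show ?case by (simp add: sim_imp_propto commute)
next
  case (3 k)
  note "3.prems"(3) [simp]
  have [simp]: "k \<le> Suc N" "Suc k \<le> N" "k < i" "i \<le> N" "Suc (Suc k) < i" "Suc k < i" using "3.prems" by simp_all
  have "e i * (alt k * (e (Suc k) * y)) \<propto> alt k * (e i * (e (Suc k) * y))"
    by (rule "3.IH") auto
  also have "\<dots> \<propto> alt k * (e (Suc k) * (e i * y))"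
    by (intro propto_left sim_imp_propto commute) auto
  finally show ?case by (simp add: mult.assoc)
qed (simp add: propto_refl)

lemma alt_Suc_Suc: "\<lbrakk>k < N; y \<in> carr N\<rbrakk> \<Longrightarrow> e (Suc k) * (alt k * y) \<propto> alt (Suc (Suc k)) * y"
  using alt_commute[of k "Suc k" y] by (simp add: mult.assoc)

text \<open>Idempotence up to \<open>k\<close> is a hypothesis because the lemma is used inside the
  induction that proves it.\<close>

lemma E_absorb_aux:
  assumes "k \<le> N" and idem: "\<And>i y. i \<le> k \<Longrightarrow> y \<in> carr N \<Longrightarrow> E i * (E i * y) \<propto> E i * y"
    and "j \<le> k" "y \<in> carr N"
  shows "E j * (E k * y) \<propto> E k * y \<and> E k * (E j * y) \<propto> E k * y"
  using assms(3,1,2,4)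
proof (induction k arbitrary: y rule: nat_induct_at_least)
  case base
  then show ?case by blast
next
  case (Suc k)
  note Suc.prems(3) [simp]
  have [simp]: "j \<le> N" "k \<le> N" "k < N" "Suc k \<le> N" using Suc.hyps Suc.prems by simp_all
  have IH: "E j * (E k * y) \<propto> E k * y" "E k * (E j * y) \<propto> E k * y" if "y \<in> carr N" for y
    using Suc.IH[OF _ Suc.prems(2)] that by auto
  have "E j * (E (Suc k) * y) \<propto> E j * (E k * (e k * (E k * y)))"
    by (intro propto_left E_Suc) auto
  also have "\<dots> \<propto> E k * (e k * (E k * y))"
    by (intro IH) auto
  also have "\<dots> \<propto> E (Suc k) * y"
    by (intro propto_sym[OF E_Suc]) auto
  finally have 1: "E j * (E (Suc k) * y) \<propto> E (Suc k) * y" .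
  have "E (Suc k) * (E j * y) \<propto> E k * (e k * (E k * (E j * y)))"
    by (intro E_Suc) auto
  also have "\<dots> \<propto> E k * (e k * (E k * y))"
    by (intro propto_left IH) auto
  also have "\<dots> \<propto> E (Suc k) * y"
    by (intro propto_sym[OF E_Suc]) auto
  finally show ?case using 1 by simp
qed

text \<open>The two claims need each other. Squaring \<open>E k\<close> meets
  \<open>e_j E_j e_j\<close> with \<open>j = k - 1\<close>, which the sandwich rule reduces. The
  sandwich rule at \<open>k\<close> in turn expands \<open>E k\<close> around \<open>e_j\<close>,
  uses \<open>e_k e_j e_k = e_k\<close>, and merges two copies of \<open>E j\<close>.\<close>

lemma E_idem_sandwich:
  "k \<le> N \<Longrightarrow> y \<in> carr N \<Longrightarrow> E k * (E k * y) \<propto> E k * y"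
  "1 \<le> k \<Longrightarrow> k < N \<Longrightarrow> y \<in> carr N \<Longrightarrow> e k * (E k * (e k * y)) \<propto> e k * (E (k - 1) * y)"
proof (induction k arbitrary: y rule: less_induct)
  case (less k)
  have sandwich: "e k * (E k * (e k * y)) \<propto> e k * (E i * y)"
    if k: "k = Suc i" "k < N" and y [simp]: "y \<in> carr N" for i y
  proof -
    have [simp]: "i < N" "i \<le> N" "Suc i \<le> N" using k by simp_all
    have "e k * (E k * (e k * y)) \<propto> e k * (E i * (e i * (E i * (e k * y))))"
      unfolding k by (intro propto_left E_Suc) auto
    also have "\<dots> \<propto> E i * (e k * (e i * (E i * (e k * y))))"
      unfolding k by (intro E_commute) auto
    also have "\<dots> \<propto> E i * (e k * (e i * (e k * (E i * y))))"
      unfolding k by (intro propto_left propto_sym[OF E_commute]) auto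
    also have "\<dots> \<propto> E i * (e k * (E i * y))"
      unfolding k by (intro propto_left sim_imp_propto braid) (use k in auto)
    also have "\<dots> \<propto> e k * (E i * (E i * y))"
      unfolding k by (intro propto_sym[OF E_commute]) auto
    also have "\<dots> \<propto> e k * (E i * y)"
      by (intro propto_left less.IH(1)) (use k in auto)
    finally show ?thesis .
  qed
  {
    case 1
    note 1 [simp]
    consider "k = 0" | "k = Suc 0" | i where "k = Suc (Suc i)" by (metis not0_implies_Suc)
    then show ?case
    proof cases
      case 1
      then show ?thesis by (simp add: propto_refl)
    next
      case 2
      have "E k * (E k * y) \<propto> e 0 * (E k * y)"
        unfolding 2 by (rule E_1) (use N in auto)
      also have "\<dots> \<propto> e 0 * (e 0 * y)"
        unfolding 2 by (intro propto_left E_1) auto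
      also have "\<dots> \<propto> e 0 * y"
        by (rule square_0) auto
      also have "\<dots> \<propto> E k * y"
        unfolding 2 by (rule propto_sym[OF E_1]) auto
      finally show ?thesis .
    next
      case (3 i)
      let ?j = "Suc i"
      have [simp]: "?j < N" "?j \<le> N" "i \<le> N" "Suc ?j \<le> N" using 3 \<open>k \<le> N\<close> by simp_all
      have absorb: "E i * (E ?j * y) \<propto> E ?j * y" if "y \<in> carr N" for y
      proof (rule conjunct1, rule E_absorb_aux)
        show "E l * (E l * u) \<propto> E l * u" if "l \<le> ?j" "u \<in> carr N" for l u
        proof (rule less.IH(1))
          have "?j \<le> N" by simp
          with that(1) show "l \<le> N" by (rule order.trans)
        qed (use that 3 in auto)
      qed (use that in auto)
      have "E k * (E k * y) \<propto> E ?j * (e ?j * (E ?j * (E k * y)))"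
        unfolding 3 by (rule E_Suc) auto
      also have "\<dots> \<propto> E ?j * (e ?j * (E ?j * (E ?j * (e ?j * (E ?j * y)))))"
        unfolding 3 by (intro propto_left E_Suc) auto
      also have "\<dots> \<propto> E ?j * (e ?j * (E ?j * (e ?j * (E ?j * y))))"
        by (intro propto_left less.IH(1)) (use 3 in auto)
      also have "\<dots> \<propto> E ?j * (e ?j * (E i * (E ?j * y)))"
        by (rule propto_left) (use less.IH(2)[of ?j "E ?j * y"] 3 in auto)
      also have "\<dots> \<propto> E ?j * (e ?j * (E ?j * y))"
        by (intro propto_left absorb) auto
      also have "\<dots> \<propto> E k * y"
        unfolding 3 by (rule propto_sym[OF E_Suc]) auto
      finally show ?thesis .
    qed
  next
    case 2
    then show ?case using sandwich[of "k - 1" y] by simp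
  }
qed

lemma E_idem: "k \<le> N \<Longrightarrow> y \<in> carr N \<Longrightarrow> E k * (E k * y) \<propto> E k * y"
  by (rule E_idem_sandwich(1))

lemma E_sandwich: "Suc k < N \<Longrightarrow> y \<in> carr N \<Longrightarrow> e (Suc k) * (E (Suc k) * (e (Suc k) * y)) \<propto> e (Suc k) * (E k * y)"
  using E_idem_sandwich(2)[of "Suc k" y] by simp

lemma E_absorb:
  assumes "j \<le> k" "k \<le> N" "y \<in> carr N"
  shows "E j * (E k * y) \<propto> E k * y" "E k * (E j * y) \<propto> E k * y"
  using E_absorb_aux[of k j y] E_idem assms by auto

lemma e_E_Suc:
  assumes "1 \<le> k" "k < N" and y [simp]: "y \<in> carr N"
  shows "e k * (E (Suc k) * y) \<propto> e k * (E k * y)"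
proof -
  obtain i where i: "k = Suc i" using assms by (cases k) auto
  have [simp]: "i \<le> N" "Suc i < N" "Suc i \<le> N" "i < N" using assms i by simp_all
  have "e k * (E (Suc k) * y) \<propto> e k * (E k * (e k * (E k * y)))"
    unfolding i by (intro propto_left E_Suc) auto
  also have "\<dots> \<propto> e k * (E i * (E k * y))"
    unfolding i by (intro E_sandwich) auto
  also have "\<dots> \<propto> e k * (E k * y)"
    unfolding i by (intro propto_left E_absorb) auto
  finally show ?thesis .
qed

text \<open>Up to commutation \<open>alt k\<close> begins with \<open>e_(k-1)\<close>, which meets
  the middle letter of \<open>E k\<close> in a sandwich; the smaller idempotent left over is
  absorbed.\<close>

lemma E_alt_lower:
  "\<lbrakk>k \<le> N; y \<in> carr N\<rbrakk> \<Longrightarrow> E k * (alt k * y) \<propto> E (k - 1) * (alt k * y)"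
proof (cases k rule: alt.cases)
  case 2
  assume y [simp]: "y \<in> carr N"
  have "E (Suc 0) * (e 0 * y) \<propto> e 0 * (e 0 * y)" by (rule E_1) auto
  also have "\<dots> \<propto> e 0 * y" by (rule square_0) auto
  finally show ?thesis unfolding 2 by simp
next
  case (3 i)
  assume a: "k \<le> N" and y [simp]: "y \<in> carr N"
  have [simp]: "i \<le> N" "Suc i < N" "Suc i \<le> N" "i < N" "i \<le> Suc N" using a 3 by simp_all
  let ?j = "Suc i"
  have "E (Suc ?j) * (alt (Suc ?j) * y) \<propto> E ?j * (e ?j * (E ?j * (alt (Suc ?j) * y)))"
    by (rule E_Suc) auto
  also have "\<dots> \<propto> E ?j * (e ?j * (E ?j * (e ?j * (alt i * y))))"
    by (intro propto_left propto_sym[OF alt_Suc_Suc]) auto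
  also have "\<dots> \<propto> E ?j * (e ?j * (E i * (alt i * y)))"
    by (intro propto_left E_sandwich) auto
  also have "\<dots> \<propto> E ?j * (E i * (e ?j * (alt i * y)))"
    by (intro propto_left E_commute) auto
  also have "\<dots> \<propto> E ?j * (e ?j * (alt i * y))"
    by (intro E_absorb) auto
  also have "\<dots> \<propto> E ?j * (alt (Suc ?j) * y)"
    by (intro propto_left alt_Suc_Suc) auto
  finally show ?thesis unfolding 3 by simp
qed (simp add: propto_refl)

text \<open>Trades one level of the tower for an extra alternating product on the left. Repeated in
  \<open>e_last\<close>, this produces the word of the double relation.\<close>

lemma E_alt_Suc:
  "\<lbrakk>k \<le> N; y \<in> carr N\<rbrakk> \<Longrightarrow> E k * (alt (Suc k) * y) \<propto> E (k - 1) * (alt k * (alt (Suc k) * y))"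
proof (induction k arbitrary: y rule: alt.induct)
  case 2
  then show ?case using E_1[of "e (Suc 0) * y"] by simp
next
  case (3 k)
  note y [simp] = \<open>y \<in> carr N\<close>
  have [simp]: "k \<le> N" "Suc k < N" "Suc k \<le> N" "k < N" "k - 1 \<le> N" "Suc (Suc k) \<le> N"
    "k - 1 \<le> Suc k" "k \<le> Suc N" "k - 1 < Suc k" "k - 1 < Suc (Suc k)"
    using 3 by simp_all
  let ?j = "Suc k" and ?l = "Suc (Suc k)"
  have "E ?l * (alt (Suc ?l) * y) \<propto> E ?j * (e ?j * (E ?j * (alt (Suc ?l) * y)))"
    by (rule E_Suc) auto
  also have "\<dots> \<propto> E ?j * (e ?j * (E ?j * (e ?l * (alt ?j * y))))"
    by (intro propto_left propto_sym[OF alt_Suc_Suc]) auto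
  also have "\<dots> \<propto> E ?j * (e ?j * (e ?l * (E ?j * (alt ?j * y))))"
    by (intro propto_left propto_sym[OF E_commute]) auto
  also have "\<dots> \<propto> E ?j * (e ?j * (e ?l * (E k * (alt ?j * y))))"
    using E_alt_lower[of ?j y] by (intro propto_left) auto
  also have "\<dots> \<propto> E ?j * (e ?j * (e ?l * (E (k - 1) * (alt k * (alt ?j * y)))))"
    by (intro propto_left "3.IH") auto
  also have "\<dots> \<propto> E ?j * (e ?j * (E (k - 1) * (e ?l * (alt k * (alt ?j * y)))))"
    by (intro propto_left E_commute) auto
  also have "\<dots> \<propto> E ?j * (E (k - 1) * (e ?j * (e ?l * (alt k * (alt ?j * y)))))"
    by (intro propto_left E_commute) auto
  also have "\<dots> \<propto> E ?j * (e ?j * (e ?l * (alt k * (alt ?j * y))))"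
    by (intro E_absorb) auto
  also have "\<dots> \<propto> E ?j * (e ?j * (alt k * (e ?l * (alt ?j * y))))"
    by (intro propto_left alt_commute) auto
  also have "\<dots> \<propto> E ?j * (e ?j * (alt k * (alt (Suc ?l) * y)))"
    by (intro propto_left alt_Suc_Suc) auto
  also have "\<dots> \<propto> E ?j * (alt ?l * (alt (Suc ?l) * y))"
    by (intro propto_left alt_Suc_Suc) auto
  finally show ?case by simp
qed (simp add: propto_refl)

text \<open>A vector fixed by the whole tower can be given an alternating product: unfolding
  \<open>E k\<close> exposes \<open>e_(k-1)\<close>, and the induction supplies the letters below
  it.\<close>

lemma alt_insert:
  assumes "y \<in> carr N" "\<And>j. j \<le> N \<Longrightarrow> E j * y \<propto> y"
  shows "k \<le> N \<Longrightarrow> y \<propto> E (k - 1) * (alt k * y)"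
proof (induction k rule: alt.induct)
  case 1
  then show ?case using assms by (simp add: propto_refl)
next
  case 2
  have "y \<propto> E (Suc 0) * y" using assms N by (intro propto_sym[OF assms(2)]) auto
  also have "\<dots> \<propto> e 0 * y" by (rule E_1) (rule assms)
  finally show ?case by simp
next
  case (3 k)
  note y [simp] = assms(1)
  let ?j = "Suc k"
  have [simp]: "k \<le> N" "Suc k < N" "Suc k \<le> N" "k < N" "k - 1 \<le> N" "Suc (Suc k) \<le> N"
    "k - 1 \<le> Suc k" "k \<le> Suc N" "k - 1 < Suc k"
    using 3 by simp_all
  have "y \<propto> E (Suc ?j) * y" by (intro propto_sym[OF assms(2)]) auto
  also have "\<dots> \<propto> E ?j * (e ?j * (E ?j * y))" by (rule E_Suc) auto
  also have "\<dots> \<propto> E ?j * (e ?j * y)" by (intro propto_left assms) auto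
  also have "\<dots> \<propto> E ?j * (e ?j * (E (k - 1) * (alt k * y)))" by (intro propto_left "3.IH") auto
  also have "\<dots> \<propto> E ?j * (E (k - 1) * (e ?j * (alt k * y)))" by (intro propto_left E_commute) auto
  also have "\<dots> \<propto> E ?j * (e ?j * (alt k * y))" by (intro E_absorb) auto
  also have "\<dots> \<propto> E ?j * (alt (Suc ?j) * y)" by (intro propto_left alt_Suc_Suc) auto
  finally show ?case by simp
qed

lemma E_N_fix: "j \<le> N \<Longrightarrow> E j * E N \<propto> E N"
  using E_absorb(1)[of j N 1] by simp

text \<open>Both sides reduce to \<open>E (N - 3)\<close> times \<open>alt N\<close> times
  \<open>E N\<close>, with truncated subtraction. The side with \<open>e_N\<close> first becomes the
  word of the double relation, and dividing by \<open>b\<close> is what requires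
  \<open>b \<noteq> 0\<close>.\<close>

lemma e_last: "e (N - 1) * E N \<propto> e (N - 1) * (e N * E N)"
proof -
  obtain n where n: "N = Suc (Suc n)" using N by (metis add_2_eq_Suc le_Suc_ex)
  let ?j = "Suc n" and ?l = "Suc (Suc n)"
  define y where "y = E N"
  have y [simp]: "y \<in> carr N" and fix_y: "\<And>j. j \<le> N \<Longrightarrow> E j * y \<propto> y"
    by (simp_all add: y_def E_N_fix)
  have [simp]: "n \<le> N" "?j \<le> N" "?l \<le> N" "n < N" "?j < N" "n - 1 \<le> N" "n - 1 < ?j" "n < ?l" "n < ?j"
    "n \<le> Suc N" "?j \<le> Suc N" "?l \<le> Suc N" "Suc ?l \<le> Suc N" "n - 1 \<le> n"
    "n - Suc 0 \<le> N" "n - Suc 0 \<le> n" "n - Suc 0 < Suc n"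
    using n by simp_all
  have "e ?j * y \<propto> e ?j * (E (n - 1) * (alt n * y))"
    by (intro propto_left alt_insert fix_y) auto
  also have "\<dots> \<propto> E (n - 1) * (e ?j * (alt n * y))"
    by (intro E_commute) auto
  also have "\<dots> \<propto> E (n - 1) * (alt ?l * y)"
    by (intro propto_left alt_Suc_Suc) auto
  finally have 1: "e ?j * y \<propto> E (n - 1) * (alt ?l * y)" .
  let ?w = "alt ?l * y"
  have w [simp]: "?w \<in> carr N" by auto
  have "y \<propto> E (?l - 1) * ?w"
    by (intro alt_insert fix_y) auto
  then have "e ?j * (e ?l * y) \<propto> e ?j * (e ?l * (E ?j * ?w))"
    by (intro propto_left) auto
  also have "\<dots> \<propto> e ?j * (e ?l * (E n * (alt ?j * ?w)))"
    using E_alt_Suc[of ?j y] by (intro propto_left) auto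
  also have "\<dots> \<propto> e ?j * (E n * (e ?l * (alt ?j * ?w)))"
    by (intro propto_left E_commute) auto
  also have "\<dots> \<propto> e ?j * (E n * (alt (Suc ?l) * ?w))"
    by (intro propto_left alt_Suc_Suc) auto
  also have "\<dots> = e ?j * (E n * (alt ?j * (e ?l * ?w)))"
    by (simp add: mult.assoc)
  also have "\<dots> \<propto> e ?j * (E (n - 1) * (alt n * (alt ?j * (e ?l * ?w))))"
    by (intro propto_left E_alt_Suc) auto
  also have "\<dots> \<propto> E (n - 1) * (e ?j * (alt n * (alt ?j * (e ?l * ?w))))"
    by (intro E_commute) auto
  also have "\<dots> \<propto> E (n - 1) * (alt ?l * (alt ?j * (e ?l * ?w)))"
    by (intro propto_left alt_Suc_Suc) auto
  \<comment> \<open>With \<open>n = N - 2\<close>, the tower has been traded for alternating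
    products down to \<open>E (n - 1)\<close>; the double relation now removes two of the three at
    the cost of \<open>b\<close>.\<close>
  also have "\<dots> = E (n - 1) * (alt N * (alt (Suc N) * (alt N * y)))"
    unfolding n by (simp add: mult.assoc)
  also have "\<dots> \<propto> E (n - 1) * (alt N * y)"
  proof (rule propto_left)
    have "alt N * alt (Suc N) * alt N \<doteq> scal b * alt N"
      using rel_double by (simp add: sim_def)
    from sim_right[OF y this] have "alt N * (alt (Suc N) * (alt N * y)) \<doteq> scal b * (alt N * y)"
      by (simp add: mult.assoc)
    then show "alt N * (alt (Suc N) * (alt N * y)) \<propto> alt N * y"
      using scal_propto[OF b, of "alt N * y"] by (auto intro: sim_propto_trans)
  qed simp
  also have "\<dots> \<propto> e ?j * y"
    using propto_sym[OF 1] unfolding n[symmetric] .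
  finally have "e ?j * (e ?l * y) \<propto> e ?j * y" .
  then show ?thesis using n propto_sym by (simp add: y_def)
qed

text \<open>Below the last site the letter \<open>e_(i+1)\<close> comes from unfolding
  \<open>E (i + 2)\<close>. At \<open>i = N - 1\<close> the tower has no such member, and
  \<open>e_last\<close> takes over.\<close>

lemma e_raise: 
  assumes "1 \<le> i" "i < N" 
  shows "e i * E N \<propto> e i * (e (Suc i) * E N)"
proof (cases "Suc i = N")
  case True
  then show ?thesis using e_last by auto
next
  case False
  let ?j = "Suc i"
  have [simp]: "i \<le> N" "?j \<le> N" "?j < N" "Suc ?j \<le> N" "i < N" "Suc 0 \<le> i" "0 < i"
    using assms False by simp_all
  have "e i * E N \<propto> e i * (E (Suc ?j) * E N)"
    by (intro propto_left propto_sym[OF E_N_fix]) auto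
  also have "\<dots> \<propto> e i * (E ?j * (e ?j * (E ?j * E N)))"
    by (intro propto_left E_Suc) auto
  also have "\<dots> \<propto> e i * (E i * (e ?j * (E ?j * E N)))"
    by (intro e_E_Suc) auto
  also have "\<dots> \<propto> e i * (e ?j * (E i * (E ?j * E N)))"
    by (intro propto_left propto_sym[OF E_commute]) auto
  also have "\<dots> \<propto> e i * (e ?j * (E ?j * E N))"
    by (intro propto_left E_absorb) auto
  also have "\<dots> \<propto> e i * (e ?j * E N)"
    by (intro propto_left E_N_fix) auto
  finally show ?thesis .
qed

lemma e_0_E: "e 0 * E N \<propto> E N" "e 0 * (e 1 * E N) \<propto> E N"
proof -
  have "e 0 * E N \<propto> E (Suc 0) * E N"
    by (intro propto_sym[OF E_1]) auto
  also have "\<dots> \<propto> E N"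
    using N by (intro E_N_fix) auto
  finally show "e 0 * E N \<propto> E N" .
  have [simp]: "Suc 0 \<le> N" "Suc 0 < N" "Suc (Suc 0) \<le> N" using N by simp_all
  have "e 0 * (e 1 * E N) \<propto> E (Suc 0) * (e 1 * E N)"
    by (intro propto_sym[OF E_1]) auto
  also have "\<dots> \<propto> E (Suc 0) * (e 1 * (E (Suc 0) * E N))"
    by (intro propto_left propto_sym[OF E_N_fix]) auto
  also have "\<dots> \<propto> E (Suc (Suc 0)) * E N"
    unfolding One_nat_def by (intro propto_sym[OF E_Suc]) auto
  also have "\<dots> \<propto> E N"
    by (intro E_N_fix) auto
  finally show "e 0 * (e 1 * E N) \<propto> E N" .
qed

end

context tl_quotient
begin

section \<open>Sign sequences and the words attached to them\<close>

text \<open>Half diagrams without through-lines are encoded by sign sequences \<open>w\<close> on the sites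
  \<open>1, \<dots>, N\<close>, where \<open>True\<close> marks an opening parenthesis: an unmatched closing (opening)
  parenthesis is a line to the left (right) boundary. The class of \<open>E N\<close> is the sequence without
  opening parentheses, and the representative of any other sequence is obtained by raising.\<close>

definition valid :: "(nat \<Rightarrow> bool) \<Rightarrow> bool"
  where "valid w \<longleftrightarrow> (\<forall>p. w p \<longrightarrow> 1 \<le> p \<and> p \<le> N)"

definition up :: "nat \<Rightarrow> (nat \<Rightarrow> bool) \<Rightarrow> bool"
  where "up j w \<longleftrightarrow> 1 \<le> j \<and> j \<le> N \<and> \<not> w j \<and> (j < N \<longrightarrow> w (Suc j))"

definition peak :: "nat \<Rightarrow> (nat \<Rightarrow> bool) \<Rightarrow> bool"
  where "peak j w \<longleftrightarrow> 1 \<le> j \<and> j \<le> N \<and> w j \<and> (j < N \<longrightarrow> \<not> w (Suc j))"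

definition raise :: "nat \<Rightarrow> (nat \<Rightarrow> bool) \<Rightarrow> nat \<Rightarrow> bool"
  where "raise j w = (if j < N then w(j := True, Suc j := False) else w(j := True))"

definition lower :: "nat \<Rightarrow> (nat \<Rightarrow> bool) \<Rightarrow> nat \<Rightarrow> bool"
  where "lower j w = (if j < N then w(j := False, Suc j := True) else w(j := False))"

text \<open>An opening is created at \<open>N\<close> and moved left one site per raise, so one at
  \<open>p\<close> costs \<open>N + 1 - p\<close> generators: \<open>len\<close> counts the letters
  applied to \<open>E N\<close>.\<close>

definition len :: "(nat \<Rightarrow> bool) \<Rightarrow> nat"
  where "len w = (\<Sum>p\<in>{1..N}. if w p then Suc N - p else 0)"

lemma len_insert:
  assumes "1 \<le> p" "p \<le> N" "\<not> w p"
  shows "len (w(p := True)) = len w + (Suc N - p)"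
proof -
  have split: "len v = (if v p then Suc N - p else 0) + (\<Sum>k\<in>{1..N} - {p}. if v k then Suc N - k else 0)" for v
    unfolding len_def using assms by (intro sum.remove) auto
  have "(\<Sum>k\<in>{1..N} - {p}. if (w(p := True)) k then Suc N - k else 0)
      = (\<Sum>k\<in>{1..N} - {p}. if w k then Suc N - k else 0)"
    by (intro sum.cong) auto
  then show ?thesis
    unfolding split using assms(3) by (simp only: fun_upd_same if_True if_False)
qed

lemma len_remove:
  assumes "1 \<le> p" "p \<le> N" "w p"
  shows "len w = len (w(p := False)) + (Suc N - p)"
  using len_insert[of p "w(p := False)"] assms by (simp add: fun_upd_idem)

lemma raise_lower:
  assumes "peak j w"
  shows "raise j (lower j w) = w" "up j (lower j w)"
  using assms by (auto simp: peak_def up_def raise_def lower_def fun_eq_iff)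

lemma lower_raise:
  assumes "up j w"
  shows "lower j (raise j w) = w" "peak j (raise j w)"
  using assms by (auto simp: peak_def up_def raise_def lower_def fun_eq_iff)

lemma len_raise:
  assumes "up j w"
  shows "len (raise j w) = Suc (len w)"
proof (cases "j < N")
  case True
  have "len w = len (w(Suc j := False)) + (N - j)"
    using len_remove[of "Suc j" w] assms True by (simp add: up_def)
  moreover have "len (raise j w) = len (w(Suc j := False)) + (Suc N - j)"
    using len_insert[of j "w(Suc j := False)"] assms True
    by (simp add: up_def raise_def fun_upd_twist)
  ultimately show ?thesis using True by simp
next
  case False
  then show ?thesis using len_insert[of j w] assms by (auto simp: up_def raise_def)
qed

lemma len_lower: "peak j w \<Longrightarrow> Suc (len (lower j w)) = len w"
  using len_raise[OF raise_lower(2)] raise_lower(1) by metis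

lemma valid_raise: "valid w \<Longrightarrow> up j w \<Longrightarrow> valid (raise j w)"
  and valid_lower: "valid w \<Longrightarrow> peak j w \<Longrightarrow> valid (lower j w)"
  by (auto simp: valid_def up_def peak_def raise_def lower_def)

lemma peak_exists: "w p \<Longrightarrow> 1 \<le> p \<Longrightarrow> p \<le> N \<Longrightarrow> \<exists>j\<ge>p. peak j w"
proof (induction "N - p" arbitrary: p)
  case 0
  then show ?case unfolding peak_def by (intro exI[of _ p]) auto
next
  case (Suc n)
  show ?case
  proof (cases "w (Suc p)")
    case True
    have "\<exists>j\<ge>Suc p. peak j w"
      using Suc.hyps(2) True by (intro Suc.hyps(1)) auto
    then show ?thesis by (meson Suc_leD)
  next
    case False
    then show ?thesis using Suc.prems by (auto simp: peak_def)
  qed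
qed

inductive path :: "(nat \<Rightarrow> bool) \<Rightarrow> free \<Rightarrow> bool" where
  base: "path (\<lambda>_. False) (E N)"
| raise: "path w y \<Longrightarrow> up j w \<Longrightarrow> path (raise j w) (e j * y)"

lemma path_valid: "path w y \<Longrightarrow> valid w"
  by (induction rule: path.induct) (simp_all add: valid_raise, simp add: valid_def)

lemma path_carr [simp]: "path w y \<Longrightarrow> y \<in> carr N"
  by (induction rule: path.induct) (auto simp: up_def)

lemma path_exists: "valid w \<Longrightarrow> \<exists>y. path w y"
proof (induction "len w" arbitrary: w rule: less_induct)
  case less
  show ?case
  proof (cases "\<exists>p. w p")
    case False
    then have "w = (\<lambda>_. False)" by auto
    then show ?thesis using path.base by auto
  next
    case True
    then obtain j where j: "peak j w" using peak_exists less.prems by (metis valid_def)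
    then obtain y where "path (lower j w) y"
      using less.hyps[of "lower j w"] len_lower[OF j] valid_lower less.prems by auto
    from path.raise[OF this raise_lower(2)[OF j]] show ?thesis
      using raise_lower(1)[OF j] by auto
  qed
qed

lemma peaks_not_adjacent: "peak i w \<Longrightarrow> peak j w \<Longrightarrow> i \<noteq> j \<Longrightarrow> i + 1 < j \<or> j + 1 < i"
  unfolding peak_def by (metis Suc_eq_plus1 Suc_le_lessD less_SucE linorder_neqE_nat not_less_eq)

lemma lower_distant:
  assumes "peak i w" "peak j w" "i \<noteq> j"
  shows "peak j (lower i w)" "lower j (lower i w) = lower i (lower j w)"
  using peaks_not_adjacent[OF assms] assms
  by (auto simp: peak_def lower_def fun_eq_iff)

text \<open>Diamond argument: two different last letters are peaks of \<open>w\<close>, hence not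
  neighbours. Lowering both gives a common sequence below, and raising it in either order gives the
  same class since the letters commute.\<close>

lemma path_unique: "path w y \<Longrightarrow> path w y' \<Longrightarrow> y \<doteq> y'"
proof (induction "len w" arbitrary: w y y' rule: less_induct)
  case less
  from less.prems(1) show ?case
  proof cases
    case base
    with less.prems(2) have "path (\<lambda>_. False) y'" by simp
    then show ?thesis
    proof cases
      case base
      then show ?thesis using \<open>y = E N\<close> by (simp add: sim_refl)
    next
      case (raise w1 y1 j)
      then have "peak j (\<lambda>_. False)" using lower_raise(2) by metis
      then show ?thesis by (simp add: peak_def)
    qed
  next
    case (raise w1 y1 j)
    then have j: "peak j w" "w1 = lower j w" using lower_raise by metis+
    from less.prems(2) show ?thesis
    proof cases
      case base
      then show ?thesis using j by (simp add: peak_def)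
    next
      case (raise w1' y1' j')
      then have j': "peak j' w" "w1' = lower j' w" using lower_raise by metis+
      have bounds: "j \<le> N" "j' \<le> N" using j(1) j'(1) by (auto simp: peak_def)
      have less1: "len w1 < len w" "len w1' < len w" using len_lower j j' by (metis lessI)+
      show ?thesis
      proof (cases "j = j'")
        case True
        then have "y1 \<doteq> y1'"
          using less.hyps[OF less1(1)] \<open>path w1 y1\<close> \<open>path w1' y1'\<close> j j' by auto
        then show ?thesis
          using \<open>y = _\<close> \<open>y' = _\<close> True bounds by (simp add: sim_left)
      next
        case False
        note distant = peaks_not_adjacent[OF j(1) j'(1) False]
        define w2 where "w2 = lower j' (lower j w)"
        have p1: "peak j' (lower j w)" and p2: "peak j (lower j' w)"
          and w2: "w2 = lower j (lower j' w)"
          using lower_distant j(1) j'(1) False by (auto simp: w2_def)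
        have "valid w2"
          using path_valid[OF \<open>path w1 y1\<close>] valid_lower[OF _ p1] by (simp add: w2_def j)
        then obtain y2 where y2: "path w2 y2" using path_exists by auto
        have "path w1 (e j' * y2)"
          using path.raise[OF y2, of j'] raise_lower[OF p1] by (simp add: w2_def j)
        with less.hyps[OF less1(1)] \<open>path w1 y1\<close> have y1: "y1 \<doteq> e j' * y2" by auto
        have "path w1' (e j * y2)"
          using path.raise[OF y2, of j] raise_lower[OF p2] by (simp add: w2 j')
        with less.hyps[OF less1(2)] \<open>path w1' y1'\<close> have y1': "y1' \<doteq> e j * y2" by auto
        have "e j * y1 \<doteq> e j * (e j' * y2)" using y1 bounds by (simp add: sim_left)
        also have "\<dots> \<doteq> e j' * (e j * y2)" using distant bounds y2 by (intro commute) auto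
        also have "\<dots> \<doteq> e j' * y1'" using y1' bounds by (simp add: sim_left sim_sym)
        finally show ?thesis using \<open>y = _\<close> \<open>y' = _\<close> by simp
      qed
    qed
  qed
qed

lemma path_peak:
  assumes "path w y" "peak j w"
  obtains y1 where "path (lower j w) y1" "y \<doteq> e j * y1"
proof -
  obtain y1 where "path (lower j w) y1"
    using path_exists valid_lower path_valid assms by metis
  moreover from path.raise[OF this raise_lower(2)[OF assms(2)]] have "y \<doteq> e j * y1"
    using path_unique assms raise_lower(1) by metis
  ultimately show thesis by (rule that)
qed

section \<open>Action of the generators on the words\<close>

definition act :: "nat \<Rightarrow> free \<Rightarrow> (nat \<Rightarrow> bool) \<Rightarrow> bool"
  where "act i y w' \<longleftrightarrow> (\<exists>y' c. path w' y' \<and> e i * y \<doteq> scal c * y')"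

lemma act_sim: "y' \<doteq> y \<Longrightarrow> act i y w \<Longrightarrow> i \<le> N \<Longrightarrow> act i y' w"
  unfolding act_def using sim_trans[OF sim_left[OF carr_gen]] by blast

lemma act_raise: "path w y \<Longrightarrow> up j w \<Longrightarrow> act j y (raise j w)"
  unfolding act_def
  by (intro exI[of _ "e j * y"] exI[of _ 1]) (auto simp: path.raise sim_refl up_def)

lemma act_peak:
  assumes "path w y" "peak j w"
  shows "act j y w"
proof -
  obtain y1 where y1: "path (lower j w) y1" "y \<doteq> e j * y1" using path_peak assms by blast
  have j: "j \<le> N" using assms by (simp add: peak_def)
  obtain c where c: "e j * (e j * y1) \<doteq> scal c * (e j * y1)"
    using square[OF j path_carr[OF y1(1)]] by blast
  have "e j * y \<doteq> e j * (e j * y1)" using y1 j by (simp add: sim_left)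
  also note c
  also have "scal c * (e j * y1) \<doteq> scal c * y" using y1 by (simp add: sim_left sim_sym)
  finally show ?thesis using assms by (auto simp: act_def)
qed

text \<open>Up to the congruence \<open>y\<close> starts with \<open>e_j e_i\<close>, so applying
  \<open>e_i\<close> collapses the first two letters by the braid relation and undoes the raise at
  \<open>j\<close>.\<close>

lemma act_braid:
  assumes "path w y" "peak j w" "peak i (lower j w)" "1 \<le> i" "i < N" "j = Suc i \<or> Suc j = i"
  shows "act i y (lower j w)"
proof -
  obtain y1 where y1: "path (lower j w) y1" "y \<doteq> e j * y1" using path_peak assms by blast
  obtain y2 where y2: "path (lower i (lower j w)) y2" "y1 \<doteq> e i * y2" using path_peak y1 assms by blast
  have ij: "i \<le> N" "j \<le> N" using assms by (auto simp: peak_def)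
  have "e i * y \<doteq> e i * (e j * y1)" using y1 ij by (simp add: sim_left)
  also have "\<dots> \<doteq> e i * (e j * (e i * y2))" using y2 ij by (simp add: sim_left)
  also have "\<dots> \<doteq> e i * y2" using y2 assms by (intro braid) auto
  also have "\<dots> \<doteq> scal 1 * y1" using y2 by (simp add: sim_sym)
  finally show ?thesis using y1 unfolding act_def by blast
qed

text \<open>When \<open>e_i\<close> commutes with the leading letter \<open>e_j\<close>, its action
  is computed below that letter and \<open>e_j\<close> is applied to the result.\<close>

lemma act_commute:
  assumes "y \<doteq> e j * y1" "act i y1 w2" "\<And>y2. path w2 y2 \<Longrightarrow> act j y2 w3"
    and "i \<le> N" "j \<le> N" "i + 1 < j \<or> j + 1 < i" and y1: "y1 \<in> carr N"
  shows "act i y w3"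
proof -
  from assms(2) obtain y2 c where y2: "path w2 y2" "e i * y1 \<doteq> scal c * y2" by (auto simp: act_def)
  from assms(3)[OF y2(1)] obtain y3 c' where y3: "path w3 y3" "e j * y2 \<doteq> scal c' * y3"
    by (auto simp: act_def)
  have "e i * y \<doteq> e i * (e j * y1)" using assms by (simp add: sim_left)
  also have "\<dots> \<doteq> e j * (e i * y1)" using assms by (intro commute) auto
  also have "\<dots> \<doteq> e j * (scal c * y2)" using assms y2 by (simp add: sim_left)
  also have "\<dots> = scal c * (e j * y2)" by (rule scal_left_commute)
  also have "\<dots> \<doteq> scal c * (scal c' * y3)" using y3 by (simp add: sim_left)
  also have "\<dots> = scal (c * c') * y3" by (simp add: scal_mult mult.assoc)
  finally show ?thesis using y3 unfolding act_def by blast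
qed

text \<open>In the diagram \<open>e_i\<close> pairs \<open>i\<close> with \<open>i + 1\<close> and
  joins their former partners. The partner \<open>k\<close> of \<open>i + 1\<close>, if there is
  one, thereby becomes an opening; otherwise only \<open>i + 1\<close> changes its sign.\<close>

lemma act_opening:
  "\<lbrakk>path w y; 1 \<le> i; i < N; w i; w (Suc i)\<rbrakk> \<Longrightarrow> \<exists>w'. act i y w' \<and>
    (w' = w(Suc i := False) \<or> (\<exists>k. Suc i < k \<and> k \<le> N \<and> \<not> w k \<and> w' = w(Suc i := False, k := True)))"
proof (induction "len w" arbitrary: w y i rule: less_induct)
  case less
  note w = less.prems
  obtain j where j: "j \<ge> Suc i" "peak j w" using peak_exists[of w "Suc i"] w by auto
  show ?case
  proof (cases "j = Suc i")
    case True
    have "peak i (lower j w)" using True w by (auto simp: peak_def lower_def)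
    then have "act i y (lower j w)" using act_braid j w True by auto
    moreover have "lower j w = (if j < N then w(Suc i := False, Suc (Suc i) := True) else w(Suc i := False))"
      using True by (simp add: lower_def)
    moreover have "j < N \<Longrightarrow> \<not> w (Suc (Suc i))" using j True by (auto simp: peak_def)
    ultimately show ?thesis using True
      by (cases "j < N") (auto intro!: exI[of _ "lower j w"] exI[of _ "Suc (Suc i)"])
  next
    case False
    then have ij: "i + 1 < j" "j \<le> N" "i \<le> N" "Suc i < j" using j w by (auto simp: peak_def)
    define u where "u = lower j w"
    obtain y1 where y1: "path u y1" "y \<doteq> e j * y1" using path_peak j w unfolding u_def by blast
    have u: "u i" "u (Suc i)" "\<not> u j" "j < N \<Longrightarrow> u (Suc j)"
      and uw: "\<And>k. k \<noteq> j \<Longrightarrow> k \<noteq> Suc j \<Longrightarrow> u k = w k" "w j" "j < N \<Longrightarrow> \<not> w (Suc j)"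
      using ij w j by (auto simp: u_def lower_def peak_def)
    have w_eq: "w = raise j u" using raise_lower j by (simp add: u_def)
    have len_u: "Suc (len u) = len w" using len_lower j by (simp add: u_def)
    obtain w2 where w2: "act i y1 w2" and
      w2': "w2 = u(Suc i := False) \<or> (\<exists>k. Suc i < k \<and> k \<le> N \<and> \<not> u k \<and> w2 = u(Suc i := False, k := True))"
      using less.hyps[of u y1 i] len_u y1 u w by auto
    have commute: "act i y w3" if "\<And>y2. path w2 y2 \<Longrightarrow> act j y2 w3" for w3
      by (rule act_commute[OF y1(2) w2 that]) (use ij y1 in auto)
    have raise: "act i y (raise j w2)" if "up j w2"
      by (rule commute) (rule act_raise[OF _ that])
    from w2' consider "w2 = u(Suc i := False)"
      | k where "Suc i < k" "k \<le> N" "\<not> u k" "w2 = u(Suc i := False, k := True)" "k \<noteq> j"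
      | "w2 = u(Suc i := False, j := True)" by blast
    then show ?thesis
    proof cases
      case 1
      have "up j w2" using 1 ij u w by (auto simp: up_def)
      moreover have "raise j w2 = w(Suc i := False)"
        using 1 ij by (auto simp: w_eq raise_def fun_eq_iff)
      ultimately show ?thesis using raise by auto
    next
      case (2 k)
      have k: "k = Suc j \<Longrightarrow> \<not> j < N" using 2 u by auto
      have "up j w2" using 2 ij u w by (auto simp: up_def)
      moreover have "raise j w2 = w(Suc i := False, k := True)"
        using 2 ij k by (auto simp: w_eq raise_def fun_eq_iff)
      moreover have "\<not> w k" using 2 k uw(1)[of k] by auto
      ultimately show ?thesis using raise 2 by (intro exI[of _ "raise j w2"]) auto
    next
      case 3
      show ?thesis
      proof (cases "j < N")
        case False
        then have j_N: "j = N" using ij by simp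
        have "act i y w2"
          by (rule commute) (rule act_peak, use 3 ij in \<open>auto simp: peak_def j_N\<close>)
        moreover have "w2 = w(Suc i := False)"
          using 3 ij False by (auto simp: w_eq raise_def fun_eq_iff)
        ultimately show ?thesis by auto
      next
        case True
        \<comment> \<open>Now \<open>j\<close> and \<open>j + 1\<close> are both openings in
          \<open>w2\<close>, so \<open>e_j\<close> poses the original question again. The opening at
          \<open>i + 1\<close> has been replaced by one further right, which lowers
          \<open>len\<close> and permits a second use of the induction hypothesis.\<close>
        have "len u = len (u(Suc i := False)) + (Suc N - Suc i)"
          by (rule len_remove) (use u ij in auto)
        moreover have "len w2 = len (u(Suc i := False)) + (Suc N - j)"
          unfolding 3 by (rule len_insert) (use u ij in auto)
        ultimately have len_w2: "len w2 < len w" using ij len_u by simp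
        obtain y2 where y2: "path w2 y2" using w2 by (auto simp: act_def)
        have "w2 j" "w2 (Suc j)" using 3 ij u True by auto
        then obtain w3 where w3: "act j y2 w3" and
          w3': "w3 = w2(Suc j := False) \<or> (\<exists>k. Suc j < k \<and> k \<le> N \<and> \<not> w2 k \<and> w3 = w2(Suc j := False, k := True))"
          using less.hyps[OF len_w2 y2, of j] True ij by auto
        have "act j y2' w3" if "path w2 y2'" for y2'
          by (rule act_sim[OF path_unique[OF that y2] w3 ij(2)])
        then have act: "act i y w3" by (rule commute)
        have w2_eq: "w2(Suc j := False) = w(Suc i := False)"
          using 3 ij True by (auto simp: w_eq raise_def fun_eq_iff)
        from w3' show ?thesis
        proof (elim disjE exE conjE)
          assume "w3 = w2(Suc j := False)"
          then show ?thesis using act w2_eq by auto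
        next
          fix k assume k: "Suc j < k" "k \<le> N" "\<not> w2 k" "w3 = w2(Suc j := False, k := True)"
          have "\<not> w k" using k 3 ij uw(1)[of k] by auto
          then show ?thesis
            using act k ij unfolding k(4) w2_eq by (intro exI[of _ "w(Suc i := False, k := True)"] conjI disjI2 exI[of _ k]) auto
        qed
      qed
    qed
  qed
qed

text \<open>The representative is \<open>e_i e_(i+1) ... e_N E N\<close>, and \<open>e_raise\<close>
  strips the letters after the first.\<close>

lemma path_single:
  assumes "1 \<le> i" "i \<le> N"
  shows "\<exists>y. path (\<lambda>p. p = i) y \<and> (i < N \<longrightarrow> e i * E N \<propto> y)"
  using assms(2,1)
proof (induction i rule: inc_induct)
  case base
  have "up N (\<lambda>_. False)" using N by (simp add: up_def)
  moreover have "raise N (\<lambda>_. False) = (\<lambda>p. p = N)" by (auto simp: raise_def fun_eq_iff)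
  ultimately show ?case using path.raise[OF path.base, of N] by auto
next
  case (step n)
  show ?case
  proof (cases "Suc n = N")
    case True
    have u: "up N (\<lambda>_. False)" "up n (\<lambda>p. p = N)" using N True step by (auto simp: up_def)
    have "raise N (\<lambda>_. False) = (\<lambda>p. p = N)" "raise n (\<lambda>p. p = N) = (\<lambda>p. p = n)"
      using True by (auto simp: raise_def fun_eq_iff)
    then have "path (\<lambda>p. p = n) (e n * (e N * E N))"
      using path.raise[OF path.raise[OF path.base u(1)], of n] u(2) by simp
    moreover have "e n * E N \<propto> e n * (e N * E N)"
      using e_raise[of n] step True by simp
    ultimately show ?thesis by auto
  next
    case False
    then obtain y where y: "path (\<lambda>p. p = Suc n) y" "e (Suc n) * E N \<propto> y" using step by auto
    have u: "up n (\<lambda>p. p = Suc n)" using step by (auto simp: up_def)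
    have "raise n (\<lambda>p. p = Suc n) = (\<lambda>p. p = n)" using step by (auto simp: raise_def fun_eq_iff)
    then have "path (\<lambda>p. p = n) (e n * y)" using path.raise[OF y(1) u] by simp
    moreover have "e n * E N \<propto> e n * (e (Suc n) * E N)"
      using e_raise[of n] step by simp
    moreover have "e n * (e (Suc n) * E N) \<propto> e n * y" using y step by (intro propto_left) auto
    ultimately show ?thesis using propto_trans by blast
  qed
qed

lemma path_single_propto:
  assumes "path (\<lambda>p. p = i) y" "1 \<le> i" "i < N"
  shows "e i * E N \<propto> y"
  using path_single[of i] path_unique[OF _ assms(1)] assms propto_sim_trans by (metis less_imp_le)

text \<open>Mirror image of \<open>act_opening\<close>: the partner \<open>l\<close> of the closing
  at \<open>i\<close>, if there is one, becomes a closing, while \<open>i\<close> opens towards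
  \<open>i + 1\<close>.\<close>

lemma act_closing:
  "\<lbrakk>path w y; 1 \<le> i; i < N; \<not> w i; \<not> w (Suc i)\<rbrakk> \<Longrightarrow> \<exists>w'. act i y w' \<and>
    (w' = w(i := True) \<or> (\<exists>l. l < i \<and> w l \<and> w' = w(i := True, l := False)))"
proof (induction "len w" arbitrary: w y i rule: less_induct)
  case less
  note w = less.prems
  have valid: "valid w" using path_valid w by blast
  consider "\<forall>p. \<not> w p" | j where "peak j w" "Suc j = i" | j where "peak j w" "Suc j \<noteq> i"
    using peak_exists valid by (metis valid_def)
  then show ?case
  proof cases
    case 1
    then have w0: "w = (\<lambda>_. False)" by auto
    have y: "y \<doteq> E N" using path_unique path.base w w0 by auto
    \<comment> \<open>Without openings \<open>e_i\<close> meets \<open>E N\<close> itself. The words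
      do not evaluate \<open>e_i E N\<close>; \<open>path_single\<close> does, and thus
      \<open>b \<noteq> 0\<close> enters.\<close>
    obtain y' where y': "path (\<lambda>p. p = i) y'" "e i * E N \<propto> y'" using path_single[of i] w by auto
    then obtain c where "e i * E N \<doteq> scal c * y'" by (auto simp: propto_def)
    moreover have "e i * y \<doteq> e i * E N" using y w by (simp add: sim_left)
    ultimately have "act i y (\<lambda>p. p = i)" using y' sim_trans unfolding act_def by blast
    moreover have "(\<lambda>p. p = i) = w(i := True)" by (simp add: w0 fun_eq_iff)
    ultimately show ?thesis by auto
  next
    case (2 j)
    have "peak i (lower j w)" using 2 w by (auto simp: peak_def lower_def)
    then have "act i y (lower j w)" using act_braid 2 w by auto
    moreover have "lower j w = w(i := True, j := False)"
      using 2 w by (auto simp: lower_def fun_eq_iff)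
    ultimately show ?thesis using 2 by (auto simp: peak_def)
  next
    case (3 j)
    then have ne: "j \<noteq> i" "j \<noteq> Suc i" "Suc j \<noteq> i" "1 \<le> j" "j \<le> N" "i \<le> N"
      using w by (auto simp: peak_def)
    moreover from this have "i + 1 < j \<or> j + 1 < i" by linarith
    ultimately have ij: "i + 1 < j \<or> j + 1 < i" "j \<le> N" "i \<le> N" "j \<noteq> i" "j \<noteq> Suc i" "Suc j \<noteq> i" "1 \<le> j"
      by simp_all
    define u where "u = lower j w"
    obtain y1 where y1: "path u y1" "y \<doteq> e j * y1" using path_peak 3 w unfolding u_def by blast
    have u: "\<not> u i" "\<not> u (Suc i)" "\<not> u j" "j < N \<Longrightarrow> u (Suc j)"
      and uw: "\<And>k. k \<noteq> j \<Longrightarrow> k \<noteq> Suc j \<Longrightarrow> u k = w k" "w j" "j < N \<Longrightarrow> \<not> w (Suc j)"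
      using ij w 3 by (auto simp: u_def lower_def peak_def)
    have w_eq: "w = raise j u" using raise_lower 3 by (simp add: u_def)
    have len_u: "Suc (len u) = len w" using len_lower 3 by (simp add: u_def)
    obtain w2 where w2: "act i y1 w2" and
      w2': "w2 = u(i := True) \<or> (\<exists>l. l < i \<and> u l \<and> w2 = u(i := True, l := False))"
      using less.hyps[of u y1 i] len_u y1 u w by auto
    have commute: "act i y w3" if "\<And>y2. path w2 y2 \<Longrightarrow> act j y2 w3" for w3
      by (rule act_commute[OF y1(2) w2 that]) (use ij y1 in auto)
    have raise: "act i y (raise j w2)" if "up j w2"
      by (rule commute) (rule act_raise[OF _ that])
    from w2' consider "w2 = u(i := True)"
      | l where "l < i" "u l" "w2 = u(i := True, l := False)" "l \<noteq> Suc j \<or> \<not> j < N"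
      | "Suc j < i" "w2 = u(i := True, Suc j := False)" "j < N" by blast
    then show ?thesis
    proof cases
      case 1
      have "up j w2" using 1 ij u w by (auto simp: up_def)
      moreover have "raise j w2 = w(i := True)"
        using 1 ij by (auto simp: w_eq raise_def fun_eq_iff)
      ultimately show ?thesis using raise by auto
    next
      case (2 l)
      have l: "l \<noteq> j" "j < N \<Longrightarrow> l \<noteq> Suc j" "l \<noteq> Suc j" using 2 u w by auto
      have "up j w2" using 2 l ij u w by (auto simp: up_def)
      moreover have "raise j w2 = w(i := True, l := False)"
        using 2 ij l by (auto simp: w_eq raise_def fun_eq_iff)
      moreover have "w l" using 2 l uw(1)[of l] by auto
      ultimately show ?thesis using raise 2 by (intro exI[of _ "raise j w2"]) auto
    next
      case 3
      \<comment> \<open>The new closing at \<open>j + 1\<close> stands next to the one at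
        \<open>j\<close>, so the lemma is applied again, to \<open>e_j\<close>; exchanging the
        opening at \<open>j + 1\<close> for one at \<open>i\<close> lowered
        \<open>len\<close>.\<close>
      have "len u = len (u(Suc j := False)) + (Suc N - Suc j)"
        by (rule len_remove) (use u ij 3 in auto)
      moreover have "len (u(Suc j := False, i := True)) = len (u(Suc j := False)) + (Suc N - i)"
        by (rule len_insert) (use u ij w in auto)
      moreover have "u(Suc j := False, i := True) = w2"
        using 3 by (auto simp: fun_eq_iff)
      ultimately have len_w2: "len w2 < len w" using 3 len_u by simp
      obtain y2 where y2: "path w2 y2" using w2 by (auto simp: act_def)
      have "\<not> w2 j" "\<not> w2 (Suc j)" using 3 ij u by auto
      then obtain w3 where w3: "act j y2 w3" and
        w3': "w3 = w2(j := True) \<or> (\<exists>l. l < j \<and> w2 l \<and> w3 = w2(j := True, l := False))"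
        using less.hyps[OF len_w2 y2, of j] 3 ij by auto
      have "act j y2' w3" if "path w2 y2'" for y2'
          by (rule act_sim[OF path_unique[OF that y2] w3 ij(2)])
      then have act: "act i y w3" by (rule commute)
      have w2_eq: "w2(j := True) = w(i := True)"
        using 3 ij by (auto simp: w_eq raise_def fun_eq_iff)
      from w3' show ?thesis
      proof (elim disjE exE conjE)
        assume "w3 = w2(j := True)"
        then show ?thesis using act w2_eq by auto
      next
        fix l assume l: "l < j" "w2 l" "w3 = w2(j := True, l := False)"
        have "w l" using l 3 ij uw(1)[of l] by (auto split: if_splits)
        then show ?thesis
          using act l 3 unfolding l(3) w2_eq by (intro exI[of _ "w(i := True, l := False)"] conjI disjI2 exI[of _ l]) auto
      qed
    qed
  qed
qed

lemma act_exists: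
  assumes "path w y" "1 \<le> i" "i \<le> N"
  shows "\<exists>w'. act i y w'"
proof -
  consider "peak i w" | "up i w" | "i < N" "w i" "w (Suc i)" | "i < N" "\<not> w i" "\<not> w (Suc i)"
    using assms by (auto simp: peak_def up_def)
  then show ?thesis
    by cases (use assms act_peak act_raise act_opening act_closing in metis)+
qed

section \<open>The span of the words\<close>

definition rep :: "(nat \<Rightarrow> bool) \<Rightarrow> free"
  where "rep w = (SOME y. path w y)"

lemma path_rep: "valid w \<Longrightarrow> path w (rep w)"
  unfolding rep_def using path_exists by (rule someI_ex)

definition in_span :: "free \<Rightarrow> bool"
  where "in_span p \<longleftrightarrow> (\<exists>c. p \<doteq> (\<Sum>w | valid w. scal (c w) * rep w))"

lemma valid_set: "{w. valid w} = (\<lambda>S p. p \<in> S) ` Pow {1..N}"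
proof (rule subset_antisym; rule subsetI)
  fix w assume "w \<in> {w. valid w}"
  then have "w = (\<lambda>p. p \<in> {p. w p})" "{p. w p} \<in> Pow {1..N}" by (auto simp: valid_def)
  then show "w \<in> (\<lambda>S p. p \<in> S) ` Pow {1..N}" by blast
qed (auto simp: valid_def)

lemma finite_valid: "finite {w. valid w}"
  unfolding valid_set by simp

lemma card_valid: "card {w. valid w} = 2 ^ N"
  unfolding valid_set by (subst card_image) (auto simp: inj_on_def fun_eq_iff card_Pow)

lemma rep_carr [simp]: "valid w \<Longrightarrow> rep w \<in> carr N"
  using path_rep path_carr by blast

lemma in_span_sim: "p \<doteq> r \<Longrightarrow> in_span r \<Longrightarrow> in_span p"
  unfolding in_span_def using sim_trans by blast

lemma in_span_add:
  assumes "in_span p" "in_span r" shows "in_span (p + r)"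
proof -
  from assms obtain c c' where "p \<doteq> (\<Sum>w | valid w. scal (c w) * rep w)"
    "r \<doteq> (\<Sum>w | valid w. scal (c' w) * rep w)" by (auto simp: in_span_def)
  from sim_add[OF this] have "p + r \<doteq> (\<Sum>w | valid w. scal (c w + c' w) * rep w)"
    by (simp add: sum.distrib scal_add distrib_right)
  then show ?thesis by (auto simp: in_span_def)
qed

lemma in_span_scal:
  assumes "in_span p" shows "in_span (scal a * p)"
proof -
  from assms obtain c where "p \<doteq> (\<Sum>w | valid w. scal (c w) * rep w)" by (auto simp: in_span_def)
  from sim_left[OF carr_scal this, of a] have "scal a * p \<doteq> (\<Sum>w | valid w. scal (a * c w) * rep w)"
    by (simp add: sum_distrib_left scal_mult mult.assoc)
  then show ?thesis unfolding in_span_def by (intro exI[of _ "\<lambda>w. a * c w"])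
qed

lemma in_span_0: "in_span 0"
  unfolding in_span_def by (intro exI[of _ "\<lambda>_. 0"]) (simp add: sim_refl)

lemma in_span_sum: "(\<And>i. i \<in> A \<Longrightarrow> in_span (f i)) \<Longrightarrow> in_span (sum f A)"
  by (induction A rule: infinite_finite_induct) (auto simp: in_span_0 in_span_add)

lemma in_span_path:
  assumes "path w y" shows "in_span y"
proof -
  have w: "valid w" using assms path_valid by blast
  have "(\<Sum>v | valid v. scal (if v = w then 1 else 0) * rep v) = (\<Sum>v | valid v. if v = w then rep v else 0)"
    by (intro sum.cong) auto
  also have "\<dots> = rep w" using w finite_valid by simp
  finally have "y \<doteq> (\<Sum>v | valid v. scal (if v = w then 1 else 0) * rep v)"
    using path_unique[OF assms path_rep[OF w]] by simp
  then show ?thesis unfolding in_span_def by (intro exI[of _ "\<lambda>v. if v = w then 1 else 0"])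
qed

lemma in_span_act: "act i y w \<Longrightarrow> in_span (e i * y)"
  unfolding act_def using in_span_path in_span_scal in_span_sim by blast

lemma in_span_linear:
  assumes "i \<le> N" "\<And>w y. path w y \<Longrightarrow> in_span (e i * y)" "in_span p"
  shows "in_span (e i * p)"
proof -
  from assms obtain c where c: "p \<doteq> (\<Sum>w | valid w. scal (c w) * rep w)" by (auto simp: in_span_def)
  have "e i * p \<doteq> (\<Sum>w | valid w. scal (c w) * (e i * rep w))"
    using sim_left[OF carr_gen[OF assms(1)] c] by (simp add: sum_distrib_left scal_left_commute)
  moreover have "in_span (\<Sum>w | valid w. scal (c w) * (e i * rep w))"
    using assms(2) path_rep by (auto intro!: in_span_sum in_span_scal)
  ultimately show ?thesis using in_span_sim by blast
qed

lemma in_span_gen_pos: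
  assumes "1 \<le> i" "i \<le> N" "in_span p"
  shows "in_span (e i * p)"
proof (rule in_span_linear[OF assms(2) _ assms(3)])
  fix w y assume "path w y"
  then obtain w' where "act i y w'" using act_exists assms by blast
  then show "in_span (e i * y)" by (rule in_span_act)
qed

lemma in_span_propto: "p \<propto> r \<Longrightarrow> in_span r \<Longrightarrow> in_span p"
  unfolding propto_def using in_span_scal in_span_sim by blast

lemma in_span_E: "in_span (E N)"
  using path.base in_span_path by blast

text \<open>Letters of index at least \<open>2\<close> commute with \<open>e_0\<close> and are
  stripped until openings occur at most at site \<open>1\<close>; there the bottom of the tower
  returns a multiple of \<open>E N\<close>.\<close>

lemma in_span_gen_0: "path w y \<Longrightarrow> in_span (e 0 * y)"
proof (induction "len w" arbitrary: w y rule: less_induct)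
  case less
  have valid: "valid w" using path_valid less.prems by blast
  consider "w = (\<lambda>_. False)" | "w = (\<lambda>p. p = 1)" | j where "peak j w" "2 \<le> j"
  proof (cases "\<exists>p\<ge>2. w p")
    case True
    then obtain p where "w p" "2 \<le> p" by blast
    then show ?thesis using that(3) peak_exists[of w p] valid by (auto simp: valid_def)
  next
    case False
    then have "\<not> w p" if "p \<noteq> 1" for p
      using that valid by (cases "p = 0") (auto simp: valid_def not_le, (metis Suc_1 Suc_leI le_neq_implies_less less_one not_le One_nat_def)?)
    then have "w = (\<lambda>_. False) \<or> w = (\<lambda>p. p = 1)"
      by (cases "w 1") (auto simp: fun_eq_iff, metis+)
    then show ?thesis using that by blast
  qed
  then show ?case
  proof cases
    case 1
    have "e 0 * y \<doteq> e 0 * E N" using path_unique path.base less.prems 1 by (auto intro: sim_left)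
    then show ?thesis using e_0_E(1) in_span_E in_span_propto in_span_sim by blast
  next
    case 2
    have "e 1 * E N \<propto> y" using path_single_propto[of 1 y] less.prems N unfolding 2 by auto
    from propto_left[OF _ propto_sym[OF this], of "e 0"] have "e 0 * y \<propto> e 0 * (e 1 * E N)" by simp
    then show ?thesis using e_0_E(2) in_span_E in_span_propto by blast
  next
    case (3 j)
    obtain y1 where y1: "path (lower j w) y1" "y \<doteq> e j * y1" using path_peak less.prems 3 by blast
    have j: "j \<le> N" using 3 by (simp add: peak_def)
    have "in_span (e 0 * y1)"
      using less.hyps[OF _ y1(1)] len_lower[OF 3(1)] by simp
    from in_span_gen_pos[OF _ j this] 3 have "in_span (e j * (e 0 * y1))" by simp
    moreover have "e 0 * y \<doteq> e j * (e 0 * y1)"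
    proof -
      have "e 0 * y \<doteq> e 0 * (e j * y1)" using y1 by (simp add: sim_left)
      also have "\<dots> \<doteq> e j * (e 0 * y1)" using y1 3 j by (intro commute) auto
      finally show ?thesis .
    qed
    ultimately show ?thesis using in_span_sim by blast
  qed
qed

lemma in_span_gen: "i \<le> N \<Longrightarrow> in_span p \<Longrightarrow> in_span (e i * p)"
  using in_span_gen_pos[of i p] in_span_linear[of 0 p] in_span_gen_0 by (cases "i = 0") auto

lemma in_span_E_left_ideal: "p \<in> carr N \<Longrightarrow> in_span (p * E N)"
proof (induction p rule: carr_induct)
  case (single u c)
  then show ?case
  proof (induction u)
    case Nil
    then show ?case by (simp add: single_Word_Nil in_span_scal in_span_E)
  next
    case (Cons i u)
    then show ?case by (simp add: single_Word_Cons mult.assoc in_span_gen)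
  qed
qed (simp_all add: in_span_0 distrib_right in_span_add)

end

section \<open>The spin chain module\<close>

text \<open>Solving for the unit vectors gives a right inverse, which for a square matrix is also a
  left inverse.\<close>

lemma spanning_imp_independent:
  fixes B :: "complex mat"
  assumes B: "B \<in> carrier_mat n n"
    and span: "\<And>u. u \<in> carrier_vec n \<Longrightarrow> \<exists>a\<in>carrier_vec n. B *\<^sub>v a = u"
    and a: "a \<in> carrier_vec n" "B *\<^sub>v a = 0\<^sub>v n"
  shows "a = 0\<^sub>v n"
proof -
  have "\<forall>j. \<exists>x\<in>carrier_vec n. B *\<^sub>v x = unit_vec n j"
    using span by simp
  then obtain X where X: "\<And>j. X j \<in> carrier_vec n" "\<And>j. B *\<^sub>v X j = unit_vec n j"
    by metis
  define C where "C = mat n n (\<lambda>(i, j). X j $ i)"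
  have C: "C \<in> carrier_mat n n" by (simp add: C_def)
  have "B * C = 1\<^sub>m n"
  proof (rule eq_matI)
    fix i j assume ij: "i < dim_row (1\<^sub>m n :: complex mat)" "j < dim_col (1\<^sub>m n :: complex mat)"
    have "col C j = X j"
      using X(1)[of j] ij by (intro eq_vecI) (auto simp: C_def)
    then have "(B * C) $$ (i, j) = (B *\<^sub>v X j) $ i"
      using B C ij by simp
    then show "(B * C) $$ (i, j) = 1\<^sub>m n $$ (i, j)"
      using X(2) ij by (simp add: unit_vec_def)
  qed (use B C in auto)
  then have "C * B = 1\<^sub>m n"
    using mat_mult_left_right_inverse B C by blast
  then have "a = (C * B) *\<^sub>v a" using a by simp
  also have "\<dots> = C *\<^sub>v 0\<^sub>v n" using a B C by simp
  also have "\<dots> = 0\<^sub>v n" using C by (intro eq_vecI) auto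
  finally show ?thesis .
qed

lemma mat_eq_action:
  fixes A B :: "complex mat"
  assumes "A \<in> carrier_mat n n" "B \<in> carrier_mat n n"
    and "\<And>v. v \<in> carrier_vec n \<Longrightarrow> A *\<^sub>v v = B *\<^sub>v v"
  shows "A = B"
proof (rule eq_matI)
  fix i j assume ij: "i < dim_row B" "j < dim_col B"
  have "(A *\<^sub>v unit_vec n j) $ i = (B *\<^sub>v unit_vec n j) $ i"
    using assms(3) by simp
  then show "A $$ (i, j) = B $$ (i, j)"
    using assms(1,2) ij by (simp add: scalar_prod_right_unit)
qed (use assms in auto)

section \<open>The parameters in multiplicative form\<close>

locale generic_parameters =
  fixes N :: nat and \<eta> \<omega>\<^sub>1 \<omega>\<^sub>2 \<theta> b :: complex
  assumes N_ge: "N \<ge> 2"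
    and root: "\<forall>n::nat. n > 0 \<longrightarrow> qpow \<eta> 1 ^ n \<noteq> 1"
    and left: "\<forall>m::int. qnum \<eta> (\<omega>\<^sub>1 - of_int m) \<noteq> 0"
    and right: "qnum \<eta> (\<omega>\<^sub>2 + 1) \<noteq> 0"
    and twist: "\<forall>n \<epsilon>. \<forall>\<epsilon>\<^sub>1 \<in> {1, - 1}. \<forall>\<epsilon>\<^sub>2 \<in> {1, - 1}.
           n \<le> N - 1 \<and> n mod 2 = (N - 1) mod 2 \<and> \<epsilon> \<in> {1, - 1} \<longrightarrow>
           qpow \<eta> \<theta> \<noteq> qpow \<eta> (\<epsilon> * (- of_nat n + \<epsilon>\<^sub>1 * \<omega>\<^sub>1 + \<epsilon>\<^sub>2 * \<omega>\<^sub>2))"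
    and b_eq: "b = (if even N
              then qnum \<eta> ((\<omega>\<^sub>1 + \<omega>\<^sub>2 + 1 + \<theta>) / 2) * qnum \<eta> ((\<omega>\<^sub>1 + \<omega>\<^sub>2 + 1 - \<theta>) / 2)
                     / (qnum \<eta> (\<omega>\<^sub>1 + 1) * qnum \<eta> (\<omega>\<^sub>2 + 1))
              else - (qnum \<eta> ((\<omega>\<^sub>1 - \<omega>\<^sub>2 + \<theta>) / 2) * qnum \<eta> ((\<omega>\<^sub>1 - \<omega>\<^sub>2 - \<theta>) / 2)
                     / (qnum \<eta> (\<omega>\<^sub>1 + 1) * qnum \<eta> (\<omega>\<^sub>2 + 1))))"
begin

abbreviation q :: complex where "q \<equiv> qpow \<eta> 1"
abbreviation x :: complex where "x \<equiv> qpow \<eta> \<omega>\<^sub>1"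
abbreviation z :: complex where "z \<equiv> qpow \<eta> \<omega>\<^sub>2"
abbreviation t :: complex where "t \<equiv> qpow \<eta> \<theta>"

lemma q_square: "q - 1 / q \<noteq> 0"
  using root[rule_format, of 2] by (simp add: field_simps power2_eq_square)

lemma qnum_eq: "qnum \<eta> a = (qpow \<eta> a - 1 / qpow \<eta> a) / (q - 1 / q)"
  by (simp add: qnum_def qpow_minus)

lemma qnum_nonzero_iff: "qnum \<eta> a \<noteq> 0 \<longleftrightarrow> (qpow \<eta> a)\<^sup>2 \<noteq> 1"
  using q_square by (simp add: qnum_eq) (simp add: field_simps power2_eq_square)

lemma qx: "(q * x)\<^sup>2 \<noteq> 1"
  using left[rule_format, of "- 1"] unfolding qnum_nonzero_iff by (simp add: qpow_add mult.commute)

lemma qz: "(q * z)\<^sup>2 \<noteq> 1"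
  using right unfolding qnum_nonzero_iff by (simp add: qpow_add mult.commute)

lemma x_square: "x\<^sup>2 \<noteq> 1"
  using left[rule_format, of 0] unfolding qnum_nonzero_iff by simp

sublocale sc: spin_chain N q x z t
  using N_ge qx qz by unfold_locales auto

lemma bweight_left: "bweight \<eta> \<omega>\<^sub>1 = sc.s1"
  using q_square by (simp add: bweight_def qnum_eq sc.s1_def sc.k1_def qpow_add mult.commute)

lemma bweight_right: "bweight \<eta> \<omega>\<^sub>2 = sc.s2"
  using q_square by (simp add: bweight_def qnum_eq sc.s2_def sc.k2_def qpow_add mult.commute)

lemma qnum_2: "qnum \<eta> 2 = q + 1 / q"
proof -
  have "qpow \<eta> 2 = q * q" using qpow_add[of \<eta> 1 1] by simp
  moreover have "(q * q - 1 / (q * q)) = (q + 1 / q) * (q - 1 / q)"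
    by (simp add: field_simps)
  ultimately show ?thesis using q_square by (simp add: qnum_eq)
qed

text \<open>If \<open>u\<close> and \<open>w\<close> are the exponentials of the half arguments,
  then \<open>u * w\<close> and \<open>u / w\<close> are those of \<open>a\<close> and
  \<open>c\<close>, so no half argument survives.\<close>

lemma qnum_half_product:
  "qnum \<eta> ((a + c) / 2) * qnum \<eta> ((a - c) / 2)
    = (qpow \<eta> a + 1 / qpow \<eta> a - qpow \<eta> c - 1 / qpow \<eta> c) / ((q - 1 / q) * (q - 1 / q))"
proof -
  define u where "u = qpow \<eta> ((a + c) / 2)"
  define w where "w = qpow \<eta> ((a - c) / 2)"
  have "(a + c) / 2 + (a - c) / 2 = a" "(a + c) / 2 - (a - c) / 2 = c"
    by (simp_all add: field_simps)
  then have uw: "qpow \<eta> a = u * w" "qpow \<eta> c = u / w"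
    unfolding u_def w_def using qpow_add[of \<eta> "(a + c) / 2" "(a - c) / 2"] qpow_diff[of \<eta> "(a + c) / 2" "(a - c) / 2"]
    by simp_all
  have "u \<noteq> 0" "w \<noteq> 0" by (simp_all add: u_def w_def)
  then have "(u - 1 / u) * (w - 1 / w) = u * w + 1 / (u * w) - u / w - 1 / (u / w)"
    by (simp add: field_simps)
  then show ?thesis
    unfolding uw qnum_eq u_def[symmetric] w_def[symmetric] by simp
qed

lemma b_eq_bval: "b = sc.bval"
proof -
  have k: "qnum \<eta> (\<omega>\<^sub>1 + 1) * qnum \<eta> (\<omega>\<^sub>2 + 1) = sc.k1 * sc.k2 / ((q - 1 / q) * (q - 1 / q))"
    by (simp add: qnum_eq qpow_add sc.k1_def sc.k2_def mult.commute)
  have cancel: "p / (d * d) / (k / (d * d)) = p / k" if "d \<noteq> 0" for p k d :: complex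
    using that by simp
  have "b = (if even N then (qpow \<eta> (\<omega>\<^sub>1 + \<omega>\<^sub>2 + 1) + 1 / qpow \<eta> (\<omega>\<^sub>1 + \<omega>\<^sub>2 + 1) - t - 1 / t)
     else - (qpow \<eta> (\<omega>\<^sub>1 - \<omega>\<^sub>2) + 1 / qpow \<eta> (\<omega>\<^sub>1 - \<omega>\<^sub>2) - t - 1 / t)) / (sc.k1 * sc.k2)"
    unfolding b_eq qnum_half_product k cancel[OF q_square]
    by (simp add: cancel[OF q_square] minus_divide_left)
  also have "\<dots> = sc.bval"
    by (simp add: sc.bval_def qpow_add qpow_diff algebra_simps)
  finally show ?thesis .
qed

text \<open>The first four values are the obstructions to moving factors through the chain; the
  second and third at \<open>n = 0\<close>, the last two at \<open>n = 1\<close>, are the zeros of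
  \<open>b\<close>.\<close>

lemma twist_generic:
  assumes "n \<le> N - 1" "n mod 2 = (N - 1) mod 2"
  shows "t \<noteq> q ^ n / (x * z)" "t \<noteq> q ^ n * z / x" "t \<noteq> q ^ n * x / z" "t \<noteq> q ^ n * x * z"
    "t \<noteq> 1 / (q ^ n * x * z)"
proof -
  have qn: "qpow \<eta> (of_nat n) = q ^ n"
    by (simp add: qpow_def exp_of_nat_mult[symmetric] mult.commute)
  have *: "t \<noteq> qpow \<eta> (\<epsilon> * (- of_nat n + \<epsilon>\<^sub>1 * \<omega>\<^sub>1 + \<epsilon>\<^sub>2 * \<omega>\<^sub>2))"
    if "\<epsilon> \<in> {1, - 1}" "\<epsilon>\<^sub>1 \<in> {1, - 1}" "\<epsilon>\<^sub>2 \<in> {1, - 1}" for \<epsilon> \<epsilon>\<^sub>1 \<epsilon>\<^sub>2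
    using twist assms that by blast
  have "qpow \<eta> (- 1 * (- of_nat n + 1 * \<omega>\<^sub>1 + 1 * \<omega>\<^sub>2)) = q ^ n / (x * z)"
    and "qpow \<eta> (- 1 * (- of_nat n + 1 * \<omega>\<^sub>1 + - 1 * \<omega>\<^sub>2)) = q ^ n * z / x"
    and "qpow \<eta> (- 1 * (- of_nat n + - 1 * \<omega>\<^sub>1 + 1 * \<omega>\<^sub>2)) = q ^ n * x / z"
    and "qpow \<eta> (- 1 * (- of_nat n + - 1 * \<omega>\<^sub>1 + - 1 * \<omega>\<^sub>2)) = q ^ n * x * z"
    and "qpow \<eta> (1 * (- of_nat n + - 1 * \<omega>\<^sub>1 + - 1 * \<omega>\<^sub>2)) = 1 / (q ^ n * x * z)"
    by (simp_all add: qpow_add qpow_diff qpow_minus qn)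
  then show "t \<noteq> q ^ n / (x * z)" "t \<noteq> q ^ n * z / x" "t \<noteq> q ^ n * x / z" "t \<noteq> q ^ n * x * z"
    "t \<noteq> 1 / (q ^ n * x * z)"
    using *[of "- 1" 1 1] *[of "- 1" 1 "- 1"] *[of "- 1" "- 1" 1] *[of "- 1" "- 1" "- 1"]
      *[of 1 "- 1" "- 1"] by simp_all
qed

text \<open>As a function of \<open>t\<close> the numerator vanishes only at \<open>t = a\<close>
  and \<open>t = 1 / a\<close>, with \<open>a = q * x * z\<close> for even \<open>N\<close> and
  \<open>a = x / z\<close> for odd \<open>N\<close>; both values are excluded.\<close>

lemma bval_nonzero: "sc.bval \<noteq> 0"
proof -
  have factor: "a + 1 / a - t - 1 / t = (a - t) * ((t - 1 / a) / t)" if "a \<noteq> 0" for a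
    using that by (simp add: divide_simps) (simp add: algebra_simps)
  show ?thesis
  proof (cases "even N")
    case True
    have n: "1 \<le> N - 1" "1 mod 2 = (N - 1) mod 2" using True N_ge by (simp_all add: mod2_eq_if)
    have "q * x * z - t \<noteq> 0" "t - 1 / (q * x * z) \<noteq> 0"
      using twist_generic(4,5)[OF n] by auto
    then have "q * x * z + 1 / (q * x * z) - t - 1 / t \<noteq> 0"
      by (simp add: factor)
    then show ?thesis using True sc.k_nonzero by (simp add: sc.bval_def)
  next
    case False
    have n: "0 \<le> N - 1" "0 mod 2 = (N - 1) mod 2" using False N_ge by (simp_all add: mod2_eq_if)
    have "x / z - t \<noteq> 0" "t - 1 / (x / z) \<noteq> 0"
      using twist_generic(2,3)[OF n] by auto
    moreover have xz: "x / z \<noteq> 0" by simp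
    ultimately have "x / z + 1 / (x / z) - t - 1 / t \<noteq> 0"
      unfolding factor[OF xz] by simp
    then have "t + 1 / t - x / z - z / x \<noteq> 0"
      by (simp add: algebra_simps)
    then show ?thesis using False sc.k_nonzero by (simp add: sc.bval_def)
  qed
qed

lemma generic_moves:
  assumes m: "1 \<le> m" "m \<le> N"
  shows "sc.xs m / q ^ (N - m) \<noteq> 1 / (t * z) \<and> z \<noteq> t * (sc.xs m / q ^ (N - m))"
proof (cases "odd m")
  case True
  have n: "N - m \<le> N - 1" "(N - m) mod 2 = (N - 1) mod 2" using True m by (auto simp: mod2_eq_if)
  have "t = r / (x * z)" if "x / r = 1 / (t * z)" "r \<noteq> 0" for r
    using that by (simp add: divide_eq_eq eq_divide_eq mult_ac)
  moreover have "t = r * z / x" if "z = t * (x / r)" "r \<noteq> 0" for r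
    using that by (subst that(1)) simp
  ultimately show ?thesis
    using twist_generic(1,2)[OF n] True by (auto simp: sc.xs_def)
next
  case False
  \<comment> \<open>At even \<open>m\<close> the factor \<open>1 / (q * x)\<close> contributes one
    more power of \<open>q\<close>, which restores the parity of \<open>N - 1\<close>.\<close>
  have n: "Suc (N - m) \<le> N - 1" "Suc (N - m) mod 2 = (N - 1) mod 2" using False m by (cases "m = 1"; auto simp: mod2_eq_if)+
  have "t = q * r * x / z" if "1 / (q * x) / r = 1 / (t * z)" "r \<noteq> 0" for r
    using that by (simp add: divide_eq_eq eq_divide_eq mult_ac)
  moreover have "t = q * r * x * z" if "z = t * (1 / (q * x) / r)" "r \<noteq> 0" for r
    using that by (subst that(1)) simp
  ultimately show ?thesis
    using twist_generic(3,4)[OF n] False by (auto simp: sc.xs_def)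
qed

section \<open>The representation matrices and their kernel\<close>

abbreviation R :: "free \<Rightarrow> complex mat" where "R \<equiv> spin_free N \<eta> \<omega>\<^sub>1 \<omega>\<^sub>2 \<theta>"

lemma spin_word_action:
  "set u \<subseteq> {0..N} \<Longrightarrow> spin_word N \<eta> \<omega>\<^sub>1 \<omega>\<^sub>2 \<theta> (Word u) \<in> carrier_mat (2 ^ N) (2 ^ N) \<and>
    (\<forall>v\<in>carrier_vec (2 ^ N). to_cfun N (spin_word N \<eta> \<omega>\<^sub>1 \<omega>\<^sub>2 \<theta> (Word u) *\<^sub>v v)
      = eval_word sc.T u (to_cfun N v))"
proof (induction u)
  case Nil
  then show ?case by (simp add: spin_word_def eval_word_def)
next
  case (Cons i u)
  let ?M = "spin_word N \<eta> \<omega>\<^sub>1 \<omega>\<^sub>2 \<theta> (Word u)" and ?G = "spin_gen N \<eta> \<omega>\<^sub>1 \<omega>\<^sub>2 \<theta> i"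
  have M: "?M \<in> carrier_mat (2 ^ N) (2 ^ N)" using Cons by simp
  have G: "?G \<in> carrier_mat (2 ^ N) (2 ^ N)" using Cons.prems N_ge by (intro spin_gen_carrier) auto
  have eq: "spin_word N \<eta> \<omega>\<^sub>1 \<omega>\<^sub>2 \<theta> (Word (i # u)) = ?G * ?M"
    by (simp add: spin_word_def)
  have "to_cfun N ((?G * ?M) *\<^sub>v v) = eval_word sc.T (i # u) (to_cfun N v)" if v: "v \<in> carrier_vec (2 ^ N)" for v
  proof -
    have Mv: "?M *\<^sub>v v \<in> carrier_vec (2 ^ N)" using M v by simp
    have "(?G * ?M) *\<^sub>v v = ?G *\<^sub>v (?M *\<^sub>v v)" using G M v by simp
    then show ?thesis
      using to_cfun_spin_gen[OF _ _ Mv, of i \<eta> \<omega>\<^sub>1 \<omega>\<^sub>2 \<theta>] Cons v N_ge by (simp add: eval_word_def)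
  qed
  then show ?case
    unfolding eq using G M by auto
qed

lemma R_action:
  assumes p: "p \<in> carr N"
  shows "R p \<in> carrier_mat (2 ^ N) (2 ^ N)"
    and "v \<in> carrier_vec (2 ^ N) \<Longrightarrow> to_cfun N (R p *\<^sub>v v) = sc.ev p (to_cfun N v)"
proof -
  define M where "M = ring_mat TYPE(complex) (2 ^ N) ()"
  interpret M: ring M unfolding M_def by (rule ring_mat)
  have M: "carrier M = carrier_mat (2 ^ N) (2 ^ N)" "\<zero>\<^bsub>M\<^esub> = 0\<^sub>m (2 ^ N) (2 ^ N)" "A \<oplus>\<^bsub>M\<^esub> B = A + B" for A B
    by (simp_all add: M_def ring_mat_simps)
  let ?f = "\<lambda>w. Poly_Mapping.lookup p w \<cdot>\<^sub>m spin_word N \<eta> \<omega>\<^sub>1 \<omega>\<^sub>2 \<theta> w"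
  have word: "spin_word N \<eta> \<omega>\<^sub>1 \<omega>\<^sub>2 \<theta> w \<in> carrier_mat (2 ^ N) (2 ^ N)"
    "v \<in> carrier_vec (2 ^ N) \<Longrightarrow>
      to_cfun N (spin_word N \<eta> \<omega>\<^sub>1 \<omega>\<^sub>2 \<theta> w *\<^sub>v v) = eval_word sc.T (letters w) (to_cfun N v)"
    if "w \<in> Poly_Mapping.keys p" for w v
    using spin_word_action[of "letters w"] p that by (auto simp: carr_iff)
  have "finsum M ?f A \<in> carrier_mat (2 ^ N) (2 ^ N) \<and> (\<forall>v\<in>carrier_vec (2 ^ N). \<forall>c.
      to_cfun N (finsum M ?f A *\<^sub>v v) c =
      (\<Sum>w\<in>A. Poly_Mapping.lookup p w * eval_word sc.T (letters w) (to_cfun N v) c))"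
    if "finite A" "A \<subseteq> Poly_Mapping.keys p" for A
    using that
  proof (induction A rule: finite_induct)
    case empty
    have "to_cfun N (0\<^sub>m (2 ^ N) (2 ^ N) *\<^sub>v v) c = 0" if "v \<in> carrier_vec (2 ^ N)" for v c
      using that by (simp add: to_cfun_def scalar_prod_def)
    then show ?case by (simp add: M)
  next
    case (insert w A)
    have f: "?f \<in> A \<rightarrow> carrier M" "?f w \<in> carrier M"
      using insert.prems word by (auto simp: M)
    have eq: "finsum M ?f (insert w A) = ?f w + finsum M ?f A"
      using M.finsum_insert[OF insert.hyps(1,2) f] by (simp only: M)
    have IH: "finsum M ?f A \<in> carrier_mat (2 ^ N) (2 ^ N)" "\<And>v c. v \<in> carrier_vec (2 ^ N) \<Longrightarrow>
      to_cfun N (finsum M ?f A *\<^sub>v v) c =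
      (\<Sum>w\<in>A. Poly_Mapping.lookup p w * eval_word sc.T (letters w) (to_cfun N v) c)"
      using insert by auto
    have w: "spin_word N \<eta> \<omega>\<^sub>1 \<omega>\<^sub>2 \<theta> w \<in> carrier_mat (2 ^ N) (2 ^ N)"
      using word insert.prems by simp
    have "to_cfun N ((?f w + finsum M ?f A) *\<^sub>v v) c =
      (\<Sum>w\<in>insert w A. Poly_Mapping.lookup p w * eval_word sc.T (letters w) (to_cfun N v) c)"
      if v: "v \<in> carrier_vec (2 ^ N)" for v c
    proof -
      have "(?f w + finsum M ?f A) *\<^sub>v v
          = Poly_Mapping.lookup p w \<cdot>\<^sub>v (spin_word N \<eta> \<omega>\<^sub>1 \<omega>\<^sub>2 \<theta> w *\<^sub>v v) + finsum M ?f A *\<^sub>v v"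
        using w IH(1) v by (simp add: add_mult_distrib_mat_vec[where nr = "2 ^ N" and nc = "2 ^ N"] mat_vec_simps[where n = "2 ^ N"])
      moreover have "spin_word N \<eta> \<omega>\<^sub>1 \<omega>\<^sub>2 \<theta> w *\<^sub>v v \<in> carrier_vec (2 ^ N)"
        "finsum M ?f A *\<^sub>v v \<in> carrier_vec (2 ^ N)"
        using w IH(1) v by auto
      ultimately show ?thesis
        using IH(2)[OF v] word(2)[OF _ v, of w] insert by (simp add: to_cfun_simps)
    qed
    then show ?case
      unfolding eq using w IH(1) by auto
  qed
  from this[of "Poly_Mapping.keys p"]
  show "R p \<in> carrier_mat (2 ^ N) (2 ^ N)"
    and "v \<in> carrier_vec (2 ^ N) \<Longrightarrow> to_cfun N (R p *\<^sub>v v) = sc.ev p (to_cfun N v)"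
    by (auto simp: spin_free_def M_def eval_free_def)
qed

text \<open>\<open>F\<close> ranges over all functions of configurations. The operators leave sites
  outside \<open>1\<close> to \<open>N\<close> untouched, so the relations hold without a support
  condition on \<open>F\<close>.\<close>

definition kernel :: "free set"
  where "kernel = {p \<in> carr N. \<forall>F. sc.ev p F = (\<lambda>_. 0)}"

lemma kernel_diffI:
  "p \<in> carr N \<Longrightarrow> r \<in> carr N \<Longrightarrow> (\<And>F. sc.ev p F = sc.ev r F) \<Longrightarrow> p - r \<in> kernel"
  by (simp add: kernel_def sc.ev_minus fun_eq_iff)

lemma kernel_diffD: "p - r \<in> kernel \<Longrightarrow> sc.ev p F = sc.ev r F"
  by (simp add: kernel_def sc.ev_minus fun_eq_iff)

lemma kernel_carr: "p \<in> kernel \<Longrightarrow> p \<in> carr N"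
  unfolding kernel_def by blast

lemma kernel_closed:
  "p \<in> kernel \<Longrightarrow> r \<in> kernel \<Longrightarrow> p + r \<in> kernel"
  "p \<in> kernel \<Longrightarrow> - p \<in> kernel"
  "p \<in> kernel \<Longrightarrow> r \<in> carr N \<Longrightarrow> r * p \<in> kernel"
  "p \<in> kernel \<Longrightarrow> r \<in> carr N \<Longrightarrow> p * r \<in> kernel"
  using sc.ev_minus[of 0 p]
  by (auto simp: kernel_def sc.ev_plus fun_eq_iff)[2] (auto simp: kernel_def sc.ev_mult sc.ev_null)

lemma R_cong:
  assumes "p \<in> carr N" "r \<in> carr N" "p - r \<in> kernel"
  shows "R p = R r"
proof (rule mat_eq_action[where n = "2 ^ N"])
  fix v :: "complex vec" assume v: "v \<in> carrier_vec (2 ^ N)"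
  show "R p *\<^sub>v v = R r *\<^sub>v v"
  proof (rule to_cfun_inj[where N = N])
    show "R p *\<^sub>v v \<in> carrier_vec (2 ^ N)" "R r *\<^sub>v v \<in> carrier_vec (2 ^ N)"
      using R_action(1) assms v by (auto intro: mult_mat_vec_carrier)
    show "to_cfun N (R p *\<^sub>v v) = to_cfun N (R r *\<^sub>v v)"
      using R_action(2) assms v kernel_diffD by simp
  qed
qed (use R_action(1) assms in auto)

lemma free_alg_inv:
  assumes "p \<in> carr N" shows "\<ominus>\<^bsub>free_alg N\<^esub> p = - p"
proof -
  interpret F: ring "free_alg N" by (rule ring_free_alg)
  show ?thesis by (rule F.minus_equality) (use assms in auto)
qed

lemma free_alg_minus: "p \<in> carr N \<Longrightarrow> r \<in> carr N \<Longrightarrow> p \<ominus>\<^bsub>free_alg N\<^esub> r = p - r"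
  by (simp add: a_minus_def free_alg_inv)

lemma kernel_ideal: "ideal kernel (free_alg N)"
proof (rule idealI[OF ring_free_alg])
  interpret F: ring "free_alg N" by (rule ring_free_alg)
  show "subgroup kernel (add_monoid (free_alg N))"
  proof (rule F.add.subgroupI)
    show "kernel \<noteq> {}" by (auto simp: kernel_def intro!: exI[of _ 0])
  qed (auto simp: kernel_carr kernel_closed free_alg_inv)
qed (auto simp: kernel_closed)

lemma relations_carr: "tbtl_relations N \<eta> \<omega>\<^sub>1 \<omega>\<^sub>2 \<subseteq> carr N"
  unfolding tbtl_relations_def by (auto intro!: carr_diff carr_mult)

lemma relations_kernel: "tbtl_relations N \<eta> \<omega>\<^sub>1 \<omega>\<^sub>2 \<subseteq> kernel"
proof
  fix p assume p: "p \<in> tbtl_relations N \<eta> \<omega>\<^sub>1 \<omega>\<^sub>2"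
  have lt: "i < N" "0 < i" "i \<le> N" "Suc i \<le> N" "i - Suc 0 \<le> N" if "Suc 0 \<le> i" "i \<le> N - Suc 0" for i
    using that N_ge by simp_all
  from p show "p \<in> kernel"
    unfolding tbtl_relations_def
    by (auto intro!: kernel_diffI carr_mult simp: sc.ev_mult sc.T_square sc.T_braid sc.T_0_square sc.T_N_square
        sc.T_commute lt qnum_2 bweight_left bweight_right)
qed

abbreviation Itb :: "free set" where "Itb \<equiv> tbtl_ideal N \<eta> \<omega>\<^sub>1 \<omega>\<^sub>2"
abbreviation tb :: "free set ring" where "tb \<equiv> tbtl N \<eta> \<omega>\<^sub>1 \<omega>\<^sub>2"
abbreviation tcl :: "free \<Rightarrow> free set" where "tcl \<equiv> tbtl_class N \<eta> \<omega>\<^sub>1 \<omega>\<^sub>2"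

lemma Itb_ideal: "ideal Itb (free_alg N)"
  unfolding tbtl_ideal_def by (rule ring.genideal_ideal[OF ring_free_alg relations_carr])

lemma Itb_kernel: "Itb \<subseteq> kernel"
  unfolding tbtl_ideal_def
  by (rule ring.genideal_minimal[OF ring_free_alg kernel_ideal relations_kernel])

lemma tb_ring: "ring tb"
  unfolding tbtl_def by (rule ideal.quotient_is_ring[OF Itb_ideal])

lemma tcl_hom: "tcl \<in> Ring.ring_hom (free_alg N) tb"
  unfolding tbtl_def tbtl_class_def[abs_def] by (rule ideal.rcos_ring_hom[OF Itb_ideal])

lemma tcl_simps:
  "p \<in> carr N \<Longrightarrow> tcl p \<in> carrier tb"
  "p \<in> carr N \<Longrightarrow> r \<in> carr N \<Longrightarrow> tcl (p + r) = tcl p \<oplus>\<^bsub>tb\<^esub> tcl r"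
  "p \<in> carr N \<Longrightarrow> r \<in> carr N \<Longrightarrow> tcl (p * r) = tcl p \<otimes>\<^bsub>tb\<^esub> tcl r"
  "tcl 1 = \<one>\<^bsub>tb\<^esub>"
  using ring_hom_closed[OF tcl_hom] ring_hom_add[OF tcl_hom] ring_hom_mult[OF tcl_hom] ring_hom_one[OF tcl_hom]
  by simp_all

lemma tcl_surj: "a \<in> carrier tb \<Longrightarrow> \<exists>p\<in>carr N. a = tcl p"
  by (auto simp: tbtl_def tbtl_class_def FactRing_def A_RCOSETS_def')

lemma tcl_eq_iff: "p \<in> carr N \<Longrightarrow> r \<in> carr N \<Longrightarrow> tcl p = tcl r \<longleftrightarrow> p - r \<in> Itb"
  using ring.quotient_eq_iff_same_a_r_cos[OF ring_free_alg Itb_ideal, of p r]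
  by (simp add: free_alg_minus tbtl_class_def)

lemma tcl_0: "tcl 0 = \<zero>\<^bsub>tb\<^esub>"
  using ring_hom_zero[OF tcl_hom ring_free_alg tb_ring] by simp

lemma tcl_inv:
  assumes "p \<in> carr N" shows "\<ominus>\<^bsub>tb\<^esub> tcl p = tcl (- p)"
proof -
  interpret tb: ring tb by (rule tb_ring)
  show ?thesis
    by (rule tb.minus_equality) (use assms in \<open>simp_all add: tcl_simps(1) tcl_0 flip: tcl_simps(2)\<close>)
qed

lemma tcl_minus: "p \<in> carr N \<Longrightarrow> r \<in> carr N \<Longrightarrow> tcl p \<ominus>\<^bsub>tb\<^esub> tcl r = tcl (p - r)"
  by (simp add: a_minus_def tcl_inv flip: tcl_simps(2))

lemma spin_rep_tcl:
  assumes p: "p \<in> carr N"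
  shows "spin_rep N \<eta> \<omega>\<^sub>1 \<omega>\<^sub>2 \<theta> (tcl p) = R p"
proof -
  have "tcl p = (\<lambda>i. i + p) ` Itb"
    by (auto simp: tbtl_class_def a_r_coset_def')
  moreover have "R (i + p) = R p" if "i \<in> Itb" for i
  proof (rule R_cong)
    show "i + p \<in> carr N" using that Itb_kernel p by (auto simp: kernel_def)
    show "i + p - p \<in> kernel" using that Itb_kernel by auto
  qed (rule p)
  \<comment> \<open>Nonemptiness of the coset: its image is then a singleton, as
    \<open>the_elem\<close> requires.\<close>
  moreover have "0 \<in> Itb"
    using additive_subgroup.zero_closed[OF ideal.axioms(1)[OF Itb_ideal]] by simp
  ultimately have "R ` tcl p = {R p}" by auto
  then show ?thesis by (simp add: spin_rep_def)
qed

end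

lemma alt_eq_prod_list: "alt k = prod_list (map gen (filter (\<lambda>j. odd (j + k)) [0..<k]))"
proof (induction k rule: alt.induct)
  case (3 k)
  have "filter (\<lambda>j. odd (j + Suc (Suc k))) [0..<Suc (Suc k)]
      = filter (\<lambda>j. odd (j + k)) [0..<k] @ [Suc k]"
    by simp
  then show ?case using 3 by (simp del: upt_Suc)
qed simp_all

lemma alt_I:
  "even N \<Longrightarrow> alt N = I1 N" "even N \<Longrightarrow> alt (Suc N) = I2 N"
  "odd N \<Longrightarrow> alt N = I2 N" "odd N \<Longrightarrow> alt (Suc N) = I1 N"
  by (simp_all add: alt_eq_prod_list I1_def I2_def)

context generic_parameters
begin

lemma I_carr: "I1 N \<in> carr N" "I2 N \<in> carr N"
  unfolding I1_def I2_def by (rule carr_prod_list; auto simp del: upt_Suc)+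

lemma ev_prod_list: "sc.ev (prod_list (map gen u)) F = foldr sc.T u F"
  by (induction u) (simp_all add: sc.ev_mult)

lemma ev_I: "sc.ev (I1 N) F = sc.P 1 F" "sc.ev (I2 N) F = sc.P 0 F"
proof -
  have "[0..<Suc N] = 0 # [1..<Suc N]" by (simp add: upt_conv_Cons del: upt_Suc)
  then have "filter odd [0..<Suc N] = sc.alternate 1" "filter even [0..<Suc N] = sc.alternate 0"
    by (simp_all add: sc.alternate_def del: upt_Suc)
  then show "sc.ev (I1 N) F = sc.P 1 F" "sc.ev (I2 N) F = sc.P 0 F"
    unfolding I1_def I2_def by (simp_all add: ev_prod_list del: upt_Suc)
qed

lemma double_relations_kernel:
  "I1 N * I2 N * I1 N - scal b * I1 N \<in> kernel" "I2 N * I1 N * I2 N - scal b * I2 N \<in> kernel"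
proof -
  show "I1 N * I2 N * I1 N - scal b * I1 N \<in> kernel"
    by (rule kernel_diffI)
      (simp_all only: carr_mult carr_scal I_carr sc.ev_mult ev_I sc.ev_scal sc.double_relation_odd b_eq_bval)
  show "I2 N * I1 N * I2 N - scal b * I2 N \<in> kernel"
    by (rule kernel_diffI)
      (simp_all only: carr_mult carr_scal I_carr sc.ev_mult ev_I sc.ev_scal sc.double_relation_even b_eq_bval)
qed

section \<open>The ring of the double quotient\<close>

abbreviation Dtb :: "free set set" where "Dtb \<equiv> double_ideal N \<eta> \<omega>\<^sub>1 \<omega>\<^sub>2 b"
abbreviation A :: "free set set ring" where "A \<equiv> double_quot N \<eta> \<omega>\<^sub>1 \<omega>\<^sub>2 b"
abbreviation dcl :: "free set \<Rightarrow> free set set" where "dcl \<equiv> double_class N \<eta> \<omega>\<^sub>1 \<omega>\<^sub>2 b"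

text \<open>The second ideal lives in a ring of cosets, so the annihilator must be pushed forward to
  an ideal there before minimality of the generated ideal can be used.\<close>

lemma image_kernel_ideal: "ideal (tcl ` kernel) tb"
proof (rule idealI[OF tb_ring])
  interpret tb: ring tb by (rule tb_ring)
  note carr = kernel_carr
  show "subgroup (tcl ` kernel) (add_monoid tb)"
  proof (rule tb.add.subgroupI)
    show "tcl ` kernel \<subseteq> carrier tb" using carr tcl_simps(1) by blast
    show "tcl ` kernel \<noteq> {}" by (auto simp: kernel_def intro!: exI[of _ 0])
    fix a assume "a \<in> tcl ` kernel"
    then obtain p where p: "p \<in> kernel" "a = tcl p" by blast
    have "\<ominus>\<^bsub>tb\<^esub> a = tcl (- p)"
      unfolding p(2) by (rule tcl_inv[OF carr[OF p(1)]])
    then show "\<ominus>\<^bsub>tb\<^esub> a \<in> tcl ` kernel"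
      using kernel_closed(2)[OF p(1)] by blast
    fix c assume "c \<in> tcl ` kernel"
    then obtain r where r: "r \<in> kernel" "c = tcl r" by blast
    have "a \<oplus>\<^bsub>tb\<^esub> c = tcl (p + r)"
      unfolding p(2) r(2) by (rule tcl_simps(2)[symmetric]) (use p r carr in blast)+
    then show "a \<oplus>\<^bsub>tb\<^esub> c \<in> tcl ` kernel"
      using kernel_closed(1)[OF p(1) r(1)] by blast
  qed
  fix a y assume "a \<in> tcl ` kernel" and y: "y \<in> carrier tb"
  then obtain p where p: "p \<in> kernel" "a = tcl p" by blast
  obtain r where r: "r \<in> carr N" "y = tcl r" using tcl_surj[OF y] by blast
  have "y \<otimes>\<^bsub>tb\<^esub> a = tcl (r * p)" "a \<otimes>\<^bsub>tb\<^esub> y = tcl (p * r)"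
    unfolding p(2) r(2) by (rule tcl_simps(3)[symmetric]; use p r carr in blast)+
  then show "y \<otimes>\<^bsub>tb\<^esub> a \<in> tcl ` kernel" "a \<otimes>\<^bsub>tb\<^esub> y \<in> tcl ` kernel"
    using kernel_closed(3,4)[OF p(1) r(1)] by blast+
qed

lemma Dtb_ideal: "ideal Dtb tb"
  unfolding double_ideal_def
  by (rule ring.genideal_ideal[OF tb_ring]) (auto intro!: tcl_simps(1) simp: I_carr)

lemma Dtb_kernel: "Dtb \<subseteq> tcl ` kernel"
  unfolding double_ideal_def
  by (rule ring.genideal_minimal[OF tb_ring image_kernel_ideal]) (use double_relations_kernel in auto)

lemma A_ring: "ring A"
  unfolding double_quot_def by (rule ideal.quotient_is_ring[OF Dtb_ideal])

lemma dcl_hom: "dcl \<in> Ring.ring_hom tb A"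
  unfolding double_quot_def double_class_def[abs_def] by (rule ideal.rcos_ring_hom[OF Dtb_ideal])

definition proj :: "free \<Rightarrow> free set set" where "proj p = dcl (tcl p)"

lemma proj_simps:
  "p \<in> carr N \<Longrightarrow> proj p \<in> carrier A"
  "p \<in> carr N \<Longrightarrow> r \<in> carr N \<Longrightarrow> proj (p + r) = proj p \<oplus>\<^bsub>A\<^esub> proj r"
  "p \<in> carr N \<Longrightarrow> r \<in> carr N \<Longrightarrow> proj (p * r) = proj p \<otimes>\<^bsub>A\<^esub> proj r"
  "proj 1 = \<one>\<^bsub>A\<^esub>" "proj 0 = \<zero>\<^bsub>A\<^esub>"
  using ring_hom_closed[OF dcl_hom] ring_hom_add[OF dcl_hom] ring_hom_mult[OF dcl_hom]
    ring_hom_one[OF dcl_hom] ring_hom_zero[OF dcl_hom tb_ring A_ring]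
  by (simp_all add: proj_def tcl_simps tcl_0)

lemma proj_surj: "a \<in> carrier A \<Longrightarrow> \<exists>p\<in>carr N. a = proj p"
proof -
  assume "a \<in> carrier A"
  then obtain u where "u \<in> carrier tb" "a = dcl u"
    by (auto simp: double_quot_def double_class_def FactRing_def A_RCOSETS_def')
  then show ?thesis using tcl_surj by (auto simp: proj_def)
qed

lemma proj_eq_iff: "p \<in> carr N \<Longrightarrow> r \<in> carr N \<Longrightarrow> proj p = proj r \<longleftrightarrow> tcl (p - r) \<in> Dtb"
  using ring.quotient_eq_iff_same_a_r_cos[OF tb_ring Dtb_ideal, of "tcl p" "tcl r"]
  by (simp add: tcl_minus tcl_simps proj_def double_class_def)

lemma proj_eq_kernel:
  assumes "p \<in> carr N" "r \<in> carr N" "proj p = proj r"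
  shows "p - r \<in> kernel"
proof -
  obtain k where k: "k \<in> kernel" "tcl (p - r) = tcl k"
    using proj_eq_iff[OF assms(1,2)] assms(3) Dtb_kernel by blast
  have kc: "k \<in> carr N" using k(1) by (rule kernel_carr)
  \<comment> \<open>\<open>p - r\<close> and \<open>k\<close> have the same first class; their
    difference lies in \<open>Itb\<close>, hence also in \<open>kernel\<close>.\<close>
  have "p - r - k \<in> Itb" using k kc assms tcl_eq_iff[of "p - r" k] by simp
  then have "p - r - k \<in> kernel" using Itb_kernel by blast
  from kernel_closed(1)[OF this k(1)] show ?thesis by simp
qed

lemma proj_ev: "p \<in> carr N \<Longrightarrow> r \<in> carr N \<Longrightarrow> proj p = proj r \<Longrightarrow> sc.ev p F = sc.ev r F"
  using proj_eq_kernel kernel_diffD by blast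

lemma proj_relation:
  assumes "p - r \<in> tbtl_relations N \<eta> \<omega>\<^sub>1 \<omega>\<^sub>2" "p \<in> carr N" "r \<in> carr N"
  shows "proj p = proj r"
proof -
  have "p - r \<in> Itb"
    unfolding tbtl_ideal_def
    using ring.genideal_self[OF ring_free_alg relations_carr] assms(1) by blast
  then show ?thesis using tcl_eq_iff[OF assms(2,3)] by (simp add: proj_def)
qed

lemma proj_double:
  "proj (I1 N * I2 N * I1 N) = proj (scal b * I1 N)" "proj (I2 N * I1 N * I2 N) = proj (scal b * I2 N)"
proof -
  have "{tcl (I1 N * I2 N * I1 N - scal b * I1 N), tcl (I2 N * I1 N * I2 N - scal b * I2 N)} \<subseteq> Dtb"
    unfolding double_ideal_def
    by (rule ring.genideal_self[OF tb_ring]) (auto intro!: tcl_simps(1) simp: I_carr)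
  then show "proj (I1 N * I2 N * I1 N) = proj (scal b * I1 N)"
    "proj (I2 N * I1 N * I2 N) = proj (scal b * I2 N)"
    by (auto simp: proj_eq_iff I_carr)
qed

lemma bweight_nonzero: "bweight \<eta> \<omega>\<^sub>1 \<noteq> 0"
  using left[rule_format, of 0] left[rule_format, of "- 1"] by (simp add: bweight_def)

sublocale tl: tl_quotient N proj "bweight \<eta> \<omega>\<^sub>1" "bweight \<eta> \<omega>\<^sub>2" "qnum \<eta> 2" b
proof
  show "b \<noteq> 0" using bval_nonzero b_eq_bval by simp
  show "2 \<le> N" "bweight \<eta> \<omega>\<^sub>1 \<noteq> 0" using N_ge bweight_nonzero by simp_all
  show "proj (gen i * gen i) = proj (scal (qnum \<eta> 2) * gen i)" if "1 \<le> i" "i < N" for i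
  proof (rule proj_relation)
    have "i \<le> N - 1" using that by simp
    with that show "gen i * gen i - scal (qnum \<eta> 2) * gen i \<in> tbtl_relations N \<eta> \<omega>\<^sub>1 \<omega>\<^sub>2"
      unfolding tbtl_relations_def by blast
  qed (use that in auto)
  show "proj (gen 0 * gen 0) = proj (scal (bweight \<eta> \<omega>\<^sub>1) * gen 0)"
    by (rule proj_relation) (auto simp: tbtl_relations_def)
  show "proj (gen N * gen N) = proj (scal (bweight \<eta> \<omega>\<^sub>2) * gen N)"
    by (rule proj_relation) (auto simp: tbtl_relations_def)
  show "proj (gen i * gen j * gen i) = proj (gen i)" if "1 \<le> i" "i < N" "j = i + 1 \<or> j = i - 1" for i j
  proof (rule proj_relation)
    have "i \<le> N - 1" using that by simp
    with that show "gen i * gen j * gen i - gen i \<in> tbtl_relations N \<eta> \<omega>\<^sub>1 \<omega>\<^sub>2"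
      unfolding tbtl_relations_def by blast
    have "i \<le> N" "j \<le> N" using that by auto
    then show "gen i * gen j * gen i \<in> carr N" "gen i \<in> carr N" by auto
  qed
  show "proj (gen i * gen j) = proj (gen j * gen i)" if "i \<le> N" "j \<le> N" "i + 1 < j" for i j
  proof (rule proj_relation)
    show "gen i * gen j - gen j * gen i \<in> tbtl_relations N \<eta> \<omega>\<^sub>1 \<omega>\<^sub>2"
      using that unfolding tbtl_relations_def by blast
  qed (use that in auto)
  show "proj (alt N * alt (Suc N) * alt N) = proj (scal b * alt N)"
  proof (cases "even N")
    case True
    show ?thesis unfolding alt_I(1)[OF True] alt_I(2)[OF True] by (rule proj_double)
  next
    case False
    show ?thesis unfolding alt_I(3)[OF False] alt_I(4)[OF False] by (rule proj_double)
  qed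
  show "proj (p + r) = proj (p' + r')" "proj (p * r) = proj (p' * r')"
    if "p \<in> carr N" "p' \<in> carr N" "r \<in> carr N" "r' \<in> carr N" "proj p = proj p'" "proj r = proj r'"
    for p p' r r'
    using that by (simp_all add: proj_simps)
qed

section \<open>The cyclic vector and the comparison of dimensions\<close>

definition vac :: "complex vec"
  where "vac = vec (2 ^ N) (\<lambda>k. sc.pre N (SOME c. idx N c = k))"

lemma vac_carrier [simp]: "vac \<in> carrier_vec (2 ^ N)"
  by (simp add: vac_def)

lemma to_cfun_vac: "to_cfun N vac = sc.pre N"
proof (rule ext)
  fix c
  have "idx N (SOME d. idx N d = idx N c) = idx N c" 
    by (rule someI[of "\<lambda>d. idx N d = idx N c"]) (rule refl)
  \<comment> \<open>\<open>pre N\<close> sees only the sites \<open>1\<close> to \<open>N\<close>,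
    which the index determines, so the choice is harmless.\<close>
  then have "sc.pre N (SOME d. idx N d = idx N c) = sc.pre N c"
    unfolding sc.pre_def by (intro prod.cong) (auto dest: idx_inj)
  then show "to_cfun N vac c = sc.pre N c"
    by (simp add: to_cfun_def vac_def)
qed

lemma to_cfun_depends_on: "depends_on {1..N} (to_cfun N v)"
proof (rule depends_onI)
  fix c d :: "nat \<Rightarrow> bool" assume "\<And>k. k \<in> {1..N} \<Longrightarrow> c k = d k"
  then have "idx N c = idx N d" by (intro idx_cong) auto
  then show "to_cfun N v c = to_cfun N v d" by (simp add: to_cfun_def)
qed

lemma R_vac_carrier [simp]: "p \<in> carr N \<Longrightarrow> R p *\<^sub>v vac \<in> carrier_vec (2 ^ N)"
  by (rule mult_mat_vec_carrier[OF R_action(1) vac_carrier])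

lemma to_cfun_R_vac: "p \<in> carr N \<Longrightarrow> to_cfun N (R p *\<^sub>v vac) = sc.ev p (sc.pre N)"
  by (simp add: R_action(2) to_cfun_vac)

lemma R_vac_eq_iff:
  assumes "p \<in> carr N" "r \<in> carr N"
  shows "R p *\<^sub>v vac = R r *\<^sub>v vac \<longleftrightarrow> sc.ev p (sc.pre N) = sc.ev r (sc.pre N)"
proof
  assume "R p *\<^sub>v vac = R r *\<^sub>v vac"
  then have "to_cfun N (R p *\<^sub>v vac) = to_cfun N (R r *\<^sub>v vac)" by simp
  then show "sc.ev p (sc.pre N) = sc.ev r (sc.pre N)" using to_cfun_R_vac assms by simp
next
  assume "sc.ev p (sc.pre N) = sc.ev r (sc.pre N)"
  then have "to_cfun N (R p *\<^sub>v vac) = to_cfun N (R r *\<^sub>v vac)" using to_cfun_R_vac assms by simp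
  then show "R p *\<^sub>v vac = R r *\<^sub>v vac"
    by (rule to_cfun_inj[OF R_vac_carrier[OF assms(1)] R_vac_carrier[OF assms(2)]])
qed

lemma vac_cyclic:
  assumes "v \<in> carrier_vec (2 ^ N)"
  shows "\<exists>p\<in>carr N. R p *\<^sub>v vac = v"
proof -
  have "to_cfun N v \<in> sc.reach"
    by (rule sc.reach_all[OF generic_moves to_cfun_depends_on])
  then obtain p where "p \<in> carr N" "to_cfun N v = sc.ev p (sc.pre N)"
    by (auto simp: sc.reach_def)
  then show ?thesis
    using to_cfun_inj[of "R p *\<^sub>v vac" N v] assms to_cfun_R_vac by auto
qed

abbreviation E :: free where "E \<equiv> Eidem \<eta> \<omega>\<^sub>1 N"

lemma E_eq: "E = Eid (bweight \<eta> \<omega>\<^sub>1) N"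
  by (rule Eidem_eq_Eid)

lemma E_carr [simp]: "E \<in> carr N"
  unfolding E_eq by simp

lemma ev_E: "sc.ev (p * E) (sc.pre N) = sc.ev p (sc.pre N)"
  using sc.Eid_cyclic[OF x_square] by (simp add: sc.ev_mult E_eq bweight_left)

text \<open>Because \<open>E\<close> fixes the cyclic vector, one family of coefficients describes
  both \<open>p * E\<close> in the quotient and \<open>p\<close> applied to that vector. This
  couples the two dimension bounds.\<close>

lemma span_expansion:
  assumes "p \<in> carr N"
  obtains c where "proj (p * E) = proj (\<Sum>w | tl.valid w. scal (c w) * tl.rep w)"
    and "sc.ev p (sc.pre N) = (\<lambda>d. \<Sum>w | tl.valid w. c w * sc.ev (tl.rep w) (sc.pre N) d)"
proof -
  obtain c where c: "tl.sim (p * E) (\<Sum>w | tl.valid w. scal (c w) * tl.rep w)"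
    using tl.in_span_E_left_ideal[OF assms] unfolding tl.in_span_def E_eq by blast
  then have "sc.ev (p * E) (sc.pre N) = sc.ev (\<Sum>w | tl.valid w. scal (c w) * tl.rep w) (sc.pre N)"
    by (intro proj_ev) (auto simp: tl.sim_def)
  also have "\<dots> = (\<lambda>d. \<Sum>w | tl.valid w. c w * sc.ev (tl.rep w) (sc.pre N) d)"
    by (rule ext) (simp add: sc.ev_sum sc.ev_mult)
  finally show thesis
    using that[of c] c by (simp add: ev_E tl.sim_def)
qed

text \<open>The \<open>2 ^ N\<close> vectors obtained from the spanning set span a space of dimension \<open>2 ^ N\<close>.\<close>

lemma span_independent:
  assumes zero: "(\<lambda>d. \<Sum>w | tl.valid w. c w * sc.ev (tl.rep w) (sc.pre N) d) = (\<lambda>_. 0)"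
    and w: "tl.valid w"
  shows "c w = 0"
proof -
  obtain f where f: "bij_betw f {0..<(2::nat) ^ N} {w. tl.valid w}"
    using ex_bij_betw_nat_finite[OF tl.finite_valid] by (auto simp: tl.card_valid)
  have valid_f: "tl.valid (f k)" if "k < 2 ^ N" for k
    using bij_betwE[OF f] that by auto
  define g where "g k = R (tl.rep (f k)) *\<^sub>v vac" for k
  have g: "g k \<in> carrier_vec (2 ^ N)" "to_cfun N (g k) = sc.ev (tl.rep (f k)) (sc.pre N)" if "k < 2 ^ N" for k
    using valid_f[OF that] by (simp_all add: g_def to_cfun_R_vac)
  define B where "B = mat (2 ^ N) (2 ^ N) (\<lambda>(i, k). g k $ i)"
  have B: "B \<in> carrier_mat (2 ^ N) (2 ^ N)" by (simp add: B_def)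
  have Ba: "to_cfun N (B *\<^sub>v vec (2 ^ N) (\<lambda>k. a (f k)))
      = (\<lambda>d. \<Sum>w | tl.valid w. a w * sc.ev (tl.rep w) (sc.pre N) d)" for a
  proof (rule ext)
    fix d
    have "to_cfun N (B *\<^sub>v vec (2 ^ N) (\<lambda>k. a (f k))) d = (\<Sum>k\<in>{0..<2 ^ N}. g k $ idx N d * a (f k))"
      by (simp add: to_cfun_def B_def scalar_prod_def)
    also have "\<dots> = (\<Sum>k\<in>{0..<2 ^ N}. a (f k) * sc.ev (tl.rep (f k)) (sc.pre N) d)"
      by (rule sum.cong) (auto simp: g(2)[symmetric] to_cfun_def)
    also have "\<dots> = (\<Sum>w | tl.valid w. a w * sc.ev (tl.rep w) (sc.pre N) d)"
      by (rule sum.reindex_bij_betw[OF f])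
    finally show "to_cfun N (B *\<^sub>v vec (2 ^ N) (\<lambda>k. a (f k))) d
      = (\<Sum>w | tl.valid w. a w * sc.ev (tl.rep w) (sc.pre N) d)" .
  qed
  have Bc: "B *\<^sub>v vec (2 ^ N) a \<in> carrier_vec (2 ^ N)" for a
    using B by (auto intro: mult_mat_vec_carrier)
  \<comment> \<open>Cyclicity gives every vector as some \<open>p\<close> applied to
    \<open>vac\<close>, and the expansion of \<open>p * E\<close> rewrites it in the columns of
    \<open>B\<close>.\<close>
  have span: "\<exists>a\<in>carrier_vec (2 ^ N). B *\<^sub>v a = u" if u: "u \<in> carrier_vec (2 ^ N)" for u
  proof -
    obtain p where p: "p \<in> carr N" "R p *\<^sub>v vac = u" using vac_cyclic u by blast
    obtain a where a: "sc.ev p (sc.pre N) = (\<lambda>d. \<Sum>w | tl.valid w. a w * sc.ev (tl.rep w) (sc.pre N) d)"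
      using span_expansion[OF p(1)] by blast
    have "to_cfun N (B *\<^sub>v vec (2 ^ N) (\<lambda>k. a (f k))) = to_cfun N u"
      unfolding Ba a[symmetric] using p to_cfun_R_vac by auto
    then have "B *\<^sub>v vec (2 ^ N) (\<lambda>k. a (f k)) = u"
      using to_cfun_inj[OF Bc u] by blast
    then show ?thesis by (intro bexI[of _ "vec (2 ^ N) (\<lambda>k. a (f k))"]) auto
  qed
  have null: "B *\<^sub>v vec (2 ^ N) (\<lambda>k. c (f k)) = 0\<^sub>v (2 ^ N)"
  proof (rule to_cfun_inj[OF Bc])
    show "to_cfun N (B *\<^sub>v vec (2 ^ N) (\<lambda>k. c (f k))) = to_cfun N (0\<^sub>v (2 ^ N))"
      unfolding Ba zero by (simp add: to_cfun_def)
  qed simp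
  have c0: "vec (2 ^ N) (\<lambda>k. c (f k)) = 0\<^sub>v (2 ^ N)"
    by (rule spanning_imp_independent[OF B span _ null]) simp_all
  have "w \<in> f ` {0..<2 ^ N}" using bij_betw_imp_surj_on[OF f] w by simp
  then obtain k where k: "k < 2 ^ N" "f k = w" by auto
  have "vec (2 ^ N) (\<lambda>k. c (f k)) $ k = (0\<^sub>v (2 ^ N) :: complex vec) $ k" using c0 by simp
  then show ?thesis using k by simp
qed

text \<open>From left to right this is well-definedness of the map to the spin chain. From right to
  left it is injectivity: the coefficients of a vanishing vector vanish, and the same coefficients
  expand the class.\<close>

lemma proj_E_eq_iff:
  assumes p: "p \<in> carr N" and r: "r \<in> carr N"
  shows "proj (p * E) = proj (r * E) \<longleftrightarrow> R p *\<^sub>v vac = R r *\<^sub>v vac"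
proof
  assume "proj (p * E) = proj (r * E)"
  then have "sc.ev (p * E) (sc.pre N) = sc.ev (r * E) (sc.pre N)"
    using p r by (intro proj_ev) auto
  then show "R p *\<^sub>v vac = R r *\<^sub>v vac"
    using p r by (simp add: R_vac_eq_iff ev_E)
next
  assume "R p *\<^sub>v vac = R r *\<^sub>v vac"
  then have zero: "sc.ev (p - r) (sc.pre N) = (\<lambda>_. 0)"
    using p r by (simp add: R_vac_eq_iff sc.ev_minus fun_eq_iff)
  have pr: "p - r \<in> carr N" using p r by simp
  obtain c where c: "proj ((p - r) * E) = proj (\<Sum>w | tl.valid w. scal (c w) * tl.rep w)"
    "sc.ev (p - r) (sc.pre N) = (\<lambda>d. \<Sum>w | tl.valid w. c w * sc.ev (tl.rep w) (sc.pre N) d)"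
    using span_expansion[OF pr] by blast
  have "c w = 0" if "tl.valid w" for w
    using span_independent[OF _ that, of c] c(2) zero by simp
  then have "proj ((p - r) * E) = proj 0"
    unfolding c(1) by (intro arg_cong[where f = proj]) simp
  then have "proj ((p - r) * E + r * E) = proj (0 + r * E)"
    using p r proj_simps(2)[of "(p - r) * E" "r * E"] proj_simps(2)[of 0 "r * E"] by simp
  then show "proj (p * E) = proj (r * E)" by (simp add: left_diff_distrib)
qed

section \<open>The two modules and their isomorphism\<close>

abbreviation W :: "(free set, free set set) module" where "W \<equiv> W_module N \<eta> \<omega>\<^sub>1 \<omega>\<^sub>2 b"
abbreviation S :: "(free set, complex vec) module" where "S \<equiv> spin_module N \<eta> \<omega>\<^sub>1 \<omega>\<^sub>2 \<theta>"

lemma W_simps: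
  "carrier W = (\<lambda>p. proj (p * E)) ` carr N" "\<zero>\<^bsub>W\<^esub> = proj 0" "u \<oplus>\<^bsub>W\<^esub> v = u \<oplus>\<^bsub>A\<^esub> v"
  "p \<in> carr N \<Longrightarrow> tcl p \<odot>\<^bsub>W\<^esub> u = proj p \<otimes>\<^bsub>A\<^esub> u"
proof -
  have "{x \<otimes>\<^bsub>A\<^esub> proj E |x. x \<in> carrier A} = (\<lambda>p. proj (p * E)) ` carr N"
    using proj_surj proj_simps(1) by (fastforce simp: proj_simps(3))
  then show "carrier W = (\<lambda>p. proj (p * E)) ` carr N"
    by (simp add: W_module_def Let_def proj_def)
  show "\<zero>\<^bsub>W\<^esub> = proj 0"
    by (simp add: W_module_def Let_def proj_simps(5))
qed (simp_all add: W_module_def Let_def proj_def)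

lemma S_simps:
  "carrier S = carrier_vec (2 ^ N)" "\<zero>\<^bsub>S\<^esub> = 0\<^sub>v (2 ^ N)" "u \<oplus>\<^bsub>S\<^esub> v = u + v"
  "p \<in> carr N \<Longrightarrow> tcl p \<odot>\<^bsub>S\<^esub> u = R p *\<^sub>v u"
  by (simp_all add: spin_module_def spin_rep_tcl)

lemma R_simps:
  assumes p: "p \<in> carr N" and r: "r \<in> carr N" and v: "v \<in> carrier_vec (2 ^ N)"
  shows "R (p + r) *\<^sub>v v = R p *\<^sub>v v + R r *\<^sub>v v" "R (p * r) *\<^sub>v v = R p *\<^sub>v (R r *\<^sub>v v)"
    "R 1 *\<^sub>v v = v" "R p *\<^sub>v v \<in> carrier_vec (2 ^ N)"
proof -
  have closed: "R u *\<^sub>v w \<in> carrier_vec (2 ^ N)" if "u \<in> carr N" "w \<in> carrier_vec (2 ^ N)" for u w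
    using R_action(1) that by (auto intro: mult_mat_vec_carrier)
  note closed [simp]
  show "R (p + r) *\<^sub>v v = R p *\<^sub>v v + R r *\<^sub>v v"
    by (rule to_cfun_inj[where N = N])
      (use assms in \<open>auto simp: R_action(2) to_cfun_simps sc.ev_plus fun_eq_iff\<close>)
  show "R (p * r) *\<^sub>v v = R p *\<^sub>v (R r *\<^sub>v v)"
    by (rule to_cfun_inj[where N = N])
      (use assms in \<open>auto simp: R_action(2) sc.ev_mult\<close>)
  show "R 1 *\<^sub>v v = v"
    by (rule to_cfun_inj[where N = N])
      (use assms in \<open>auto simp: R_action(2)\<close>)
  show "R p *\<^sub>v v \<in> carrier_vec (2 ^ N)" using assms by simp
qed

lemma S_module: "left_module tb S"
proof -
  have "abelian_group S"
  proof (rule abelian_groupI)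
    fix v assume "v \<in> carrier S"
    then show "\<exists>w\<in>carrier S. w \<oplus>\<^bsub>S\<^esub> v = \<zero>\<^bsub>S\<^esub>"
      by (intro bexI[of _ "- v"]) (auto simp: S_simps)
  qed (auto simp: S_simps add.commute intro: assoc_add_vec comm_add_vec)
  then show ?thesis
    unfolding left_module_def
  proof (intro conjI tb_ring)
    show "left_module_axioms tb S"
    proof
      fix a c u v assume "a \<in> carrier tb" "u \<in> carrier S"
      then obtain p where p: "p \<in> carr N" "a = tcl p" and u: "u \<in> carrier_vec (2 ^ N)"
        using tcl_surj by (auto simp: S_simps)
      show "a \<odot>\<^bsub>S\<^esub> u \<in> carrier S"
        using p u R_simps(4) by (simp add: S_simps)
      show "a \<odot>\<^bsub>S\<^esub> (u \<oplus>\<^bsub>S\<^esub> v) = a \<odot>\<^bsub>S\<^esub> u \<oplus>\<^bsub>S\<^esub> a \<odot>\<^bsub>S\<^esub> v" if "v \<in> carrier S"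
        using p u that mult_add_distrib_mat_vec[OF R_action(1)] by (simp add: S_simps)
      assume "c \<in> carrier tb"
      then obtain r where r: "r \<in> carr N" "c = tcl r"
        using tcl_surj by auto
      show "(a \<oplus>\<^bsub>tb\<^esub> c) \<odot>\<^bsub>S\<^esub> u = a \<odot>\<^bsub>S\<^esub> u \<oplus>\<^bsub>S\<^esub> c \<odot>\<^bsub>S\<^esub> u"
        using p r u R_simps(1) by (simp add: S_simps flip: tcl_simps(2))
      show "(a \<otimes>\<^bsub>tb\<^esub> c) \<odot>\<^bsub>S\<^esub> u = a \<odot>\<^bsub>S\<^esub> (c \<odot>\<^bsub>S\<^esub> u)"
        using p r u R_simps(2) by (simp add: S_simps flip: tcl_simps(3))
    next
      fix u assume "u \<in> carrier S"
      then show "\<one>\<^bsub>tb\<^esub> \<odot>\<^bsub>S\<^esub> u = u"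
        \<comment> \<open>The zeros only fill the two algebra elements in the shared assumptions of
          \<open>R_simps\<close>.\<close>
        using R_simps(3)[of 0 0 u] by (simp add: S_simps flip: tcl_simps(4))
    qed
  qed
qed

lemma W_module: "left_module tb W"
proof -
  interpret A: ring A by (rule A_ring)
  have in_A: "u \<in> carrier A" if "u \<in> carrier W" for u
    using that proj_simps(1) by (auto simp: W_simps)
  have add: "proj (p * E) \<oplus>\<^bsub>A\<^esub> proj (r * E) = proj ((p + r) * E)" if "p \<in> carr N" "r \<in> carr N" for p r
    using that by (simp add: distrib_right proj_simps(2))
  have "abelian_group W"
  proof (rule abelian_groupI)
    fix u v assume "u \<in> carrier W" "v \<in> carrier W"
    then show "u \<oplus>\<^bsub>W\<^esub> v \<in> carrier W" "u \<oplus>\<^bsub>W\<^esub> v = v \<oplus>\<^bsub>W\<^esub> u"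
      using in_A A.a_comm by (auto simp: W_simps add)
  next
    have "proj 0 = proj (0 * E)" by simp
    then show "\<zero>\<^bsub>W\<^esub> \<in> carrier W" unfolding W_simps by (intro image_eqI[of _ _ 0]) auto
  next
    fix u assume u: "u \<in> carrier W"
    then show "\<zero>\<^bsub>W\<^esub> \<oplus>\<^bsub>W\<^esub> u = u"
      using in_A by (simp add: W_simps(2,3) proj_simps(5))
    from u obtain p where p: "p \<in> carr N" "u = proj (p * E)" by (auto simp: W_simps)
    then have "proj (- p * E) \<oplus>\<^bsub>A\<^esub> u = proj 0"
      using add[of "- p" p] by simp
    then show "\<exists>v\<in>carrier W. v \<oplus>\<^bsub>W\<^esub> u = \<zero>\<^bsub>W\<^esub>"
      unfolding W_simps using p(1) by (intro bexI[of _ "proj (- p * E)"] image_eqI[of _ _ "- p"]) auto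
  next
    fix u v w assume "u \<in> carrier W" "v \<in> carrier W" "w \<in> carrier W"
    then show "u \<oplus>\<^bsub>W\<^esub> v \<oplus>\<^bsub>W\<^esub> w = u \<oplus>\<^bsub>W\<^esub> (v \<oplus>\<^bsub>W\<^esub> w)"
      using in_A A.a_assoc by (simp add: W_simps(3))
  qed
  then show ?thesis
    unfolding left_module_def
  proof (intro conjI tb_ring)
    show "left_module_axioms tb W"
    proof
      fix a c u v assume "a \<in> carrier tb" and uW: "u \<in> carrier W"
      then obtain p where p: "p \<in> carr N" "a = tcl p" using tcl_surj by auto
      note pA = proj_simps(1)[OF p(1)] and uA = in_A[OF uW]
      obtain s where s: "s \<in> carr N" "u = proj (s * E)" using uW by (auto simp: W_simps)
      have "proj p \<otimes>\<^bsub>A\<^esub> u = proj ((p * s) * E)"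
        using p s by (simp add: mult.assoc proj_simps(3))
      then show "a \<odot>\<^bsub>W\<^esub> u \<in> carrier W"
        using p s by (auto simp: W_simps)
      show "a \<odot>\<^bsub>W\<^esub> (u \<oplus>\<^bsub>W\<^esub> v) = a \<odot>\<^bsub>W\<^esub> u \<oplus>\<^bsub>W\<^esub> a \<odot>\<^bsub>W\<^esub> v" if "v \<in> carrier W"
        using p pA uA in_A[OF that] by (simp add: W_simps(3,4) A.r_distr)
      assume "c \<in> carrier tb"
      then obtain r where r: "r \<in> carr N" "c = tcl r"
        using tcl_surj by auto
      note rA = proj_simps(1)[OF r(1)]
      show "(a \<oplus>\<^bsub>tb\<^esub> c) \<odot>\<^bsub>W\<^esub> u = a \<odot>\<^bsub>W\<^esub> u \<oplus>\<^bsub>W\<^esub> c \<odot>\<^bsub>W\<^esub> u"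
        using p r pA rA uA by (simp add: W_simps(3,4) proj_simps(2) A.l_distr flip: tcl_simps(2))
      show "(a \<otimes>\<^bsub>tb\<^esub> c) \<odot>\<^bsub>W\<^esub> u = a \<odot>\<^bsub>W\<^esub> (c \<odot>\<^bsub>W\<^esub> u)"
        using p r pA rA uA by (simp add: W_simps(4) proj_simps(3) A.m_assoc flip: tcl_simps(3))
    next
      fix u assume "u \<in> carrier W"
      then show "\<one>\<^bsub>tb\<^esub> \<odot>\<^bsub>W\<^esub> u = u"
        using in_A by (simp add: W_simps(4) proj_simps(4) flip: tcl_simps(4))
    qed
  qed
qed

text \<open>\<open>g\<close> chooses an algebra element producing \<open>v\<close> from
  \<open>vac\<close>. By \<open>proj_E_eq_iff\<close> the class of \<open>g v * E\<close> is
  independent of the choice, which makes \<open>f\<close> additive and equivariant.\<close>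

lemma isomorphic: "isomorphic_left_modules tb S W"
proof -
  have "\<forall>v\<in>carrier_vec (2 ^ N). \<exists>p. p \<in> carr N \<and> R p *\<^sub>v vac = v"
    using vac_cyclic by blast
  then obtain g where g: "\<And>v. v \<in> carrier_vec (2 ^ N) \<Longrightarrow> g v \<in> carr N"
    "\<And>v. v \<in> carrier_vec (2 ^ N) \<Longrightarrow> R (g v) *\<^sub>v vac = v"
    by (metis bchoice)
  define f where "f v = proj (g v * E)" for v
  have f_R: "f (R p *\<^sub>v vac) = proj (p * E)" if "p \<in> carr N" for p
    unfolding f_def using that g by (subst proj_E_eq_iff) auto
  have "bij_betw f (carrier S) (carrier W)"
    unfolding bij_betw_def
  proof
    show "inj_on f (carrier S)"
    proof (rule inj_onI)
      fix u v assume "u \<in> carrier S" "v \<in> carrier S" "f u = f v"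
      then show "u = v"
        unfolding f_def S_simps using g by (metis proj_E_eq_iff)
    qed
    show "f ` carrier S = carrier W"
    proof (rule subset_antisym; rule subsetI)
      fix y assume "y \<in> f ` carrier S"
      then show "y \<in> carrier W" using g by (auto simp: f_def S_simps W_simps)
    next
      fix y assume "y \<in> carrier W"
      then obtain p where "p \<in> carr N" "y = proj (p * E)" by (auto simp: W_simps)
      then show "y \<in> f ` carrier S"
        using f_R[of p] by (intro image_eqI[of _ _ "R p *\<^sub>v vac"]) (simp_all add: S_simps)
    qed
  qed
  moreover have "f (u \<oplus>\<^bsub>S\<^esub> v) = f u \<oplus>\<^bsub>W\<^esub> f v" if "u \<in> carrier S" "v \<in> carrier S" for u v
  proof -
    have uv: "g u \<in> carr N" "g v \<in> carr N" "R (g u) *\<^sub>v vac = u" "R (g v) *\<^sub>v vac = v"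
      using that g by (simp_all add: S_simps)
    then have "u \<oplus>\<^bsub>S\<^esub> v = R (g u + g v) *\<^sub>v vac" by (simp add: S_simps R_simps(1))
    then have "f (u \<oplus>\<^bsub>S\<^esub> v) = proj ((g u + g v) * E)" using f_R[of "g u + g v"] uv by simp
    also have "\<dots> = f u \<oplus>\<^bsub>W\<^esub> f v"
      using uv by (simp add: f_def W_simps(3) distrib_right proj_simps(2))
    finally show ?thesis .
  qed
  moreover have "f (a \<odot>\<^bsub>S\<^esub> v) = a \<odot>\<^bsub>W\<^esub> f v" if av: "a \<in> carrier tb" "v \<in> carrier S" for a v
  proof -
    obtain p where p: "p \<in> carr N" "a = tcl p" using tcl_surj[OF av(1)] by blast
    have v: "g v \<in> carr N" "R (g v) *\<^sub>v vac = v"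
      using av g by (simp_all add: S_simps)
    have "a \<odot>\<^bsub>S\<^esub> v = R (p * g v) *\<^sub>v vac" using p v by (simp add: S_simps R_simps(2))
    then have "f (a \<odot>\<^bsub>S\<^esub> v) = proj ((p * g v) * E)" using f_R[of "p * g v"] p v by simp
    also have "\<dots> = a \<odot>\<^bsub>W\<^esub> f v"
      using p v by (simp add: f_def W_simps(4) mult.assoc proj_simps(3))
    finally show ?thesis .
  qed
  ultimately have "f \<in> left_module_iso tb S W"
    by (simp add: left_module_iso_def)
  then show ?thesis
    using S_module W_module by (auto simp: isomorphic_left_modules_def)
qed

end

text \<open>The first conjunct guarantees that the value of \<open>spin_rep\<close> on a class is
  that of \<open>spin_free\<close> on any representative, so the module in the second conjunct
  really carries the spin chain representation.\<close>

theorem theorem5p24: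
  fixes N :: nat and \<eta> \<omega>\<^sub>1 \<omega>\<^sub>2 \<theta> b :: complex
  assumes "N \<ge> 2"
    and "\<forall>n::nat. n > 0 \<longrightarrow> qpow \<eta> 1 ^ n \<noteq> 1"
    and "\<forall>m::int. qnum \<eta> (\<omega>\<^sub>1 - of_int m) \<noteq> 0"
    and "qnum \<eta> \<omega>\<^sub>2 \<noteq> 0" and "qnum \<eta> (\<omega>\<^sub>2 + 1) \<noteq> 0"
    and "\<forall>n \<epsilon>. \<forall>\<epsilon>\<^sub>1 \<in> {1, - 1}. \<forall>\<epsilon>\<^sub>2 \<in> {1, - 1}.
           n \<le> N - 1 \<and> n mod 2 = (N - 1) mod 2 \<and> \<epsilon> \<in> {1, - 1} \<longrightarrow>
           qpow \<eta> \<theta> \<noteq> qpow \<eta> (\<epsilon> * (- of_nat n + \<epsilon>\<^sub>1 * \<omega>\<^sub>1 + \<epsilon>\<^sub>2 * \<omega>\<^sub>2))"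
    and "b = (if even N
              then qnum \<eta> ((\<omega>\<^sub>1 + \<omega>\<^sub>2 + 1 + \<theta>) / 2) * qnum \<eta> ((\<omega>\<^sub>1 + \<omega>\<^sub>2 + 1 - \<theta>) / 2)
                     / (qnum \<eta> (\<omega>\<^sub>1 + 1) * qnum \<eta> (\<omega>\<^sub>2 + 1))
              else - (qnum \<eta> ((\<omega>\<^sub>1 - \<omega>\<^sub>2 + \<theta>) / 2) * qnum \<eta> ((\<omega>\<^sub>1 - \<omega>\<^sub>2 - \<theta>) / 2)
                     / (qnum \<eta> (\<omega>\<^sub>1 + 1) * qnum \<eta> (\<omega>\<^sub>2 + 1))))"
  shows "(\<forall>p \<in> carrier (free_alg N).
            spin_rep N \<eta> \<omega>\<^sub>1 \<omega>\<^sub>2 \<theta> (tbtl_class N \<eta> \<omega>\<^sub>1 \<omega>\<^sub>2 p) = spin_free N \<eta> \<omega>\<^sub>1 \<omega>\<^sub>2 \<theta> p) \<and>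
         isomorphic_left_modules (tbtl N \<eta> \<omega>\<^sub>1 \<omega>\<^sub>2)
           (spin_module N \<eta> \<omega>\<^sub>1 \<omega>\<^sub>2 \<theta>) (W_module N \<eta> \<omega>\<^sub>1 \<omega>\<^sub>2 b)"
proof -
  interpret generic_parameters N \<eta> \<omega>\<^sub>1 \<omega>\<^sub>2 \<theta> b
    using assms by unfold_locales
  show ?thesis
    using spin_rep_tcl isomorphic by blast
qed

end
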